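(* Let $n\ge2$, $s\ge1$, $\omega\in\mathbf{C}^n$, $R_\omega>0$, $f=(f_1,\dots,f_s)\in(\mathbf{A}^2(\omega,R_\omega))^s$ and $x\in B(\omega,R_\omega)$, and put $\nu_x=\|x-\omega\|/R_\omega$. If $$c_0\,(1-\nu_x^2)^{\frac{n+1}{2}}\,\frac{\|f(x)\|}{R_\omega}+\nu_x<1$$ and $$\frac{(n+1)(n+2)}{2}\,(1-\nu_x^2)^{\frac{n-1}{2}}\left(\frac{\|f\|}{R_\omega}\,\frac{1}{1-\nu_x^2}+1\right)\frac{\|f(x)\|}{R_\omega}\le\alpha_0,$$ then the Newton sequence $$(f^0,x_0)=(f,x),\qquad (f^{k+1},x_{k+1})=(f^k,x_k)-D\,\mathrm{eval}(f^k,x_k)^\dagger\,\mathrm{eval}(f^k,x_k),\quad k\ge0,$$ converges quadratically to some $(g,y)\in(\mathbf{A}^2(\omega,R_\omega))^s\times B(\omega,R_\omega)$ satisfying $g(y)=0$, and moreover $$\big(\|f-g\|^2+\|x-y\|^2\big)^{1/2}\le c_0\,(1-\nu_x^2)^{\frac{n+1}{2}}\,\|f(x)\|.$$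
   Context: $B(\omega,R_\omega)\subset\mathbf{C}^n$ is the open Euclidean ball. $\mathbf{A}^2(\omega,R_\omega)$ is the Hilbert space of analytic square-integrable functions on $B(\omega,R_\omega)$ with inner product $\langle f,g\rangle=\frac{c_n}{R_\omega^{2n}}\int_{B(\omega,R_\omega)}f(z)\overline{g(z)}\,dz$, $c_n=n!/\pi^n$ (integration with respect to Lebesgue measure, normalized by the volume of the ball). $(\mathbf{A}^2(\omega,R_\omega))^s$ has the inner product $\langle f,g\rangle=\sum_{i=1}^s\langle f_i,g_i\rangle$; $\|f\|$ denotes the associated norm, while $\|f(x)\|$, $\|x-y\|$ are Euclidean norms on $\mathbf{C}^s$, $\mathbf{C}^n$. The space $(\mathbf{A}^2(\omega,R_\omega))^s\times\mathbf{C}^n$ has the product Hilbert structure. The evaluation map $\mathrm{eval}:(\mathbf{A}^2(\omega,R_\omega))^s\times B(\omega,R_\omega)\to\mathbf{C}^s$ is $\mathrm{eval}(f,x)=f(x)$; its derivative is $D\,\mathrm{eval}(f,x)(g,y)=g(x)+Df(x)y$, and $^\dagger$ denotes the Moore–Penrose generalized inverse. Constants: $c_0=\sum_{k\ge0}(1/2)^{2^k-1}$, and $\alpha_0$ ($\approx0.13$) is the smallest positive root of $(1-4u+2u^2)^2-2u$. *)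

theory Defs
  imports "HOL-Analysis.Analysis"
begin

(* Complex differentiability at every point, which for open S is the usual notion of an
   analytic function of several complex variables (as for the one-variable holomorphic_on). *)
definition analytic_fun_on :: "(complex ^ 'n \<Rightarrow> complex) \<Rightarrow> (complex ^ 'n) set \<Rightarrow> bool" where
  "analytic_fun_on f S \<longleftrightarrow>
     (\<forall>z\<in>S. \<exists>f'. (f has_derivative f') (at z) \<and> Vector_Spaces.linear (*s) (*) f')"

(* A function on the ball is encoded as a total function vanishing outside the ball, so that
   equality of elements of the space is equality in HOL. *)
definition A2 :: "complex ^ 'n \<Rightarrow> real \<Rightarrow> (complex ^ 'n \<Rightarrow> complex) set" where
  "A2 \<omega> R = {f. analytic_fun_on f (ball \<omega> R)
               \<and> set_integrable lborel (ball \<omega> R) (\<lambda>z. (cmod (f z))\<^sup>2)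
               \<and> (\<forall>z. z \<notin> ball \<omega> R \<longrightarrow> f z = 0)}"

definition A2_inner ::
    "complex ^ 'n \<Rightarrow> real \<Rightarrow> (complex ^ 'n \<Rightarrow> complex) \<Rightarrow> (complex ^ 'n \<Rightarrow> complex) \<Rightarrow> complex" where
  "A2_inner \<omega> R f g =
     complex_of_real ((fact CARD('n) / pi ^ CARD('n)) / R ^ (2 * CARD('n)))
     * (LINT z:ball \<omega> R|lborel. f z * cnj (g z))"

text \<open>An element of the s-fold power is encoded as one vector-valued function.\<close>

definition A2s :: "complex ^ 'n \<Rightarrow> real \<Rightarrow> (complex ^ 'n \<Rightarrow> complex ^ 's) set" where
  "A2s \<omega> R = {f. \<forall>i. (\<lambda>z. f z $ i) \<in> A2 \<omega> R}"

definition A2s_inner ::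
    "complex ^ 'n \<Rightarrow> real \<Rightarrow> (complex ^ 'n \<Rightarrow> complex ^ 's) \<Rightarrow> (complex ^ 'n \<Rightarrow> complex ^ 's)
     \<Rightarrow> complex" where
  "A2s_inner \<omega> R f g = (\<Sum>i\<in>UNIV. A2_inner \<omega> R (\<lambda>z. f z $ i) (\<lambda>z. g z $ i))"

definition A2s_norm :: "complex ^ 'n \<Rightarrow> real \<Rightarrow> (complex ^ 'n \<Rightarrow> complex ^ 's) \<Rightarrow> real" where
  "A2s_norm \<omega> R f = sqrt (Re (A2s_inner \<omega> R f f))"

definition vec_inner :: "complex ^ 'm \<Rightarrow> complex ^ 'm \<Rightarrow> complex" where
  "vec_inner u v = (\<Sum>i\<in>UNIV. u $ i * cnj (v $ i))"

type_synonym ('n, 's) point = "(complex ^ 'n \<Rightarrow> complex ^ 's) \<times> (complex ^ 'n)"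

definition prod_inner ::
    "complex ^ 'n \<Rightarrow> real \<Rightarrow> ('n::finite, 's::finite) point \<Rightarrow> ('n, 's) point \<Rightarrow> complex" where
  "prod_inner \<omega> R p q = A2s_inner \<omega> R (fst p) (fst q) + vec_inner (snd p) (snd q)"

definition prod_norm :: "complex ^ 'n \<Rightarrow> real \<Rightarrow> ('n::finite, 's::finite) point \<Rightarrow> real" where
  "prod_norm \<omega> R p = sqrt (Re (prod_inner \<omega> R p p))"

(* The four Penrose equations for A : V -> 'b, where V is a subspace of 'a with inner product
   innerV.  They determine X uniquely and, for linear A, force X to be linear. *)
definition penrose ::
    "'a set \<Rightarrow> ('a \<Rightarrow> 'a \<Rightarrow> complex) \<Rightarrow> ('b \<Rightarrow> 'b \<Rightarrow> complex) \<Rightarrow> ('a \<Rightarrow> 'b) \<Rightarrow> ('b \<Rightarrow> 'a) \<Rightarrow> bool" where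
  "penrose V innerV innerW A X \<longleftrightarrow>
     range X \<subseteq> V \<and>
     (\<forall>v\<in>V. A (X (A v)) = A v) \<and>
     (\<forall>w. X (A (X w)) = X w) \<and>
     (\<forall>w w'. innerW (A (X w)) w' = innerW w (A (X w'))) \<and>
     (\<forall>v\<in>V. \<forall>v'\<in>V. innerV (X (A v)) v' = innerV v (X (A v')))"

definition moore_penrose ::
    "'a set \<Rightarrow> ('a \<Rightarrow> 'a \<Rightarrow> complex) \<Rightarrow> ('b \<Rightarrow> 'b \<Rightarrow> complex) \<Rightarrow> ('a \<Rightarrow> 'b) \<Rightarrow> ('b \<Rightarrow> 'a)" where
  "moore_penrose V innerV innerW A = (THE X. penrose V innerV innerW A X)"

definition evaluation :: "('n::finite, 's::finite) point \<Rightarrow> complex ^ 's" where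
  "evaluation p = (fst p) (snd p)"

definition D_evaluation ::
    "('n::finite, 's::finite) point \<Rightarrow> ('n, 's) point \<Rightarrow> complex ^ 's" where
  "D_evaluation p q = (fst q) (snd p) + frechet_derivative (fst p) (at (snd p)) (snd q)"

primrec newton_seq ::
    "complex ^ 'n \<Rightarrow> real \<Rightarrow> ('n::finite, 's::finite) point \<Rightarrow> nat \<Rightarrow> ('n, 's) point" where
  "newton_seq \<omega> R p 0 = p"
| "newton_seq \<omega> R p (Suc k) =
     newton_seq \<omega> R p k
     - moore_penrose (A2s \<omega> R \<times> UNIV) (prod_inner \<omega> R) vec_inner
         (D_evaluation (newton_seq \<omega> R p k)) (evaluation (newton_seq \<omega> R p k))"

definition converges_quadratically ::
    "('a::minus \<Rightarrow> real) \<Rightarrow> (nat \<Rightarrow> 'a) \<Rightarrow> 'a \<Rightarrow> bool" where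
  "converges_quadratically N p l \<longleftrightarrow>
     (\<lambda>k. N (p k - l)) \<longlonglongrightarrow> 0 \<and>
     (\<exists>C. \<forall>k. N (p (Suc k) - l) \<le> C * (N (p k - l))\<^sup>2)"

definition c0 :: real where
  "c0 = (\<Sum>k. (1 / 2) ^ (2 ^ k - 1))"

definition alpha0 :: real where
  "alpha0 = (LEAST u. 0 < u \<and> (1 - 4 * u + 2 * u\<^sup>2)\<^sup>2 - 2 * u = 0)"

end

theory Submission
  imports Defs "HOL-Complex_Analysis.Complex_Analysis" "HOL-Probability.Distributions"
begin

text \<open>Rotation invariance and the translation trick for the Gaussian weight show that
  \<open>(1 - \<langle>z, x\<rangle>)\<close> to the power \<open>- (n + 1)\<close> is the reproducing kernel of the unit ball.  Hence the
  Newton step, given by the adjoint of the derivative, has norm at most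
  \<open>\<beta> = (1 - \<nu>\<^sup>2)\<close> to the power \<open>(n + 1) / 2\<close>, times the norm of the value, and the first two derivatives of a function at a point of the ball are
  controlled by its norm.  Taylor's formula bounds the value after a step, so that the quantities
  \<open>\<beta>\<close> along the sequence satisfy \<open>\<beta>' \<le> \<Lambda> \<beta>\<^sup>2\<close> with one constant \<open>\<Lambda>\<close>, and the second hypothesis
  gives \<open>\<Lambda> \<beta> \<le> 1 / 2\<close> at the start: the steps are at most \<open>\<beta> / 2\<close> to the power \<open>2\<^sup>k - 1\<close>.\<close>

subsection \<open>The Hermitian inner product\<close>

text \<open>Rotation invariance enters only through multiplication by roots of unity: finite
  averages commute with integrals, and their limits extract single Taylor coefficients, so
  orthogonality of monomials and polar coordinates are avoided. The Gaussian appears because the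
  whole space admits translations, which a ball does not; homogeneity carries its moments back to
  the ball. One constant \<open>\<Lambda>\<close> must serve all steps although the weight
  \<open>1 - \<nu>\<^sup>2\<close> changes with the iterate. The obstacle is therefore to freeze
  this weight: dimension at least 2 makes the relative displacement \<open>\<tau>\<close> at most
  0.044 and \<open>(CARD('n) + 1) * \<tau>\<close> at most 0.132, so that the weight and its power
  with exponent \<open>CARD('n) + 1\<close> vary by bounded factors on the ball containing all
  iterates. The limit is found without completeness of the function space: every step changes the
  function by a kernel times a constant vector, so the limit function is \<open>f\<close> minus an
  explicit series of kernels with summable coefficients and base points in a smaller ball.\<close>

lemma Re_vec_inner: "Re (vec_inner u v) = u \<bullet> v"
  by (simp add: vec_inner_def inner_vec_def inner_complex_def)

lemma vec_inner_add_left: "vec_inner (u + v) w = vec_inner u w + vec_inner v w"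
  and vec_inner_add_right: "vec_inner w (u + v) = vec_inner w u + vec_inner w v"
  and vec_inner_diff_left: "vec_inner (u - v) w = vec_inner u w - vec_inner v w"
  and vec_inner_smult_left: "vec_inner (c *s u) w = c * vec_inner u w"
  and vec_inner_smult_right: "vec_inner w (c *s u) = cnj c * vec_inner w u"
  and vec_inner_scaleR_left: "vec_inner (r *\<^sub>R u) w = of_real r * vec_inner u w"
  and vec_inner_scaleR_right: "vec_inner w (r *\<^sub>R u) = of_real r * vec_inner w u"
  and vec_inner_zero_left [simp]: "vec_inner 0 w = 0"
  and vec_inner_zero_right [simp]: "vec_inner w 0 = 0"
  and vec_inner_minus_left [simp]: "vec_inner (-u) w = - vec_inner u w"
  and vec_inner_minus_right [simp]: "vec_inner w (-u) = - vec_inner w u"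
  by (simp_all add: vec_inner_def sum.distrib sum_subtractf sum_distrib_left sum_negf algebra_simps
      scaleR_conv_of_real[where 'a = complex])

lemma cnj_vec_inner: "cnj (vec_inner u v) = vec_inner v u"
  by (simp add: vec_inner_def mult.commute)

lemma vec_inner_self: "vec_inner u u = of_real ((norm u)\<^sup>2)"
proof (rule complex_eqI)
  have "cnj (vec_inner u u) = vec_inner u u" by (rule cnj_vec_inner)
  then have "Im (vec_inner u u) = 0" by (metis Reals_cnj_iff complex_is_Real_iff)
  then show "Im (vec_inner u u) = Im (of_real ((norm u)\<^sup>2))" by simp
qed (simp add: Re_vec_inner power2_norm_eq_inner)

lemma norm_smult_vec: "norm (c *s (u :: complex ^ 'm)) = cmod c * norm u"
  by (simp add: norm_vec_def norm_mult L2_set_right_distrib)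

text \<open>Multiplying \<open>u\<close> by a unimodular scalar makes the Hermitian product real and
  nonnegative, hence equal to the real inner product, where the real Cauchy-Schwarz inequality
  applies.\<close>

lemma norm_vec_inner_le: "cmod (vec_inner u v) \<le> norm u * norm v"
proof (cases "vec_inner u v = 0")
  case False
  define c where "c = cnj (sgn (vec_inner u v))"
  have c: "cmod c = 1" using False by (simp add: c_def norm_sgn)
  have "vec_inner (c *s u) v = (vec_inner u v * cnj (vec_inner u v)) / of_real (cmod (vec_inner u v))"
    by (simp add: vec_inner_smult_left c_def sgn_eq)
  also have "\<dots> = of_real (cmod (vec_inner u v))"
    using False by (simp add: power2_eq_square flip: complex_norm_square)
  finally have "vec_inner (c *s u) v = of_real (cmod (vec_inner u v))" .
  then have "cmod (vec_inner u v) = (c *s u) \<bullet> v" by (metis Re_complex_of_real Re_vec_inner)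
  also have "\<dots> \<le> norm (c *s u) * norm v" by (rule norm_cauchy_schwarz)
  finally show ?thesis by (simp add: norm_smult_vec c)
qed auto

lemma bounded_linear_vec_inner_left: "bounded_linear (\<lambda>u. vec_inner u v)"
  by (rule bounded_linear_intro[where K = "norm v"])
    (simp_all add: vec_inner_add_left vec_inner_scaleR_left scaleR_conv_of_real[where 'a = complex] norm_vec_inner_le)

lemma continuous_on_vec_inner [continuous_intros]:
  "continuous_on S f \<Longrightarrow> continuous_on S g \<Longrightarrow> continuous_on S (\<lambda>x. vec_inner (f x) (g x))"
  unfolding vec_inner_def by (intro continuous_intros)

lemma continuous_on_smult_vec [continuous_intros]:
  fixes g :: "_ \<Rightarrow> complex ^ 'm"
  shows "continuous_on S f \<Longrightarrow> continuous_on S g \<Longrightarrow> continuous_on S (\<lambda>x. f x *s g x)"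
  unfolding vector_scalar_mult_def by (intro continuous_intros)

lemma smult_vec_of_real: "complex_of_real r *s (u :: complex ^ 'm) = r *\<^sub>R u"
  by (simp add: vec_eq_iff scaleR_conv_of_real[where 'a = complex])

subsection \<open>Invariance of Lebesgue measure under linear isometries\<close>

text \<open>Evaluating the measure of \<open>{(x, y). x \<in> A \<and> y \<in> B}\<close> after the shears
  \<open>y \<mapsto> y + x\<close> and \<open>x \<mapsto> x - y\<close> shows that two translation invariant measures are proportional.\<close>

lemma translation_invariant_measures_proportional:
  fixes M :: "'a::euclidean_space measure"
  assumes sets: "sets M = sets borel" and "sigma_finite_measure M"
    and inv: "\<And>c. distr M borel (\<lambda>x. c + x) = M"
    and A[measurable]: "A \<in> sets borel" and B[measurable]: "B \<in> sets borel"
  shows "emeasure M A * emeasure lborel B = emeasure M B * emeasure lborel A"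
proof -
  interpret M: sigma_finite_measure M by fact
  interpret P: pair_sigma_finite M lborel ..
  note [measurable_cong] = sets
  have trM: "(\<integral>\<^sup>+x. h (c + x) \<partial>M) = (\<integral>\<^sup>+x. h x \<partial>M)" if [measurable]: "h \<in> borel_measurable borel" 
    for h :: "'a \<Rightarrow> ennreal" and c
    by (subst (2) inv[of c, symmetric]) (simp add: nn_integral_distr)
  have trl: "(\<integral>\<^sup>+x. h (c + x) \<partial>lborel) = (\<integral>\<^sup>+x. h x \<partial>lborel)" if [measurable]: "h \<in> borel_measurable borel" 
    for h :: "'a \<Rightarrow> ennreal" and c
    by (subst (2) lborel_distr_plus[of c, symmetric]) (simp add: nn_integral_distr)
  \<comment> \<open>The density factor of the affine map with coefficient -1 is 1, so reflections
    preserve Lebesgue measure too. This evaluates the inner integral of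
    \<open>indicator A (x - y)\<close> at the end.\<close>
  have rfl: "(\<integral>\<^sup>+x. h (c - x) \<partial>lborel) = (\<integral>\<^sup>+x. h x \<partial>lborel)" if [measurable]: "h \<in> borel_measurable borel" 
    for h :: "'a \<Rightarrow> ennreal" and c
    by (subst (2) lborel_affine[of "-1" c], simp) (simp add: nn_integral_distr nn_integral_density)
  have "emeasure M A * emeasure lborel B = (\<integral>\<^sup>+x. (\<integral>\<^sup>+y. indicator A x * indicator B y \<partial>lborel) \<partial>M)"
    by (simp add: nn_integral_cmult nn_integral_multc sets)
  also have "\<dots> = (\<integral>\<^sup>+x. (\<integral>\<^sup>+y. indicator A x * indicator B (x + y) \<partial>lborel) \<partial>M)"
    by (simp add: nn_integral_cmult trl)
  also have "\<dots> = (\<integral>\<^sup>+y. (\<integral>\<^sup>+x. indicator A x * indicator B (x + y) \<partial>M) \<partial>lborel)"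
    by (rule P.Fubini'[symmetric]) measurable
  also have "\<dots> = (\<integral>\<^sup>+y. (\<integral>\<^sup>+x. indicator A (-y + x) * indicator B x \<partial>M) \<partial>lborel)"
  proof (rule nn_integral_cong)
    fix y :: 'a
    show "(\<integral>\<^sup>+x. indicator A x * indicator B (x + y) \<partial>M) = (\<integral>\<^sup>+x. indicator A (-y + x) * indicator B x \<partial>M)"
      by (subst trM[of "\<lambda>x. indicator A x * indicator B (x + y)" "-y", symmetric]) (auto simp: algebra_simps)
  qed
  also have "\<dots> = (\<integral>\<^sup>+x. (\<integral>\<^sup>+y. indicator A (x - y) * indicator B x \<partial>lborel) \<partial>M)"
    by (simp add: P.Fubini'[of "\<lambda>x y. indicator A (x - y) * indicator B x"])
  also have "\<dots> = emeasure M B * emeasure lborel A"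
    proof -
    have "(\<integral>\<^sup>+y. indicator A (x - y) * indicator B x \<partial>lborel) = emeasure lborel A * indicator B x" for x
      by (subst nn_integral_multc) (simp_all add: rfl)
    then have "(\<integral>\<^sup>+x. (\<integral>\<^sup>+y. indicator A (x - y) * indicator B x \<partial>lborel) \<partial>M) = (\<integral>\<^sup>+x. emeasure lborel A * indicator B x \<partial>M)"
      by presburger
    also have "\<dots> = emeasure lborel A * emeasure M B"
      by (rule nn_integral_cmult_indicator) (simp add: sets)
    finally show ?thesis by (simp only: mult.commute)
  qed
  finally show ?thesis .
qed

text \<open>The image measure is translation invariant because \<open>T\<close> is onto, hence
  proportional to Lebesgue measure; the factor is 1 because \<open>T\<close> preserves the unit
  ball. No determinant is involved.\<close>

lemma lborel_distr_linear_isometry: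
  fixes T :: "'a::euclidean_space \<Rightarrow> 'a"
  assumes lin: "linear T" and norm: "\<And>x. norm (T x) = norm x"
  shows "distr lborel borel T = lborel"
proof -
  have bl: "bounded_linear T" using lin by (simp add: linear_conv_bounded_linear)
  have [measurable]: "T \<in> borel_measurable borel"
    by (intro borel_measurable_continuous_onI linear_continuous_on bl)
  define M where "M = distr lborel borel T"
  have ball: "emeasure M (ball 0 r) = emeasure lborel (ball (0::'a) r)" for r
    by (auto simp: M_def emeasure_distr norm vimage_def ball_def)
  have sigma: "sigma_finite_measure M"
  proof
    show "\<exists>A. countable A \<and> A \<subseteq> sets M \<and> \<Union>A = space M \<and> (\<forall>a\<in>A. emeasure M a \<noteq> \<infinity>)"
    proof (intro exI conjI)
      show "countable (range (\<lambda>k::nat. ball (0::'a) (real k)))" by simp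
      show "\<Union> (range (\<lambda>k::nat. ball (0::'a) (real k))) = space M"
        by (auto simp: M_def) (meson reals_Archimedean2)
      show "\<forall>a\<in>range (\<lambda>k::nat. ball (0::'a) (real k)). emeasure M a \<noteq> \<infinity>"
        using emeasure_lborel_ball_finite by (auto simp: ball less_top[symmetric])
    qed (auto simp: M_def)
  qed
  have inj: "inj T"
    unfolding linear_injective_0[OF lin] using norm by (metis norm_eq_zero)
  have surj: "surj T" using lin inj linear_injective_imp_surjective by blast
  have inv: "distr M borel (\<lambda>x. c + x) = M" for c
  proof -
    obtain d where d: "T d = c" using surj by (metis surjD)
    have "distr M borel (\<lambda>x. c + x) = distr lborel borel (\<lambda>x. T (d + x))"
      unfolding M_def by (simp add: distr_distr o_def linear_add[OF lin] d)
    also have "\<dots> = distr (distr lborel borel ((+) d)) borel T"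
      by (simp add: distr_distr o_def)
    finally show ?thesis by (simp add: lborel_distr_plus M_def)
  qed
  have pos: "emeasure lborel (ball (0::'a) 1) \<noteq> 0" "emeasure lborel (ball (0::'a) 1) \<noteq> \<infinity>"
    using emeasure_lborel_ball_finite[of "0::'a" 1] by (simp_all add: emeasure_ball less_imp_neq[OF unit_ball_vol_pos, symmetric])
  show ?thesis
  proof (rule measure_eqI)
    fix A assume "A \<in> sets (distr lborel borel T)"
    then have A: "A \<in> sets borel" by simp
    have "emeasure M A * emeasure lborel (ball (0::'a) 1) = emeasure lborel (ball (0::'a) 1) * emeasure lborel A"
      using translation_invariant_measures_proportional[OF _ sigma inv A, of "ball 0 1"]
      by (simp only: ball) (simp add: M_def)
    then show "emeasure (distr lborel borel T) A = emeasure lborel A"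
      using pos by (metis M_def ennreal_mult_cancel_left infinity_ennreal_def mult.commute top.not_eq_extremum)
  qed simp
qed

lemma lborel_distr_smult_vec:
  assumes "cmod c = 1"
  shows "distr lborel borel ((*s) c) = (lborel :: (complex ^ 'n) measure)"
proof (rule lborel_distr_linear_isometry)
  show "linear ((*s) c :: complex ^ 'n \<Rightarrow> _)"
    by (rule linearI) (simp_all add: vec_eq_iff algebra_simps)
qed (simp add: norm_smult_vec assms)

subsection \<open>Averages over roots of unity\<close>

definition root1 :: "nat \<Rightarrow> complex" where
  "root1 N = cis (2 * pi / real N)"

text \<open>The average over the \<open>N\<close>-th roots of unity stands in for a mean over the
  circle: being a finite sum, it passes through integrals by linearity. For \<open>N = 0\<close>
  division by zero makes it 0, which is harmless in limits.\<close>

definition circ_mean :: "nat \<Rightarrow> (complex \<Rightarrow> complex) \<Rightarrow> complex" where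
  "circ_mean N \<phi> = (\<Sum>j<N. \<phi> (root1 N ^ j)) / of_nat N"

lemma cmod_root1_power [simp]: "cmod (root1 N ^ j) = 1"
  by (simp add: root1_def norm_power)

lemma root1_power_eq: "root1 N ^ j = exp (2 * of_real pi * \<i> * of_nat j / of_nat N)"
  by (simp add: root1_def cis_conv_exp mult_ac flip: exp_of_nat_mult)

lemma cnj_unimodular: "cmod c = 1 \<Longrightarrow> cnj c = inverse c"
  by (metis complex_norm_square inverse_unique of_real_1 one_power2)

text \<open>Orthogonality of the characters of a cyclic group: the summands are the powers of one
  root of unity, which for exponents below \<open>N\<close> is 1 only if \<open>m = k\<close>;
  otherwise the geometric sum vanishes.\<close>

lemma circ_mean_power:
  assumes "k < N" "m < N"
  shows "circ_mean N (\<lambda>c. c ^ m * cnj c ^ k) = (if m = k then 1 else 0)"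
proof -
  have eq: "(root1 N ^ j) ^ m * cnj (root1 N ^ j) ^ k = (root1 N ^ m * inverse (root1 N ^ k)) ^ j" for j
    by (simp add: cnj_unimodular[of "root1 N ^ j"] power_mult_distrib power_inverse
        mult.commute[of j] del: complex_cnj_power flip: power_mult)
  have nz: "root1 N \<noteq> 0" by (metis cmod_root1_power norm_zero power_one_right zero_neq_one)
  have N: "(root1 N ^ m) ^ N = 1" for m
    using complex_root_unity[of N m] assms by (simp add: root1_power_eq)
  have neq: "root1 N ^ m * inverse (root1 N ^ k) \<noteq> 1" if "m \<noteq> k"
  proof
    assume "root1 N ^ m * inverse (root1 N ^ k) = 1"
    then have "root1 N ^ m = root1 N ^ k" using nz by (simp add: field_simps)
    then show False using that assms complex_root_unity_eq[of N m k] by (simp add: root1_power_eq)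
  qed
  show ?thesis
  proof (cases "m = k")
    case True
    then show ?thesis using assms nz unfolding circ_mean_def eq by simp
  next
    case False
    then show ?thesis unfolding circ_mean_def eq using neq[OF False] N
      by (subst geometric_sum) (simp_all add: power_mult_distrib power_inverse)
  qed
qed

lemma norm_circ_mean_le:
  assumes "\<And>c. cmod c = 1 \<Longrightarrow> cmod (\<phi> c) \<le> M" "M \<ge> 0"
  shows "cmod (circ_mean N \<phi>) \<le> M"
proof (cases "N = 0")
  case False
  have "cmod (\<Sum>j<N. \<phi> (root1 N ^ j)) \<le> (\<Sum>j<N. M)"
    by (rule sum_norm_le) (use assms in auto)
  then show ?thesis using False by (simp add: circ_mean_def norm_divide field_simps)
qed (use assms in \<open>simp add: circ_mean_def\<close>)

definition taylor_coeff :: "nat \<Rightarrow> (complex \<Rightarrow> complex) \<Rightarrow> complex" where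
  "taylor_coeff k \<phi> = (deriv ^^ k) \<phi> 0 / fact k"

lemma taylor_coeff_bound:
  assumes hol: "\<phi> holomorphic_on ball 0 \<rho>" and r: "0 < r" "r < \<rho>"
    and M: "\<And>c. c \<in> cball 0 r \<Longrightarrow> cmod (\<phi> c) \<le> M"
  shows "cmod (taylor_coeff k \<phi>) \<le> M / r ^ k"
proof -
  have "cmod ((deriv ^^ k) \<phi> 0) \<le> fact k * M / r ^ k"
  proof (rule Cauchy_inequality)
    show "\<phi> holomorphic_on ball 0 r" by (rule holomorphic_on_subset[OF hol]) (use r in auto)
    show "continuous_on (cball 0 r) \<phi>"
      by (rule holomorphic_on_imp_continuous_on, rule holomorphic_on_subset[OF hol]) (use r in auto)
    show "cmod (\<phi> x) \<le> M" if "cmod (0 - x) = r" for x using M that by auto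
  qed fact
  then show ?thesis by (simp add: taylor_coeff_def norm_divide field_simps)
qed

text \<open>Orthogonality picks out the coefficient \<open>k\<close> exactly among the degrees below
  \<open>N\<close>; only higher degrees contribute an error, a geometric tail by Cauchy's estimates.
  The bound depends on the function only through \<open>M\<close> and \<open>r\<close>, which later
  gives uniformity in a parameter.\<close>

lemma circ_mean_taylor_coeff:
  assumes hol: "\<phi> holomorphic_on ball 0 \<rho>" and r: "1 < r" "r < \<rho>"
    and M: "\<And>c. c \<in> cball 0 r \<Longrightarrow> cmod (\<phi> c) \<le> M" and k: "k < N"
  shows "cmod (circ_mean N (\<lambda>c. \<phi> c * cnj c ^ k) - taylor_coeff k \<phi>) \<le> M * (1 / r) ^ N * (r / (r - 1))"
proof -
  define a where "a m = taylor_coeff m \<phi>" for m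
  have a: "cmod (a m) \<le> M * (1 / r) ^ m" for m
    using taylor_coeff_bound[OF hol _ r(2) M, of m] r unfolding a_def 
    by (simp add: power_one_over divide_simps)
  have M0: "M \<ge> 0" using M[of 0] r norm_ge_zero[of "\<phi> 0"] by (simp del: norm_ge_zero)
  have sums: "(\<lambda>m. a m * c ^ m) sums \<phi> c" if "cmod c = 1" for c
    using holomorphic_power_series[OF hol, of c] that r by (simp add: a_def taylor_coeff_def)
  define d where "d m = circ_mean N (\<lambda>c. c ^ m * cnj c ^ k)" for m
  have d1: "cmod (d m) \<le> 1" for m
    unfolding d_def by (rule norm_circ_mean_le) (auto simp: norm_mult norm_power)
  have "(\<lambda>m. (\<Sum>j<N. a m * (root1 N ^ j) ^ m * cnj (root1 N ^ j) ^ k) / of_nat N) sums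
      ((\<Sum>j<N. \<phi> (root1 N ^ j) * cnj (root1 N ^ j) ^ k) / of_nat N)"
    by (intro sums_divide sums_sum sums_mult2 sums) auto
  moreover have "(\<Sum>j<N. a m * (root1 N ^ j) ^ m * cnj (root1 N ^ j) ^ k) / of_nat N = a m * d m" for m
    by (simp add: d_def circ_mean_def sum_distrib_left mult.assoc)
  ultimately have S: "(\<lambda>m. a m * d m) sums circ_mean N (\<lambda>c. \<phi> c * cnj c ^ k)"
    by (simp add: circ_mean_def)
  have "(\<Sum>m<N. a m * d m) = (\<Sum>m<N. if m = k then a k else 0)"
    by (rule sum.cong) (use k in \<open>auto simp: d_def circ_mean_power\<close>)
  also have "\<dots> = a k" using k by simp
  finally have T: "(\<lambda>m. a (m + N) * d (m + N)) sums (circ_mean N (\<lambda>c. \<phi> c * cnj c ^ k) - a k)"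
    using sums_split_initial_segment[OF S, of N] by simp
  have G: "(\<lambda>m. M * (1 / r) ^ N * (1 / r) ^ m) sums (M * (1 / r) ^ N * (1 / (1 - 1 / r)))"
    by (intro sums_mult geometric_sums) (use r in auto)
  have "cmod (circ_mean N (\<lambda>c. \<phi> c * cnj c ^ k) - a k) \<le> M * (1 / r) ^ N * (1 / (1 - 1 / r))"
  proof (rule norm_sums_le[OF T G])
    fix m
    have "cmod (a (m + N) * d (m + N)) \<le> M * (1 / r) ^ (m + N) * 1"
      unfolding norm_mult by (intro mult_mono a d1) (use M0 r in auto)
    then show "cmod (a (m + N) * d (m + N)) \<le> M * (1 / r) ^ N * (1 / r) ^ m"
      by (simp add: power_add mult_ac)
  qed
  moreover have "1 / (1 - 1 / r) = r / (r - 1)" using r by (simp add: field_simps)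
  ultimately show ?thesis by (simp add: a_def)
qed

lemma circ_mean_tendsto_taylor_coeff:
  assumes hol: "\<phi> holomorphic_on ball 0 \<rho>" and "1 < \<rho>"
  shows "(\<lambda>N. circ_mean N (\<lambda>c. \<phi> c * cnj c ^ k)) \<longlonglongrightarrow> taylor_coeff k \<phi>"
proof -
  define r where "r = (1 + \<rho>) / 2"
  have r: "1 < r" "r < \<rho>" using assms by (auto simp: r_def)
  have "compact (\<phi> ` cball 0 r)"
    by (intro compact_continuous_image holomorphic_on_imp_continuous_on holomorphic_on_subset[OF hol])
      (use r in auto)
  then obtain M where M: "\<And>c. c \<in> cball 0 r \<Longrightarrow> cmod (\<phi> c) \<le> M"
    by (meson bounded_iff compact_imp_bounded imageI)
  have "(\<lambda>N. M * (1 / r) ^ N * (r / (r - 1))) \<longlonglongrightarrow> M * 0 * (r / (r - 1))"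
    by (intro tendsto_intros LIMSEQ_power_zero) (use r in auto)
  then have lim: "(\<lambda>N. M * (1 / r) ^ N * (r / (r - 1))) \<longlonglongrightarrow> 0" by simp
  have "\<forall>\<^sub>F N in sequentially. norm (circ_mean N (\<lambda>c. \<phi> c * cnj c ^ k) - taylor_coeff k \<phi>) \<le> M * (1 / r) ^ N * (r / (r - 1))"
    using eventually_gt_at_top[of k] by eventually_elim (rule circ_mean_taylor_coeff[OF hol r M])
  from LIM_zero_cancel[OF Lim_null_comparison[OF this lim]] show ?thesis .
qed

subsection \<open>Homogeneous components\<close>

text \<open>Holomorphy on every complex line is what the one-variable arguments use, and it passes
  at once to locally uniform limits.\<close>

definition line_holomorphic :: "(complex ^ 'n \<Rightarrow> complex) \<Rightarrow> (complex ^ 'n) set \<Rightarrow> bool" where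
  "line_holomorphic f S \<longleftrightarrow> (\<forall>x y. (\<lambda>c. f (x + c *s y)) holomorphic_on {c. x + c *s y \<in> S})"

text \<open>The homogeneous component of degree \<open>k\<close> of the expansion at 0. A derivative
  at 0 sees only a germ, so it is defined for all \<open>z\<close>, also outside the ball; this
  allows integration over the whole space.\<close>

definition hom_part :: "nat \<Rightarrow> (complex ^ 'n \<Rightarrow> complex) \<Rightarrow> complex ^ 'n \<Rightarrow> complex" where
  "hom_part k f z = taylor_coeff k (\<lambda>c. f (c *s z))"

lemma line_holomorphic_ball_0:
  assumes "line_holomorphic f (ball 0 1)" and "\<rho> * norm z \<le> 1"
  shows "(\<lambda>c. f (c *s z)) holomorphic_on ball 0 \<rho>"
proof -
  have "(\<lambda>c. f (0 + c *s z)) holomorphic_on {c. 0 + c *s z \<in> ball 0 1}"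
    using assms(1) unfolding line_holomorphic_def by blast
  moreover have "ball 0 \<rho> \<subseteq> {c. 0 + c *s z \<in> ball 0 1}"
  proof
    fix c :: complex assume "c \<in> ball 0 \<rho>"
    then have c: "cmod c < \<rho>" by simp
    have "cmod c * norm z < 1"
    proof (cases "z = 0")
      case False
      then show ?thesis using assms(2) c by (meson less_le_trans mult_strict_right_mono zero_less_norm_iff)
    qed simp
    then show "c \<in> {c. 0 + c *s z \<in> ball 0 1}" by (simp add: norm_smult_vec)
  qed
  ultimately show ?thesis using holomorphic_on_subset by fastforce
qed

lemma hom_part_smult:
  assumes "line_holomorphic f (ball 0 1)"
  shows "hom_part k f (c *s z) = c ^ k * hom_part k f z"
proof -
  \<comment> \<open>The two radii keep \<open>c * w\<close> in a disc on which
    \<open>f (w *s z)\<close> is holomorphic in \<open>w\<close>; the added 1 takes care of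
    \<open>z = 0\<close> and \<open>c = 0\<close>.\<close>
  define \<rho> where "\<rho> = 1 / (norm z + 1)"
  have \<rho>: "\<rho> > 0" "\<rho> * norm z \<le> 1" by (auto simp: \<rho>_def field_simps add_pos_nonneg)
  define \<sigma> where "\<sigma> = \<rho> / (cmod c + 1)"
  have \<sigma>: "\<sigma> > 0" "\<sigma> * cmod c \<le> \<rho>" using \<rho>(1) by (auto simp: \<sigma>_def field_simps add_pos_nonneg)
  have "(deriv ^^ k) (\<lambda>w. f ((c * w) *s z)) 0 = c ^ k * (deriv ^^ k) (\<lambda>w. f (w *s z)) (c * 0)"
  proof (rule higher_deriv_compose_linear[where S = "ball 0 \<sigma>" and T = "ball 0 \<rho>"])
    show "(\<lambda>w. f (w *s z)) holomorphic_on ball 0 \<rho>" by (rule line_holomorphic_ball_0[OF assms \<rho>(2)])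
    fix w :: complex assume "w \<in> ball 0 \<sigma>"
    then have "cmod w * (cmod c + 1) < \<rho>" using \<sigma>(1) by (simp add: \<sigma>_def field_simps add_pos_nonneg)
    then show "c * w \<in> ball 0 \<rho>" using norm_ge_zero[of w] by (simp add: norm_mult algebra_simps del: norm_ge_zero)
  qed (use \<sigma> in auto)
  then show ?thesis
    by (simp add: hom_part_def taylor_coeff_def vector_smult_assoc mult.commute[of c])
qed

text \<open>Continuity is required separately: it gives bounds on smaller closed balls and
  measurability, and deducing it from holomorphy on lines would need a theorem of Hartogs
  type.\<close>

locale ball_holomorphic =
  fixes f :: "complex ^ 'n \<Rightarrow> complex"
  assumes line_hol: "line_holomorphic f (ball 0 1)"
    and cont: "continuous_on (ball 0 1) f"
begin

lemma bounded_on_cball: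
  assumes "s < 1"
  obtains M where "M \<ge> 0" "\<And>z. norm z \<le> s \<Longrightarrow> cmod (f z) \<le> M"
proof -
  have "compact (f ` cball 0 s)"
    by (intro compact_continuous_image continuous_on_subset[OF cont]) (use assms in auto)
  then obtain M where "\<And>z. z \<in> cball 0 s \<Longrightarrow> cmod (f z) \<le> M"
    by (meson bounded_iff compact_imp_bounded imageI)
  then show ?thesis using that[of "max M 0"] by (simp add: le_max_iff_disj)
qed

lemma hom_part_sums:
  assumes "norm z < 1"
  shows "(\<lambda>k. hom_part k f z) sums f z"
proof -
  define \<rho> where "\<rho> = 2 / (norm z + 1)"
  have \<rho>: "\<rho> > 1" "\<rho> * norm z \<le> 1" using assms by (auto simp: \<rho>_def field_simps add_pos_nonneg)
  from holomorphic_power_series[OF line_holomorphic_ball_0[OF line_hol \<rho>(2)], of 1] \<rho>(1)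
  show ?thesis by (simp add: hom_part_def taylor_coeff_def)
qed

lemma circ_mean_hom_part:
  assumes "norm z < 1"
  shows "(\<lambda>N. circ_mean N (\<lambda>c. f (c *s z) * cnj c ^ k)) \<longlonglongrightarrow> hom_part k f z"
proof -
  define \<rho> where "\<rho> = 2 / (norm z + 1)"
  have \<rho>: "\<rho> > 1" "\<rho> * norm z \<le> 1" using assms by (auto simp: \<rho>_def field_simps add_pos_nonneg)
  show ?thesis unfolding hom_part_def
    by (rule circ_mean_tendsto_taylor_coeff[OF line_holomorphic_ball_0[OF line_hol \<rho>(2)] \<rho>(1)])
qed

text \<open>The radii fit together: for \<open>z\<close> in the half ball the line function is
  holomorphic on the disc of radius 2, and on the disc of radius 3/2 the arguments of
  \<open>f\<close> have norm at most 3/4, where one bound \<open>M\<close> holds. Homogeneity later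
  extends conclusions from the half ball to all \<open>z\<close>.\<close>

lemma circ_mean_hom_part_uniform:
  "uniform_limit (cball 0 (1/2)) (\<lambda>N z. circ_mean N (\<lambda>c. f (c *s z) * cnj c ^ k)) (hom_part k f) sequentially"
proof -
  obtain M where M: "M \<ge> 0" "\<And>z. norm z \<le> 3/4 \<Longrightarrow> cmod (f z) \<le> M" using bounded_on_cball[of "3/4"] by auto
  have "(\<lambda>N. M * (1 / (3/2)) ^ N * ((3/2) / ((3/2) - 1))) \<longlonglongrightarrow> M * 0 * ((3/2) / ((3/2) - 1))"
    by (intro tendsto_intros LIMSEQ_power_zero) auto
  then have lim: "(\<lambda>N. M * (1 / (3/2)) ^ N * ((3/2) / ((3/2) - 1))) \<longlonglongrightarrow> 0" by simp
  show ?thesis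
  proof (rule uniform_limitI)
    fix e :: real assume "e > 0"
    then have "\<forall>\<^sub>F N in sequentially. M * (1 / (3/2)) ^ N * ((3/2) / ((3/2) - 1)) < e"
      using lim by (rule order_tendstoD(2)[rotated])
    then show "\<forall>\<^sub>F N in sequentially. \<forall>z\<in>cball 0 (1/2). dist (circ_mean N (\<lambda>c. f (c *s z) * cnj c ^ k)) (hom_part k f z) < e"
      using eventually_gt_at_top[of k]
    proof eventually_elim
      case (elim N)
      show ?case
      proof
        fix z :: "complex ^ 'n" assume z: "z \<in> cball 0 (1/2)"
        have "cmod (circ_mean N (\<lambda>c. f (c *s z) * cnj c ^ k) - hom_part k f z) \<le> M * (1 / (3/2)) ^ N * ((3/2) / ((3/2) - 1))"
          unfolding hom_part_def
        proof (rule circ_mean_taylor_coeff)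
          show "(\<lambda>c. f (c *s z)) holomorphic_on ball 0 2" by (rule line_holomorphic_ball_0[OF line_hol]) (use z in auto)
          fix c :: complex assume "c \<in> cball 0 (3/2)"
          then have "cmod c * norm z \<le> (3/2) * (1/2)" using z by (intro mult_mono) auto
          then show "cmod (f (c *s z)) \<le> M" by (intro M(2)) (simp add: norm_smult_vec)
        qed (use elim in auto)
        then show "dist (circ_mean N (\<lambda>c. f (c *s z) * cnj c ^ k)) (hom_part k f z) < e"
          using elim by (simp add: dist_norm)
      qed
    qed
  qed
qed

text \<open>Cauchy's estimate on the sphere of radius 1/2, extended by homogeneity. The point 0
  cannot be normalised and is treated apart; there \<open>0 ^ 0 = 1\<close> matters for
  \<open>k = 0\<close>.\<close>

lemma hom_part_bound:
  obtains C where "C \<ge> 0" "\<And>z. cmod (hom_part k f z) \<le> C * norm z ^ k"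
proof -
  obtain M where M: "M \<ge> 0" "\<And>z. norm z \<le> 1/2 \<Longrightarrow> cmod (f z) \<le> M" using bounded_on_cball[of "1/2"] by auto
  have "cmod (hom_part k f z) \<le> M * 2 ^ k * norm z ^ k" for z
  proof (cases "z = 0")
    case False
    define u where "u = complex_of_real (1 / (2 * norm z)) *s z"
    have nu: "norm u = 1/2" using False by (simp add: u_def norm_smult_vec norm_divide norm_mult)
    have zu: "z = complex_of_real (2 * norm z) *s u" using False by (simp add: u_def vector_smult_assoc)
    have "cmod (hom_part k f u) \<le> M / 1 ^ k"
      unfolding hom_part_def
    proof (rule taylor_coeff_bound)
      show "(\<lambda>c. f (c *s u)) holomorphic_on ball 0 2" by (rule line_holomorphic_ball_0[OF line_hol]) (use nu in auto)
      fix c :: complex assume "c \<in> cball 0 1"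
      then show "cmod (f (c *s u)) \<le> M" by (intro M(2)) (simp add: norm_smult_vec nu)
    qed auto
    then show ?thesis
      by (subst zu) (simp add: hom_part_smult[OF line_hol] norm_mult norm_power power_mult_distrib mult.commute[of M]
        mult_left_mono mult.assoc)
  next
    case True
    have "cmod (hom_part k f (0::complex^'n)) \<le> M * 0 ^ k"
    proof (cases "k = 0")
      case True
      then show ?thesis using M(2)[of "0::complex^'n"] by (simp add: hom_part_def taylor_coeff_def)
    next
      case False
      then show ?thesis using hom_part_smult[OF line_hol, of k 0 0] M(1) by (simp add: zero_power)
    qed
    then show ?thesis using True M(1) by (cases "k = 0") (auto simp: zero_power)
  qed
  then show ?thesis using that[of "M * 2 ^ k"] M(1) by simp
qed

text \<open>The circular means are holomorphic along the line and converge uniformly on the half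
  ball, so the limit is holomorphic. A small factor \<open>e\<close> moves any given disc of the
  line into the half ball, and homogeneity divides it out again.\<close>

lemma hom_part_line_holomorphic: "line_holomorphic (hom_part k f) UNIV"
  unfolding line_holomorphic_def
proof (intro allI)
  fix x y :: "complex ^ 'n"
  have "(\<lambda>c. hom_part k f (x + c *s y)) holomorphic_on ball 0 \<rho>" if "\<rho> > 0" for \<rho>
  proof -
    define e where "e = (1/2) / (norm x + \<rho> * norm y + 1)"
    have e0: "e > 0" using that by (simp add: e_def add_nonneg_pos)
    have le: "norm (complex_of_real e *s (x + c *s y)) \<le> 1/2" if c: "c \<in> cball 0 \<rho>" for c
    proof -
      have "norm (x + c *s y) \<le> norm x + cmod c * norm y" by (metis norm_triangle_ineq norm_smult_vec)
      also have "\<dots> \<le> norm x + \<rho> * norm y + 1" using c by (simp add: add_increasing2 mult_right_mono)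
      finally have "e * norm (x + c *s y) \<le> e * (norm x + \<rho> * norm y + 1)" using e0 by (simp add: mult_left_mono)
      also have "\<dots> = 1/2" using \<open>\<rho> > 0\<close> by (simp add: e_def add_nonneg_pos less_imp_neq[symmetric])
      finally show ?thesis using e0 unfolding norm_smult_vec by simp
    qed
    define A where "A N c = circ_mean N (\<lambda>d. f (d *s (complex_of_real e *s (x + c *s y))) * cnj d ^ k)" for N c
    have "continuous_on (cball 0 \<rho>) (A N) \<and> A N holomorphic_on ball 0 \<rho>" for N
    proof -
      have "(\<lambda>c. f (d *s (complex_of_real e *s (x + c *s y)))) holomorphic_on {c. norm (complex_of_real e *s (x + c *s y)) < 1}"
        if "cmod d = 1" for d
      proof -
        have "(\<lambda>c. f ((d * e) *s x + c *s ((d * e) *s y))) holomorphic_on {c. (d * e) *s x + c *s ((d * e) *s y) \<in> ball 0 1}"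
          using line_hol unfolding line_holomorphic_def by blast
        moreover have eq: "(d * e) *s x + c *s ((d * e) *s y) = d *s (complex_of_real e *s (x + c *s y))" for c
          by (simp add: vec_eq_iff algebra_simps)
        moreover have "norm (d *s v) = norm v" for v :: "complex ^ 'n" using that by (simp add: norm_smult_vec)
        ultimately show ?thesis by (simp only: eq mem_ball_0)
      qed
      then have "A N holomorphic_on {c. norm (complex_of_real e *s (x + c *s y)) < 1}"
        unfolding A_def circ_mean_def divide_inverse
        by (intro holomorphic_on_mult holomorphic_on_sum holomorphic_on_const) (simp only: cmod_root1_power)
      then have "A N holomorphic_on cball 0 \<rho>"
        by (rule holomorphic_on_subset) (use le in force)
      then show ?thesis using ball_subset_cball holomorphic_on_imp_continuous_on holomorphic_on_subset by blast
    qed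
    then have A: "\<forall>\<^sub>F N in sequentially. continuous_on (cball 0 \<rho>) (A N) \<and> A N holomorphic_on ball 0 \<rho>" by simp
    have "uniform_limit (cball 0 \<rho>) A (\<lambda>c. hom_part k f (complex_of_real e *s (x + c *s y))) sequentially"
      unfolding A_def
      by (rule uniform_limit_compose'[OF circ_mean_hom_part_uniform]) (use le in auto)
    from holomorphic_uniform_limit[OF A this trivial_limit_sequentially]
    have "(\<lambda>c. hom_part k f (complex_of_real e *s (x + c *s y))) holomorphic_on ball 0 \<rho>" .
    then have "(\<lambda>c. complex_of_real e ^ k * hom_part k f (x + c *s y)) holomorphic_on ball 0 \<rho>"
      by (simp only: hom_part_smult[OF line_hol])
    then have "(\<lambda>c. (1 / complex_of_real e ^ k) * (complex_of_real e ^ k * hom_part k f (x + c *s y))) holomorphic_on ball 0 \<rho>"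
      by (rule holomorphic_on_mult[OF holomorphic_on_const])
    then show ?thesis using e0 by simp
  qed
  then have "(\<lambda>c. hom_part k f (x + c *s y)) holomorphic_on ball 0 (cmod c + 1)" for c
    using norm_ge_zero[of c] by (smt (verit))
  then have "(\<lambda>c. hom_part k f (x + c *s y)) field_differentiable at c" for c
    by (rule holomorphic_on_imp_differentiable_at[where s = "ball 0 (cmod c + 1)"]) auto
  then show "(\<lambda>c. hom_part k f (x + c *s y)) holomorphic_on {c. x + c *s y \<in> UNIV}"
    by (simp add: holomorphic_on_def field_differentiable_at_within)
qed

text \<open>Again a uniform limit on the half ball, transported to large balls by a
  dilation.\<close>

lemma continuous_on_hom_part: "continuous_on UNIV (hom_part k f)"
proof -
  have 1: "continuous_on (cball 0 (1/2)) (hom_part k f)"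
  proof (rule uniform_limit_theorem[OF _ circ_mean_hom_part_uniform])
    have "continuous_on (cball 0 (1/2)) (\<lambda>z. circ_mean N (\<lambda>c. f (c *s z) * cnj c ^ k))" for N
    proof (cases "N = 0")
      case False
      then show ?thesis unfolding circ_mean_def
        by (intro continuous_intros continuous_on_compose2[OF cont]) (auto simp: norm_smult_vec)
    qed (simp add: circ_mean_def)
    then show "\<forall>\<^sub>F N in sequentially. continuous_on (cball 0 (1/2)) (\<lambda>z. circ_mean N (\<lambda>c. f (c *s z) * cnj c ^ k))"
      by simp
  qed auto
  have "isCont (hom_part k f) z" for z
  proof -
    define R where "R = 2 * (norm z + 1)"
    have R: "R > 0" by (simp add: R_def add_nonneg_pos)
    have "continuous_on (ball 0 (R / 2)) (\<lambda>z. complex_of_real R ^ k * hom_part k f (complex_of_real (1 / R) *s z))"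
      by (intro continuous_intros continuous_on_compose2[OF 1]) (use R in \<open>auto simp: norm_smult_vec norm_divide field_simps\<close>)
    moreover have "complex_of_real R ^ k * hom_part k f (complex_of_real (1 / R) *s z) = hom_part k f z" for z
      using R by (simp add: hom_part_smult[OF line_hol] flip: power_mult_distrib mult.assoc)
    ultimately show ?thesis by (simp add: continuous_on_eq_continuous_at R_def)
  qed
  then show ?thesis by (simp add: continuous_on_eq_continuous_at)
qed

lemma hom_part_measurable [measurable]: "hom_part k f \<in> borel_measurable borel"
  by (rule borel_measurable_continuous_onI[OF continuous_on_hom_part])

end

subsection \<open>Changes of variables and Gaussian integrals\<close>

lemma ball_in_borel [measurable]: "ball a r \<in> sets borel"
  by simp

lemma
  fixes g :: "'a::euclidean_space \<Rightarrow> 'b::{banach, second_countable_topology}"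
  assumes [measurable]: "g \<in> borel_measurable borel" and c: "c \<noteq> 0"
  shows lborel_integrable_affine_iff: "integrable lborel (\<lambda>x. g (t + c *\<^sub>R x)) \<longleftrightarrow> integrable lborel g"
    and lborel_integral_affine: "integral\<^sup>L lborel g = \<bar>c\<bar> ^ DIM('a) *\<^sub>R integral\<^sup>L lborel (\<lambda>x. g (t + c *\<^sub>R x))"
proof -
  have [measurable]: "(\<lambda>x. t + c *\<^sub>R x) \<in> borel_measurable borel" by measurable
  have scale: "integrable lborel (\<lambda>x. \<bar>c\<bar> ^ DIM('a) *\<^sub>R G x) \<longleftrightarrow> integrable lborel G" for G :: "'a \<Rightarrow> 'b"
    using c integrable_scaleR_right[of "1 / \<bar>c\<bar> ^ DIM('a)" lborel "\<lambda>x. \<bar>c\<bar> ^ DIM('a) *\<^sub>R G x"]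
    by (auto intro!: integrable_scaleR_right)
  show "integrable lborel (\<lambda>x. g (t + c *\<^sub>R x)) \<longleftrightarrow> integrable lborel g"
    by (subst (2) lborel_affine[OF c, of t]) (simp add: integrable_density integrable_distr_eq scale)
  show "integral\<^sup>L lborel g = \<bar>c\<bar> ^ DIM('a) *\<^sub>R integral\<^sup>L lborel (\<lambda>x. g (t + c *\<^sub>R x))"
    by (subst (1) lborel_affine[OF c, of t]) (simp add: integral_density integral_distr)
qed

lemma lborel_integral_smult_vec:
  fixes g :: "complex ^ 'n \<Rightarrow> complex"
  assumes [measurable]: "g \<in> borel_measurable borel" and c: "cmod c = 1"
  shows "integral\<^sup>L lborel (\<lambda>z. g (c *s z)) = integral\<^sup>L lborel g"
proof -
  have [measurable]: "((*s) c :: complex ^ 'n \<Rightarrow> _) \<in> borel_measurable borel"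
    by (intro borel_measurable_continuous_onI continuous_intros)
  show ?thesis
    by (subst (2) lborel_distr_smult_vec[OF c, symmetric]) (simp add: integral_distr)
qed

text \<open>Rotation invariance replaces \<open>g\<close> by its means over roots of unity without
  changing the integral; dominated convergence, with a majorant valid for all rotations at once,
  passes to the limit of the means.\<close>

lemma integral_eq_circ_average:
  fixes g g0 :: "complex ^ 'n \<Rightarrow> complex"
  assumes g [measurable]: "g \<in> borel_measurable borel" and [measurable]: "g0 \<in> borel_measurable borel"
    and D: "integrable lborel D" and bound: "\<And>c z. cmod c = 1 \<Longrightarrow> cmod (g (c *s z)) \<le> D z"
    and lim: "\<And>z. (\<lambda>N. circ_mean N (\<lambda>c. g (c *s z))) \<longlonglongrightarrow> g0 z"
  shows "integral\<^sup>L lborel g = integral\<^sup>L lborel g0"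
proof -
  have [measurable]: "((*s) c :: complex ^ 'n \<Rightarrow> _) \<in> borel_measurable borel" for c
    by (intro borel_measurable_continuous_onI continuous_intros)
  have int: "integrable lborel (\<lambda>z. g (c *s z))" if "cmod c = 1" for c
    by (rule Bochner_Integration.integrable_bound[OF D]) (use bound[OF that] in \<open>auto intro!: AE_I2 order_trans[OF _ abs_ge_self]\<close>)
  have "(\<lambda>N. integral\<^sup>L lborel (\<lambda>z. circ_mean N (\<lambda>c. g (c *s z)))) \<longlonglongrightarrow> integral\<^sup>L lborel g0"
  proof (rule integral_dominated_convergence[where w = D])
    show "(\<lambda>z. circ_mean N (\<lambda>c. g (c *s z))) \<in> borel_measurable lborel" for N
      unfolding circ_mean_def by measurable
    have D0: "D z \<ge> 0" for z using bound[of 1 z] norm_ge_zero order_trans by (metis norm_one)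
    show "AE z in lborel. norm (circ_mean N (\<lambda>c. g (c *s z))) \<le> D z" for N
      by (intro AE_I2 norm_circ_mean_le bound D0)
  qed (use D lim in auto)
  moreover have "\<forall>\<^sub>F N in sequentially. integral\<^sup>L lborel (\<lambda>z. circ_mean N (\<lambda>c. g (c *s z))) = integral\<^sup>L lborel g"
    using eventually_gt_at_top[of 0]
  proof eventually_elim
    case (elim N)
    have "integral\<^sup>L lborel (\<lambda>z. circ_mean N (\<lambda>c. g (c *s z))) = (\<Sum>j<N. integral\<^sup>L lborel (\<lambda>z. g (root1 N ^ j *s z))) / of_nat N"
      unfolding circ_mean_def by (simp add: int)
    also have "\<dots> = integral\<^sup>L lborel g"
      using elim by (simp add: lborel_integral_smult_vec)
    finally show ?case .
  qed
  ultimately have "(\<lambda>N. integral\<^sup>L lborel g) \<longlonglongrightarrow> integral\<^sup>L lborel g0"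
    by (rule Lim_transform_eventually)
  then show ?thesis by (simp add: LIMSEQ_const_iff)
qed

lemma
  shows integrable_power_exp_Ioi: "integrable lborel (\<lambda>t::real. indicator {0<..} t * (t ^ k * exp (-t)))"
    and integral_power_exp_Ioi: "(\<integral>t. indicator {0<..} t * (t ^ k * exp (-t)) \<partial>(lborel :: real measure)) = fact k"
proof -
  have "(\<integral>\<^sup>+t. ennreal (indicator {0<..} t * (t ^ k * exp (-t))) \<partial>lborel) = (\<integral>\<^sup>+t. ennreal (t ^ k * exp (-t)) * indicator {0..} t \<partial>lborel)"
  proof (rule nn_integral_cong_AE)
    show "AE t in lborel. ennreal (indicator {0<..} t * (t ^ k * exp (-t))) = ennreal (t ^ k * exp (-t)) * indicator {0..} t"
      using AE_lborel_singleton[of 0] by eventually_elim (auto simp: indicator_def)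
  qed
  also have "\<dots> = ennreal (fact k)" by (simp add: nn_intergal_power_times_exp_Ici ennreal_of_nat_eq_real_of_nat)
  finally have "has_bochner_integral lborel (\<lambda>t::real. indicator {0<..} t * (t ^ k * exp (-t))) (fact k)"
    by (intro has_bochner_integral_nn_integral) (auto simp: indicator_def)
  then show "integrable lborel (\<lambda>t::real. indicator {0<..} t * (t ^ k * exp (-t)))"
    and "(\<integral>t. indicator {0<..} t * (t ^ k * exp (-t)) \<partial>(lborel :: real measure)) = fact k"
    by (simp_all add: has_bochner_integral_iff)
qed

lemma
  assumes "a \<ge> 0"
  shows integrable_exp_Ioi: "integrable lborel (\<lambda>t::real. indicator {a<..} t * exp (-t))"
    and integral_exp_Ioi: "(\<integral>t. indicator {a<..} t * exp (-t) \<partial>(lborel :: real measure)) = exp (-a)"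
proof -
  have "(\<integral>\<^sup>+t. ennreal (indicator {a<..} t * exp (-t)) \<partial>lborel) = (\<integral>\<^sup>+t. ennreal (exp (-t)) * indicator {a..} t \<partial>lborel)"
  proof (rule nn_integral_cong_AE)
    show "AE t in lborel. ennreal (indicator {a<..} t * exp (-t)) = ennreal (exp (-t)) * indicator {a..} t"
      using AE_lborel_singleton[of a] by eventually_elim (auto simp: indicator_def)
  qed
  also have "\<dots> = ennreal (0 - (- exp (-a)))"
  proof (rule nn_integral_FTC_atLeast)
    have "((\<lambda>t::real. - exp (-t)) \<longlongrightarrow> - 0) at_top"
      by (intro tendsto_minus filterlim_compose[OF exp_at_bot filterlim_uminus_at_bot_at_top])
    then show "((\<lambda>t::real. - exp (-t)) \<longlongrightarrow> 0) at_top" by simp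
  qed (auto intro!: derivative_eq_intros)
  finally have "has_bochner_integral lborel (\<lambda>t::real. indicator {a<..} t * exp (-t)) (exp (-a))"
    by (intro has_bochner_integral_nn_integral) (auto simp: indicator_def)
  then show "integrable lborel (\<lambda>t::real. indicator {a<..} t * exp (-t))"
    and "(\<integral>t. indicator {a<..} t * exp (-t) \<partial>(lborel :: real measure)) = exp (-a)"
    by (simp_all add: has_bochner_integral_iff)
qed

lemma integral_ball_homogeneous:
  fixes h :: "'a::euclidean_space \<Rightarrow> 'b::{banach, second_countable_topology}"
  assumes [measurable]: "h \<in> borel_measurable borel"
    and hom: "\<And>r z. r > 0 \<Longrightarrow> h (r *\<^sub>R z) = r ^ d *\<^sub>R h z" and r: "r > 0"
  shows "(LINT z:ball 0 r|lborel. h z) = r ^ (DIM('a) + d) *\<^sub>R (LINT z:ball 0 1|lborel. h z)"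
proof -
  have "(LINT z:ball 0 r|lborel. h z) = r ^ DIM('a) *\<^sub>R (\<integral>z. indicator (ball 0 r) (0 + r *\<^sub>R z) *\<^sub>R h (0 + r *\<^sub>R z) \<partial>lborel)"
    unfolding set_lebesgue_integral_def using r by (subst lborel_integral_affine[of _ r 0]) auto
  also have "(\<integral>z. indicator (ball 0 r) (0 + r *\<^sub>R z) *\<^sub>R h (0 + r *\<^sub>R z) \<partial>lborel) = (\<integral>z. r ^ d *\<^sub>R (indicator (ball 0 1) z *\<^sub>R h z) \<partial>lborel)"
    using r by (intro Bochner_Integration.integral_cong) (auto simp: indicator_def hom)
  finally show ?thesis unfolding integral_scaleR_right by (simp add: set_lebesgue_integral_def power_add)
qed

text \<open>The Gaussian is a superposition of balls: \<open>exp (- |z|\<^sup>2)\<close> is the integral of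
  \<open>exp (- t)\<close> over \<open>t > |z|\<^sup>2\<close>.\<close>

lemma
  fixes h :: "'a::euclidean_space \<Rightarrow> complex"
  assumes [measurable]: "h \<in> borel_measurable borel"
    and hom: "\<And>r z. r > 0 \<Longrightarrow> h (r *\<^sub>R z) = r ^ (2 * k) *\<^sub>R h z" 
    and bound: "\<And>z. cmod (h z) \<le> C * norm z ^ (2 * k)" and dim: "DIM('a) = 2 * m"
  shows integrable_gaussian_homogeneous: "integrable lborel (\<lambda>z. h z * exp (- (norm z)\<^sup>2))"
    and integral_gaussian_homogeneous: 
      "(\<integral>z. h z * exp (- (norm z)\<^sup>2) \<partial>lborel) = fact (m + k) * (LINT z:ball 0 1|lborel. h z)"
proof -
  define H where "H t z = indicator {(norm z)\<^sup>2<..} t *\<^sub>R (exp (-t) *\<^sub>R h z)" for t :: real and z :: 'a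
  have ball: "H t z = (indicator {0<..} t * exp (-t)) *\<^sub>R (indicator (ball 0 (sqrt t)) z *\<^sub>R h z)" for t z
  proof (cases "t > 0")
    case True
    have "norm z < sqrt t \<longleftrightarrow> (norm z)\<^sup>2 < t" using real_sqrt_less_iff[of "(norm z)\<^sup>2" t] by simp
    then show ?thesis using True by (auto simp: H_def indicator_def)
  next
    case False
    moreover have "0 \<le> (norm z)\<^sup>2" by simp
    ultimately have "\<not> (norm z)\<^sup>2 < t" by linarith
    with False show ?thesis by (simp add: H_def)
  qed
  have dim2: "DIM('a) + 2 * k = 2 * (m + k)" using dim by simp
  have int_ball: "integrable lborel (\<lambda>z. indicator (ball 0 r) z *\<^sub>R h z)" if "r > 0" for r
  proof (rule Bochner_Integration.integrable_bound)
    show "integrable lborel (\<lambda>z::'a. \<bar>C\<bar> * r ^ (2 * k) * indicator (ball 0 r) z)"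
      using emeasure_lborel_ball_finite[of "0::'a" r] by (intro integrable_mult_right) (simp add: integrable_indicator_iff)
    have "cmod (h z) \<le> \<bar>C\<bar> * r ^ (2 * k)" if "norm z < r" for z
    proof -
      have "C * norm z ^ (2 * k) \<le> \<bar>C\<bar> * r ^ (2 * k)"
        by (intro mult_mono power_mono) (use that in auto)
      then show ?thesis using bound[of z] by simp
    qed
    then show "AE z in lborel. norm (indicator (ball 0 r) z *\<^sub>R h z) \<le> norm (\<bar>C\<bar> * r ^ (2 * k) * indicator (ball 0 r) z)"
      using \<open>r > 0\<close> by (intro AE_I2) (auto simp: indicator_def)
  qed simp
  \<comment> \<open>By scaling, the ball of radius \<open>sqrt t\<close> contributes
    \<open>sqrt t\<close> to the power \<open>2 * (m + k)\<close>, that is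
    \<open>t ^ (m + k)\<close>; integrated against \<open>exp (-t)\<close> this produces the
    factorial.\<close>
  have intH: "(\<integral>z. H t z \<partial>lborel) = (indicator {0<..} t * (t ^ (m + k) * exp (-t))) *\<^sub>R (LINT z:ball 0 1|lborel. h z)" for t
  proof (cases "t > 0")
    case True
    have "(LINT z:ball 0 (sqrt t)|lborel. h z) = sqrt t ^ (DIM('a) + 2 * k) *\<^sub>R (LINT z:ball 0 1|lborel. h z)"
      by (rule integral_ball_homogeneous) (use True hom in auto)
    also have "sqrt t ^ (DIM('a) + 2 * k) = t ^ (m + k)"
      using True by (simp only: dim2 power_mult) simp
    finally show ?thesis using True unfolding ball set_lebesgue_integral_def integral_scaleR_right by simp
  qed (simp add: ball)
  have nball: "norm (H t z) = (indicator {0<..} t * exp (-t)) *\<^sub>R (indicator (ball 0 (sqrt t)) z *\<^sub>R norm (h z))" for t z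
    unfolding ball by (simp add: abs_mult indicator_def)
  have intnH: "(\<integral>z. norm (H t z) \<partial>lborel) = (indicator {0<..} t * (t ^ (m + k) * exp (-t))) *\<^sub>R (LINT z:ball 0 1|lborel. norm (h z))" for t
  proof (cases "t > 0")
    case True
    have "(LINT z:ball 0 (sqrt t)|lborel. norm (h z)) = sqrt t ^ (DIM('a) + 2 * k) *\<^sub>R (LINT z:ball 0 1|lborel. norm (h z))"
      by (rule integral_ball_homogeneous) (use True hom in auto)
    also have "sqrt t ^ (DIM('a) + 2 * k) = t ^ (m + k)"
      using True by (simp only: dim2 power_mult) simp
    finally show ?thesis using True unfolding nball set_lebesgue_integral_def integral_scaleR_right by simp
  qed (simp add: nball)
  have H_meas [measurable]: "case_prod H \<in> borel_measurable (lborel \<Otimes>\<^sub>M lborel)"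
  proof -
    have "case_prod H = (\<lambda>(t, z). if (norm z)\<^sup>2 < t then exp (-t) *\<^sub>R h z else 0)"
      by (auto simp: H_def indicator_def fun_eq_iff)
    then show ?thesis by (simp only:) measurable
  qed
  have int: "integrable (lborel \<Otimes>\<^sub>M lborel) (case_prod H)"
  proof (rule lborel_pair.Fubini_integrable[OF H_meas])
    show "integrable lborel (\<lambda>t. \<integral>z. norm (case (t, z) of (t, z) \<Rightarrow> H t z) \<partial>lborel)"
      by (simp add: intnH integrable_power_exp_Ioi)
    have "integrable lborel (H t)" for t
      unfolding ball by (rule integrable_scaleR_right, rule int_ball) (simp split: split_indicator_asm)
    then show "AE t in lborel. integrable lborel (\<lambda>z. case (t, z) of (t, z) \<Rightarrow> H t z)" by simp
  qed
  have intt: "(\<integral>t. H t z \<partial>lborel) = h z * exp (- (norm z)\<^sup>2)" for z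
  proof -
    have "(\<integral>t. H t z \<partial>lborel) = (\<integral>t. (indicator {(norm z)\<^sup>2<..} t * exp (-t)) *\<^sub>R h z \<partial>lborel)"
      by (simp add: H_def mult.commute)
    also have "\<dots> = exp (- (norm z)\<^sup>2) *\<^sub>R h z"
      by (subst integral_scaleR_left) (simp_all add: integrable_exp_Ioi integral_exp_Ioi)
    finally show ?thesis by (simp add: scaleR_conv_of_real mult.commute exp_of_real)
  qed
  show "integrable lborel (\<lambda>z. h z * exp (- (norm z)\<^sup>2))"
    using lborel_pair.integrable_snd[OF int] by (simp add: intt)
  have "(\<integral>z. h z * exp (- (norm z)\<^sup>2) \<partial>lborel) = (\<integral>t. (\<integral>z. H t z \<partial>lborel) \<partial>lborel)"
    using lborel_pair.Fubini_integral[OF int] by (simp add: intt)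
  also have "\<dots> = fact (m + k) *\<^sub>R (LINT z:ball 0 1|lborel. h z)"
    unfolding intH by (subst integral_scaleR_left) (simp_all add: integrable_power_exp_Ioi integral_power_exp_Ioi)
  finally show "(\<integral>z. h z * exp (- (norm z)\<^sup>2) \<partial>lborel) = fact (m + k) * (LINT z:ball 0 1|lborel. h z)"
    by (simp add: scaleR_conv_of_real)
qed

lemma DIM_complex_vec: "DIM(complex ^ 'n) = 2 * CARD('n)"
  by simp

lemma measure_unit_ball: "measure lborel (ball (0 :: complex ^ 'n) 1) = pi ^ CARD('n) / fact CARD('n)"
  using content_ball[of 1 "0 :: complex ^ 'n"] unfolding DIM_complex_vec unit_ball_vol_even by simp

text \<open>The constant function is the homogeneous case of degree 0, so the Gaussian integral is
  \<open>fact CARD('n)\<close> times the volume of the unit ball.\<close>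

lemma
  shows integrable_gaussian: "integrable lborel (\<lambda>z :: complex ^ 'n. exp (- (norm z)\<^sup>2))"
    and integral_gaussian: "(\<integral>z. exp (- (norm (z :: complex ^ 'n))\<^sup>2) \<partial>lborel) = pi ^ CARD('n)"
proof -
  have "integrable lborel (\<lambda>z :: complex ^ 'n. 1 * complex_of_real (exp (- (norm z)\<^sup>2)))"
    using integrable_gaussian_homogeneous[where 'a = "complex ^ 'n" and h = "\<lambda>_. 1" and k = 0 and C = 1, OF _ _ _ DIM_complex_vec]
    by (simp add: exp_of_real)
  then have "integrable lborel (\<lambda>z :: complex ^ 'n. Re (complex_of_real (exp (- (norm z)\<^sup>2))))"
    by (intro integrable_Re) simp
  then show "integrable lborel (\<lambda>z :: complex ^ 'n. exp (- (norm z)\<^sup>2))" by simp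
  have "(\<integral>z. 1 * complex_of_real (exp (- (norm (z :: complex ^ 'n))\<^sup>2)) \<partial>lborel) = fact (CARD('n) + 0) * (LINT z:ball (0::complex^'n) 1|lborel. 1)"
    using integral_gaussian_homogeneous[where 'a = "complex ^ 'n" and h = "\<lambda>_. 1" and k = 0 and C = 1, OF _ _ _ DIM_complex_vec]
    by (simp add: exp_of_real)
  also have "(LINT z:ball (0::complex^'n) 1|lborel. (1::complex)) = measure lborel (ball (0 :: complex ^ 'n) 1)"
    by (simp add: set_lebesgue_integral_def scaleR_conv_of_real)
  finally show "(\<integral>z. exp (- (norm (z :: complex ^ 'n))\<^sup>2) \<partial>lborel) = pi ^ CARD('n)"
    by (simp add: measure_unit_ball flip: of_real_power)
qed

lemma power_le_fact_exp:
  assumes "(x::real) \<ge> 0"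
  shows "x ^ k \<le> fact k * exp x"
proof -
  have "summable (\<lambda>n. inverse (fact n) * x ^ n)" by (rule summable_exp)
  then have "(\<Sum>n\<in>{k}. inverse (fact n) * x ^ n) \<le> (\<Sum>n. inverse (fact n) * x ^ n)"
    by (rule sum_le_suminf) (use assms in auto)
  then show ?thesis by (simp add: exp_def divideR_right field_simps scaleR_conv_of_real)
qed

text \<open>Since \<open>2 * b * s\<close> is at most \<open>b\<^sup>2 + s\<^sup>2\<close>, half of
  the Gaussian decay remains. This is the majorant for the rotation arguments over the whole
  space.\<close>

lemma integrable_exp_gaussian: "integrable lborel (\<lambda>z :: complex ^ 'n. exp (b * norm z - (norm z)\<^sup>2))"
proof (rule Bochner_Integration.integrable_bound)
  have "integrable lborel (\<lambda>z :: complex ^ 'n. exp (- (norm (0 + (1 / sqrt 2) *\<^sub>R z))\<^sup>2))"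
    by (subst lborel_integrable_affine_iff) (simp_all add: integrable_gaussian)
  then show "integrable lborel (\<lambda>z :: complex ^ 'n. exp (b\<^sup>2 / 2) * exp (- (norm z)\<^sup>2 / 2))"
    by (simp add: power_divide)
  have "b * s - s\<^sup>2 \<le> b\<^sup>2 / 2 + - s\<^sup>2 / 2" for s :: real
    using zero_le_power2[of "b - s"] by (simp add: power2_eq_square algebra_simps)
  then show "AE z in lborel. norm (exp (b * norm z - (norm z)\<^sup>2)) \<le> norm (exp (b\<^sup>2 / 2) * exp (- (norm (z :: complex ^ 'n))\<^sup>2 / 2))"
    by (intro AE_I2) (simp flip: exp_add)
qed simp

lemma taylor_coeff_exp: "taylor_coeff k (\<lambda>c. exp (c * u)) = u ^ k / fact k"
proof -
  have "(deriv ^^ k) (\<lambda>w. exp (u * w)) 0 = u ^ k * (deriv ^^ k) exp (u * 0)"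
    by (rule higher_deriv_compose_linear[where S = UNIV and T = UNIV]) (auto intro: holomorphic_intros)
  moreover have "deriv exp = (exp :: complex \<Rightarrow> complex)"
    by (rule ext) (simp add: DERIV_imp_deriv)
  then have "(deriv ^^ k) exp = (exp :: complex \<Rightarrow> complex)"
    by (induction k) auto
  ultimately show ?thesis by (simp add: taylor_coeff_def mult.commute)
qed

lemma circ_mean_mult_right: "circ_mean N (\<lambda>c. \<phi> c * a) = circ_mean N \<phi> * a"
  unfolding circ_mean_def sum_distrib_right[symmetric] by simp

lemma circ_mean_cong: "(\<And>c. cmod c = 1 \<Longrightarrow> \<phi> c = \<psi> c) \<Longrightarrow> circ_mean N \<phi> = circ_mean N \<psi>"
  by (simp add: circ_mean_def del: norm_power)

lemma cnj_circ_mean: "cnj (circ_mean N \<phi>) = circ_mean N (\<lambda>c. cnj (\<phi> c))"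
  by (simp add: circ_mean_def)

lemma exp_linear_minus_square: "exp ((b + 1) * s - s\<^sup>2) = exp s * exp (b * s) * exp (- s\<^sup>2)" for b s :: real
proof -
  have "(b + 1) * s - s\<^sup>2 = s + b * s + - s\<^sup>2" by (simp add: distrib_right)
  then show ?thesis by (simp only: exp_add)
qed

section \<open>Moments of homogeneous components, first against the Gaussian, then over the
  ball\<close>

context ball_holomorphic
begin

text \<open>The translation \<open>z = w + x\<close> turns the weight \<open>exp (\<langle>x, z\<rangle> - |z|\<^sup>2)\<close> into
  \<open>exp (- |w|\<^sup>2) exp (- \<langle>w, x\<rangle>)\<close>, whose second factor is holomorphic in \<open>w\<close>, so that the
  mean value property applies.\<close>

lemma hom_part_fock_reproducing:
  "(\<integral>z. hom_part k f z * exp (vec_inner x z) * exp (- (norm z)\<^sup>2) \<partial>lborel) = pi ^ CARD('n) * hom_part k f x"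
proof -
  obtain C where C: "C \<ge> 0" "\<And>z. cmod (hom_part k f z) \<le> C * norm z ^ k" using hom_part_bound by blast
  have [measurable]: "(\<lambda>z. vec_inner x z) \<in> borel_measurable borel" "(\<lambda>z. vec_inner z x) \<in> borel_measurable borel"
    by (intro borel_measurable_continuous_onI continuous_intros)+
  define g where "g w = hom_part k f (x + w) * exp (- vec_inner w x) * exp (- (norm w)\<^sup>2)" for w
  have "(\<integral>z. hom_part k f z * exp (vec_inner x z) * exp (- (norm z)\<^sup>2) \<partial>lborel)
    = (\<integral>w. hom_part k f (x + 1 *\<^sub>R w) * exp (vec_inner x (x + 1 *\<^sub>R w)) * exp (- (norm (x + 1 *\<^sub>R w))\<^sup>2) \<partial>lborel)"
    by (subst lborel_integral_affine[of _ 1 x]) simp_all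
  also have "\<dots> = integral\<^sup>L lborel g"
  proof (rule Bochner_Integration.integral_cong)
    fix w :: "complex ^ 'n"
    have "vec_inner x (x + w) - of_real ((norm (x + w))\<^sup>2) = - vec_inner w x - of_real ((norm w)\<^sup>2)"
      unfolding vec_inner_self[symmetric] by (simp add: vec_inner_add_left vec_inner_add_right)
    then have "exp (vec_inner x (x + w)) * exp (- of_real ((norm (x + w))\<^sup>2)) = exp (- vec_inner w x) * exp (- complex_of_real ((norm w)\<^sup>2))"
      by (simp flip: exp_add)
    then show "hom_part k f (x + 1 *\<^sub>R w) * exp (vec_inner x (x + 1 *\<^sub>R w)) * exp (- (norm (x + 1 *\<^sub>R w))\<^sup>2) = g w"
      by (simp add: g_def mult.assoc flip: exp_of_real)
  qed simp
  also have "\<dots> = (\<integral>w. hom_part k f x * exp (- (norm w)\<^sup>2) \<partial>(lborel :: (complex ^ 'n) measure))"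
  proof (rule integral_eq_circ_average)
    show "g \<in> borel_measurable borel" unfolding g_def by measurable
    show "integrable lborel (\<lambda>w :: complex ^ 'n. C * fact k * exp (norm x) * exp ((norm x + 1) * norm w - (norm w)\<^sup>2))"
      by (intro integrable_mult_right integrable_exp_gaussian)
  next
    fix c :: complex and w :: "complex ^ 'n" assume c: "cmod c = 1"
    have "cmod (hom_part k f (x + c *s w)) \<le> C * norm (x + c *s w) ^ k" by (rule C)
    also have "\<dots> \<le> C * (norm x + norm w) ^ k"
      using norm_triangle_ineq[of x "c *s w"] c C(1) by (intro mult_left_mono power_mono) (simp_all add: norm_smult_vec)
    also have "\<dots> \<le> C * (fact k * exp (norm x + norm w))"
      using C(1) by (intro mult_left_mono power_le_fact_exp) auto
    finally have 1: "cmod (hom_part k f (x + c *s w)) \<le> C * (fact k * exp (norm x + norm w))" .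
    have "cmod (exp (- vec_inner (c *s w) x)) \<le> exp (norm w * norm x)"
      unfolding norm_exp_eq_Re using norm_vec_inner_le[of "c *s w" x] abs_Re_le_cmod[of "vec_inner (c *s w) x"] c
      by (simp add: norm_smult_vec)
    then have "cmod (g (c *s w)) \<le> C * (fact k * exp (norm x + norm w)) * exp (norm w * norm x) * exp (- (norm w)\<^sup>2)"
      unfolding g_def norm_mult using 1 c C(1) 
      by (intro mult_mono) (auto simp: norm_smult_vec norm_exp_eq_Re)
    then show "cmod (g (c *s w)) \<le> C * fact k * exp (norm x) * exp ((norm x + 1) * norm w - (norm w)\<^sup>2)"
      by (simp add: exp_linear_minus_square mult.assoc) (simp add: exp_add mult_ac)
  next
    fix w :: "complex ^ 'n"
    define \<phi> where "\<phi> c = hom_part k f (x + c *s w) * exp (- (c * vec_inner w x)) * exp (- (norm w)\<^sup>2)" for c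
    have h: "\<phi> holomorphic_on ball 0 2"
      using hom_part_line_holomorphic[of k] unfolding line_holomorphic_def \<phi>_def
      by (intro holomorphic_intros) (auto intro: holomorphic_on_subset)
    \<comment> \<open>The coefficient of degree 0 is the value at \<open>c = 0\<close>, so this
      limit is the mean value property on the orbit of \<open>w\<close>, along which
      \<open>norm w\<close> is constant.\<close>
    have "(\<lambda>N. circ_mean N (\<lambda>c. \<phi> c * cnj c ^ 0)) \<longlonglongrightarrow> taylor_coeff 0 \<phi>"
      by (rule circ_mean_tendsto_taylor_coeff[OF h]) simp
    moreover have "circ_mean N (\<lambda>c. \<phi> c * cnj c ^ 0) = circ_mean N (\<lambda>c. g (c *s w))" for N
      unfolding circ_mean_def by (simp add: \<phi>_def g_def vec_inner_smult_left norm_smult_vec)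
    ultimately show "(\<lambda>N. circ_mean N (\<lambda>c. g (c *s w))) \<longlonglongrightarrow> hom_part k f x * exp (- (norm w)\<^sup>2)"
      by (simp add: taylor_coeff_def \<phi>_def)
  qed simp
  also have "\<dots> = hom_part k f x * (\<integral>w. complex_of_real (exp (- (norm w)\<^sup>2)) \<partial>(lborel :: (complex ^ 'n) measure))"
    by (simp add: exp_of_real)
  finally show ?thesis by (simp add: integral_gaussian mult.commute)
qed

text \<open>The integral of the previous lemma is averaged over rotations once more:
  \<open>hom_part\<close> contributes \<open>c ^ k\<close>, and of the exponential series, in powers
  of \<open>cnj c\<close>, only the term of degree \<open>k\<close> survives, with coefficient
  \<open>1 / fact k\<close>.\<close>

lemma hom_part_gaussian_moment:
  "(\<integral>z. hom_part k f z * vec_inner x z ^ k * exp (- (norm z)\<^sup>2) \<partial>lborel) = fact k * pi ^ CARD('n) * hom_part k f x"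
proof -
  obtain C where C: "C \<ge> 0" "\<And>z. cmod (hom_part k f z) \<le> C * norm z ^ k" using hom_part_bound by blast
  have [measurable]: "(\<lambda>z. vec_inner x z) \<in> borel_measurable borel"
    by (intro borel_measurable_continuous_onI continuous_intros)
  have "(\<integral>z. hom_part k f z * exp (vec_inner x z) * exp (- (norm z)\<^sup>2) \<partial>lborel) 
    = (\<integral>z. (hom_part k f z * vec_inner x z ^ k * exp (- (norm z)\<^sup>2)) * (1 / fact k) \<partial>lborel)"
  proof (rule integral_eq_circ_average)
    show "integrable lborel (\<lambda>w :: complex ^ 'n. C * fact k * exp ((norm x + 1) * norm w - (norm w)\<^sup>2))"
      by (intro integrable_mult_right integrable_exp_gaussian)
  next
    fix c :: complex and w :: "complex ^ 'n" assume c: "cmod c = 1"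
    have "cmod (hom_part k f (c *s w)) \<le> C * norm (c *s w) ^ k" by (rule C)
    also have "\<dots> \<le> C * (fact k * exp (norm w))"
      using C(1) c power_le_fact_exp[of "norm w"] by (intro mult_left_mono) (auto simp: norm_smult_vec)
    finally have 1: "cmod (hom_part k f (c *s w)) \<le> C * (fact k * exp (norm w))" .
    have "cmod (exp (vec_inner x (c *s w))) \<le> exp (norm x * norm w)"
      unfolding norm_exp_eq_Re using norm_vec_inner_le[of x "c *s w"] abs_Re_le_cmod[of "vec_inner x (c *s w)"] c
      by (simp add: norm_smult_vec)
    then have "cmod (hom_part k f (c *s w) * exp (vec_inner x (c *s w)) * exp (- (norm (c *s w))\<^sup>2)) 
        \<le> C * (fact k * exp (norm w)) * exp (norm x * norm w) * exp (- (norm w)\<^sup>2)"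
      unfolding norm_mult using 1 c C(1) 
      by (intro mult_mono) (auto simp: norm_smult_vec norm_exp_eq_Re)
    then show "cmod (hom_part k f (c *s w) * exp (vec_inner x (c *s w)) * exp (- (norm (c *s w))\<^sup>2)) 
        \<le> C * fact k * exp ((norm x + 1) * norm w - (norm w)\<^sup>2)"
      by (simp only: exp_linear_minus_square mult.assoc)
  next
    fix w :: "complex ^ 'n"
    \<comment> \<open>The pairing \<open>vec_inner x w\<close> is antilinear in \<open>w\<close>, so
      the coefficient is extracted from the conjugate exponential and conjugated back.\<close>
    have "(\<lambda>N. circ_mean N (\<lambda>c. exp (c * vec_inner w x) * cnj c ^ k)) \<longlonglongrightarrow> taylor_coeff k (\<lambda>c. exp (c * vec_inner w x))"
      by (rule circ_mean_tendsto_taylor_coeff[where \<rho> = 2]) (auto intro!: holomorphic_intros)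
    then have "(\<lambda>N. cnj (circ_mean N (\<lambda>c. exp (c * vec_inner w x) * cnj c ^ k)) * (hom_part k f w * exp (- (norm w)\<^sup>2))) 
        \<longlonglongrightarrow> cnj (taylor_coeff k (\<lambda>c. exp (c * vec_inner w x))) * (hom_part k f w * exp (- (norm w)\<^sup>2))"
      by (intro tendsto_intros)
    moreover have "cnj (circ_mean N (\<lambda>c. exp (c * vec_inner w x) * cnj c ^ k)) * (hom_part k f w * exp (- (norm w)\<^sup>2)) = 
        circ_mean N (\<lambda>c. hom_part k f (c *s w) * exp (vec_inner x (c *s w)) * exp (- (norm (c *s w))\<^sup>2))" for N
      unfolding cnj_circ_mean circ_mean_mult_right[symmetric]
      by (rule circ_mean_cong)
        (simp add: vec_inner_smult_right norm_smult_vec hom_part_smult[OF line_hol] cnj_vec_inner exp_cnj mult_ac)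
    ultimately show "(\<lambda>N. circ_mean N (\<lambda>c. hom_part k f (c *s w) * exp (vec_inner x (c *s w)) * exp (- (norm (c *s w))\<^sup>2)))
        \<longlonglongrightarrow> (hom_part k f w * vec_inner x w ^ k * exp (- (norm w)\<^sup>2)) * (1 / fact k)"
      by (simp add: taylor_coeff_exp cnj_vec_inner mult_ac)
  qed measurable
  also have "\<dots> = (\<integral>z. (hom_part k f z * vec_inner x z ^ k * exp (- (norm z)\<^sup>2)) \<partial>lborel) * (1 / fact k)"
    by (rule integral_mult_left_zero)
  finally show ?thesis unfolding hom_part_fock_reproducing by (simp add: field_simps)
qed

text \<open>The integrand is homogeneous of real degree \<open>2 * k\<close>, so passing from the
  Gaussian to the ball divides by \<open>fact (CARD('n) + k)\<close>.\<close>

lemma hom_part_ball_moment: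
  "(LINT z:ball 0 1|lborel. hom_part k f z * vec_inner x z ^ k) = fact k * pi ^ CARD('n) / fact (CARD('n) + k) * hom_part k f x"
proof -
  obtain C where C: "C \<ge> 0" "\<And>z. cmod (hom_part k f z) \<le> C * norm z ^ k" using hom_part_bound by blast
  have "(\<integral>z. hom_part k f z * vec_inner x z ^ k * exp (- (norm z)\<^sup>2) \<partial>lborel) =
      fact (CARD('n) + k) * (LINT z:ball 0 1|lborel. hom_part k f z * vec_inner x z ^ k)"
  proof (rule integral_gaussian_homogeneous[OF _ _ _ DIM_complex_vec])
    have [measurable]: "(\<lambda>z. vec_inner x z) \<in> borel_measurable borel"
      by (intro borel_measurable_continuous_onI continuous_intros)
    show "(\<lambda>z. hom_part k f z * vec_inner x z ^ k) \<in> borel_measurable borel" by measurable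
    fix z :: "complex ^ 'n"
    show "hom_part k f (r *\<^sub>R z) * vec_inner x (r *\<^sub>R z) ^ k = r ^ (2 * k) *\<^sub>R (hom_part k f z * vec_inner x z ^ k)" for r
      using hom_part_smult[OF line_hol, of k "of_real r" z]
      by (simp add: smult_vec_of_real vec_inner_scaleR_right power_mult_distrib scaleR_conv_of_real[where 'a = complex] mult_2_right power_add mult_ac)
    have "cmod (hom_part k f z * vec_inner x z ^ k) \<le> (C * norm z ^ k) * (norm x * norm z) ^ k"
      unfolding norm_mult norm_power by (intro mult_mono C power_mono norm_vec_inner_le) (use C in auto)
    then show "cmod (hom_part k f z * vec_inner x z ^ k) \<le> C * norm x ^ k * norm z ^ (2 * k)"
      by (simp add: power_mult_distrib mult_2_right power_add mult_ac)
  qed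
  then show ?thesis unfolding hom_part_gaussian_moment by (simp add: field_simps)
qed

text \<open>Against \<open>vec_inner x z ^ k\<close>, which rotates by \<open>cnj c ^ k\<close>,
  only the component of degree \<open>k\<close> survives averaging. Because \<open>f\<close> may be
  unbounded near the sphere, this is done on balls of radius below 1, followed by a limit in which
  integrability of \<open>f\<close> supplies the majorant.\<close>

lemma ball_moment_eq_hom_part:
  assumes int: "set_integrable lborel (ball 0 1) f"
  shows "(LINT z:ball 0 1|lborel. f z * vec_inner x z ^ k) = fact k * pi ^ CARD('n) / fact (CARD('n) + k) * hom_part k f x"
proof -
  obtain C where C: "C \<ge> 0" "\<And>z. cmod (hom_part k f z) \<le> C * norm z ^ k" using hom_part_bound by blast
  have [measurable]: "(\<lambda>z. vec_inner x z) \<in> borel_measurable borel"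
    by (intro borel_measurable_continuous_onI continuous_intros)
  have f_meas [measurable]: "(\<lambda>z. indicator (ball 0 1) z *\<^sub>R f z) \<in> borel_measurable borel"
    using int unfolding set_integrable_def by (auto dest: borel_measurable_integrable)
  have eq: "(LINT z:ball 0 r|lborel. f z * vec_inner x z ^ k) = (LINT z:ball 0 r|lborel. hom_part k f z * vec_inner x z ^ k)"
    if r: "r < 1" for r
  proof -
    obtain M where M: "M \<ge> 0" "\<And>z. norm z \<le> r \<Longrightarrow> cmod (f z) \<le> M" using bounded_on_cball[OF r] by blast
    have f_meas' [measurable]: "(\<lambda>z. indicator (ball 0 r) z *\<^sub>R (indicator (ball 0 1) z *\<^sub>R f z)) \<in> borel_measurable borel" by measurable
    have ind: "indicator (ball 0 r) z *\<^sub>R (indicator (ball 0 1) z *\<^sub>R f z) = indicator (ball 0 r) z *\<^sub>R f z" for z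
      using r by (auto simp: indicator_def)
    show ?thesis unfolding set_lebesgue_integral_def
    proof (rule integral_eq_circ_average)
      have "indicator (ball 0 r) z *\<^sub>R (f z * vec_inner x z ^ k) = (indicator (ball 0 r) z *\<^sub>R (indicator (ball 0 1) z *\<^sub>R f z)) * vec_inner x z ^ k" for z
        by (simp only: ind) simp
      then show "(\<lambda>z. indicator (ball 0 r) z *\<^sub>R (f z * vec_inner x z ^ k)) \<in> borel_measurable borel"
        by (simp only:) measurable
      show "integrable lborel (\<lambda>z::complex^'n. M * norm x ^ k * indicator (ball 0 r) z)"
        using emeasure_lborel_ball_finite[of "0::complex^'n" r] by (intro integrable_mult_right) (simp add: integrable_indicator_iff)
    next
      fix c :: complex and z :: "complex ^ 'n" assume c: "cmod c = 1"
      show "cmod (indicator (ball 0 r) (c *s z) *\<^sub>R (f (c *s z) * vec_inner x (c *s z) ^ k)) \<le> M * norm x ^ k * indicator (ball 0 r) z"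
      proof (cases "norm z < r")
        case True
        have "cmod (vec_inner x (c *s z)) \<le> norm x * norm (c *s z)" by (rule norm_vec_inner_le)
        also have "\<dots> \<le> norm x" using True r c by (simp add: norm_smult_vec mult_left_le)
        finally have "cmod (vec_inner x (c *s z)) ^ k \<le> norm x ^ k" by (rule power_mono) simp
        then show ?thesis using True c M(1) M(2)[of "c *s z"]
          by (auto simp: norm_mult norm_power norm_smult_vec intro!: mult_mono)
      qed (simp add: norm_smult_vec c)
    next
      fix z :: "complex ^ 'n"
      show "(\<lambda>N. circ_mean N (\<lambda>c. indicator (ball 0 r) (c *s z) *\<^sub>R (f (c *s z) * vec_inner x (c *s z) ^ k)))
          \<longlonglongrightarrow> indicator (ball 0 r) z *\<^sub>R (hom_part k f z * vec_inner x z ^ k)"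
      proof (cases "norm z < r")
        case True
        have "circ_mean N (\<lambda>c. indicator (ball 0 r) (c *s z) *\<^sub>R (f (c *s z) * vec_inner x (c *s z) ^ k)) = 
           circ_mean N (\<lambda>c. f (c *s z) * cnj c ^ k) * vec_inner x z ^ k" for N
          unfolding circ_mean_mult_right[symmetric]
          by (rule circ_mean_cong) (use True in \<open>simp add: norm_smult_vec vec_inner_smult_right power_mult_distrib\<close>)
        then show ?thesis using True r tendsto_mult[OF circ_mean_hom_part[of z k] tendsto_const[of "vec_inner x z ^ k"]] by simp
      next
        case False
        then have "circ_mean N (\<lambda>c. indicator (ball 0 r) (c *s z) *\<^sub>R (f (c *s z) * vec_inner x (c *s z) ^ k)) = 0" for N
          unfolding circ_mean_def by (simp add: norm_smult_vec indicator_def)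
        then show ?thesis using False by simp
      qed
    qed measurable
  qed
  define r where "r j = 1 - 1 / (real j + 1)" for j :: nat
  have r1: "r j < 1" for j by (simp add: r_def)
  have "r \<longlonglongrightarrow> 1 - 0" unfolding r_def by (intro tendsto_intros lim_1_over_real_power[of 1, simplified] LIMSEQ_ignore_initial_segment) real_asymp
  then have rlim: "r \<longlonglongrightarrow> 1" by simp
  have lim: "(\<lambda>j. LINT z:ball 0 (r j)|lborel. g z * vec_inner x z ^ k) \<longlonglongrightarrow> (LINT z:ball 0 1|lborel. g z * vec_inner x z ^ k)"
    if g: "set_integrable lborel (ball 0 1) g" for g
    unfolding set_lebesgue_integral_def
  proof (rule integral_dominated_convergence)
    have [measurable]: "(\<lambda>z. indicator (ball 0 1) z *\<^sub>R g z) \<in> borel_measurable borel"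
      using g unfolding set_integrable_def by (auto dest: borel_measurable_integrable)
    have "(\<lambda>z. (indicator (ball 0 1) z *\<^sub>R g z) * vec_inner x z ^ k) \<in> borel_measurable borel" by measurable
    then show "(\<lambda>z. indicator (ball 0 1) z *\<^sub>R (g z * vec_inner x z ^ k)) \<in> borel_measurable lborel" by simp
    fix j
    have "indicator (ball 0 (r j)) z *\<^sub>R (g z * vec_inner x z ^ k) = indicator (ball 0 (r j)) z *\<^sub>R ((indicator (ball 0 1) z *\<^sub>R g z) * vec_inner x z ^ k)"
      for z using r1[of j] by (auto simp: indicator_def)
    then show "(\<lambda>z. indicator (ball 0 (r j)) z *\<^sub>R (g z * vec_inner x z ^ k)) \<in> borel_measurable lborel"
      by (simp only:) measurable
    show "AE z in lborel. norm (indicator (ball 0 (r j)) z *\<^sub>R (g z * vec_inner x z ^ k)) \<le> norm x ^ k * norm (indicator (ball 0 1) z *\<^sub>R g z)"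
    proof (rule AE_I2)
      fix z :: "complex ^ 'n"
      show "norm (indicator (ball 0 (r j)) z *\<^sub>R (g z * vec_inner x z ^ k)) \<le> norm x ^ k * norm (indicator (ball 0 1) z *\<^sub>R g z)"
      proof (cases "norm z < r j")
        case True
        then have z: "norm z < 1" using r1[of j] by simp
        have "cmod (vec_inner x z) \<le> norm x * norm z" by (rule norm_vec_inner_le)
        also have "\<dots> \<le> norm x" using z by (simp add: mult_left_le)
        finally have "cmod (vec_inner x z) ^ k \<le> norm x ^ k" by (rule power_mono) simp
        then show ?thesis using True z by (simp add: norm_mult norm_power mult.commute mult_left_mono mult_right_mono)
      qed (simp add: indicator_def)
    qed
  next
    show "AE z in lborel. (\<lambda>j. indicator (ball 0 (r j)) z *\<^sub>R (g z * vec_inner x z ^ k)) \<longlonglongrightarrow> indicator (ball 0 1) z *\<^sub>R (g z * vec_inner x z ^ k)"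
    proof (rule AE_I2)
      fix z :: "complex ^ 'n"
      show "(\<lambda>j. indicator (ball 0 (r j)) z *\<^sub>R (g z * vec_inner x z ^ k)) \<longlonglongrightarrow> indicator (ball 0 1) z *\<^sub>R (g z * vec_inner x z ^ k)"
      proof (cases "norm z < 1")
        case True
        have "\<forall>\<^sub>F j in sequentially. indicator (ball 0 (r j)) z *\<^sub>R (g z * vec_inner x z ^ k) = indicator (ball 0 1) z *\<^sub>R (g z * vec_inner x z ^ k)"
          using order_tendstoD(1)[OF rlim True] by eventually_elim (use True in simp)
        then show ?thesis by (rule tendsto_eventually)
      next
        case False
        then have "\<not> norm z < r j" for j using r1[of j] by linarith
        then show ?thesis using False by simp
      qed
    qed
  next
    show "integrable lborel (\<lambda>z. norm x ^ k * norm (indicator (ball 0 1) z *\<^sub>R g z))"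
      using g unfolding set_integrable_def by (intro integrable_mult_right integrable_norm)
  qed
  \<comment> \<open>The same limit is applied to \<open>hom_part k f\<close>. By \<open>eq\<close>
    both sequences coincide, hence so do their limits.\<close>
  have "set_integrable lborel (ball 0 1) (hom_part k f)"
    unfolding set_integrable_def
  proof (rule Bochner_Integration.integrable_bound)
    show "integrable lborel (\<lambda>z::complex^'n. C * indicator (ball 0 1) z)"
      using emeasure_lborel_ball_finite[of "0::complex^'n" 1] by (intro integrable_mult_right) (simp add: integrable_indicator_iff)
    have "C * norm z ^ k \<le> C" if "norm z < 1" for z :: "complex ^ 'n"
      using that C(1) by (simp add: mult_left_le power_le_one)
    then have "cmod (hom_part k f z) \<le> C" if "norm z < 1" for z using C(2)[of z] that order_trans by blast
    then show "AE z in lborel. norm (indicator (ball 0 1) z *\<^sub>R hom_part k f z) \<le> norm (C * indicator (ball 0 1) z)"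
      using C(1) by (intro AE_I2) (auto simp: indicator_def)
  qed measurable
  from LIMSEQ_unique[OF lim[OF int] lim[OF this, unfolded eq[OF r1, symmetric]]]
  show ?thesis unfolding hom_part_ball_moment by simp
qed

end

subsection \<open>The Bergman kernel of a ball\<close>

lemma neg_binomial_sums:
  fixes u :: complex
  assumes "cmod u < 1"
  shows "(\<lambda>k. of_nat ((n + k) choose k) * u ^ k) sums (1 / (1 - u) ^ (n + 1))"
proof -
  have "(\<lambda>k. ((- of_nat (n + 1) :: complex) gchoose k) * (- u) ^ k) sums (1 + (- u)) powr (- of_nat (n + 1))"
    by (rule gen_binomial_complex) (use assms in simp)
  moreover have "((- of_nat (n + 1) :: complex) gchoose k) * (- u) ^ k = of_nat ((n + k) choose k) * u ^ k" for k
  proof -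
    have "((- of_nat (n + 1) :: complex) gchoose k) = (-1) ^ k * (of_nat (n + k) gchoose k)"
      by (subst gbinomial_minus) (simp add: algebra_simps)
    also have "\<dots> = (-1) ^ k * of_nat ((n + k) choose k)" by (simp only: binomial_gbinomial)
    finally show ?thesis by (simp add: power_minus[of u])
  qed
  moreover have "1 - u \<noteq> 0" using assms by auto
  then have "(1 + (- u)) powr (- of_nat (n + 1)) = 1 / (1 - u) ^ (n + 1)"
    using powr_nat'[of "1 - u" "n + 1"] by (simp only: powr_minus add_uminus_conv_diff inverse_eq_divide) simp
  ultimately show ?thesis by simp
qed

lemma borel_measurable_cnj [measurable]: "cnj \<in> borel_measurable borel"
  by (intro borel_measurable_continuous_onI continuous_intros)

lemma integrable_mult_bounded:
  fixes F s :: "'a \<Rightarrow> complex"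
  assumes F: "integrable M F" and [measurable]: "s \<in> borel_measurable M"
    and bound: "\<And>z. z \<in> space M \<Longrightarrow> F z \<noteq> 0 \<Longrightarrow> cmod (s z) \<le> B"
  shows "integrable M (\<lambda>z. F z * s z)"
proof (rule Bochner_Integration.integrable_bound)
  show "integrable M (\<lambda>z. B * cmod (F z))" using F by (intro integrable_mult_right integrable_norm)
  have [measurable]: "F \<in> borel_measurable M" using F by (rule borel_measurable_integrable)
  show "(\<lambda>z. F z * s z) \<in> borel_measurable M" by measurable
  show "AE z in M. norm (F z * s z) \<le> norm (B * cmod (F z))"
  proof (rule AE_I2)
    fix z assume "z \<in> space M"
    show "norm (F z * s z) \<le> norm (B * cmod (F z))"
    proof (cases "F z = 0")
      case False
      then show ?thesis using bound[OF \<open>z \<in> space M\<close>] 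
        by (simp add: norm_mult mult.commute mult_left_mono order_trans[OF _ abs_ge_self])
    qed simp
  qed
qed

text \<open>The kernel is expanded by \<open>neg_binomial_sums\<close>. The binomial coefficient
  turns the factor \<open>fact k / fact (CARD('n) + k)\<close> of the moment of degree
  \<open>k\<close> into \<open>1 / fact CARD('n)\<close>, independent of \<open>k\<close>; so the
  integral is a constant times the sum of all homogeneous components at \<open>x\<close>.\<close>

lemma (in ball_holomorphic) unit_ball_reproducing:
  assumes int: "set_integrable lborel (ball 0 1) f" and x: "norm x < 1"
  shows "(LINT z:ball 0 1|lborel. f z * (1 / (1 - vec_inner x z) ^ (CARD('n) + 1))) = pi ^ CARD('n) / fact CARD('n) * f x"
proof -
  let ?n = "CARD('n)"
  define F where "F z = indicator (ball 0 1) z *\<^sub>R f z" for z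
  have F: "integrable lborel F" using int by (simp add: F_def[abs_def] set_integrable_def)
  have F0: "norm z < 1" if "F z \<noteq> 0" for z using that by (auto simp: F_def indicator_def split: if_splits)
  have [measurable]: "F \<in> borel_measurable borel" using F by (auto dest: borel_measurable_integrable)
  have [measurable]: "(\<lambda>z. vec_inner x z) \<in> borel_measurable borel"
    by (intro borel_measurable_continuous_onI continuous_intros)
  have vx: "cmod (vec_inner x z) \<le> norm x" if "norm z < 1" for z
    using norm_vec_inner_le[of x z] mult_left_le[of "norm z" "norm x"] that by simp
  define S where "S K z = (\<Sum>k<K. of_nat ((?n + k) choose k) * vec_inner x z ^ k)" for K z
  have Smeas [measurable]: "S K \<in> borel_measurable borel" for K unfolding S_def by measurable
  \<comment> \<open>The series at the real point \<open>norm x < 1\<close> majorises all partial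
    sums \<open>S K z\<close> uniformly in \<open>z\<close>.\<close>
  have G: "(\<lambda>k. real ((?n + k) choose k) * norm x ^ k) sums (1 / (1 - norm x) ^ (?n + 1))"
  proof -
    have "(\<lambda>k. Re (of_nat ((?n + k) choose k) * of_real (norm x) ^ k)) sums Re (1 / (1 - of_real (norm x)) ^ (?n + 1))"
      by (rule sums_Re, rule neg_binomial_sums) (use x in simp)
    moreover have "Re (1 / (1 - of_real (norm x)) ^ (?n + 1)) = 1 / (1 - norm x) ^ (?n + 1)"
      by (metis Re_complex_of_real of_real_1 of_real_diff of_real_divide of_real_power)
    moreover have "Re (of_nat ((?n + k) choose k) * of_real (norm x) ^ k) = real ((?n + k) choose k) * norm x ^ k" for k
      by (metis Re_complex_of_real of_real_mult of_real_of_nat_eq of_real_power)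
    ultimately show ?thesis by simp
  qed
  have S_bound: "cmod (S K z) \<le> 1 / (1 - norm x) ^ (?n + 1)" if z: "norm z < 1" for K z
  proof -
    have "cmod (S K z) \<le> (\<Sum>k<K. real ((?n + k) choose k) * norm x ^ k)"
      unfolding S_def by (rule sum_norm_le) (auto simp: norm_mult norm_power intro!: mult_left_mono power_mono vx z)
    also have "\<dots> \<le> (\<Sum>k. real ((?n + k) choose k) * norm x ^ k)"
      by (rule sum_le_suminf) (use G in \<open>auto simp: sums_iff\<close>)
    finally show ?thesis using G by (simp add: sums_iff)
  qed
  have "(\<lambda>K. \<integral>z. F z * S K z \<partial>lborel) \<longlonglongrightarrow> (\<integral>z. F z * (1 / (1 - vec_inner x z) ^ (?n + 1)) \<partial>lborel)"
  proof (rule integral_dominated_convergence)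
    show "integrable lborel (\<lambda>z. 1 / (1 - norm x) ^ (?n + 1) * cmod (F z))"
      using F by (intro integrable_mult_right integrable_norm)
    show "AE z in lborel. (\<lambda>K. F z * S K z) \<longlonglongrightarrow> F z * (1 / (1 - vec_inner x z) ^ (?n + 1))"
    proof (rule AE_I2)
      fix z
      show "(\<lambda>K. F z * S K z) \<longlonglongrightarrow> F z * (1 / (1 - vec_inner x z) ^ (?n + 1))"
      proof (cases "F z = 0")
        case False
        then have "cmod (vec_inner x z) < 1" using vx[OF F0] x by fastforce
        then show ?thesis using neg_binomial_sums[of "vec_inner x z" ?n] unfolding sums_def S_def
          by (intro tendsto_mult tendsto_const)
      qed simp
    qed
    show "AE z in lborel. norm (F z * S K z) \<le> 1 / (1 - norm x) ^ (?n + 1) * cmod (F z)" for K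
    proof (rule AE_I2)
      fix z
      show "norm (F z * S K z) \<le> 1 / (1 - norm x) ^ (?n + 1) * cmod (F z)"
      proof (cases "F z = 0")
        case False
        show ?thesis unfolding norm_mult mult.commute[of "cmod (F z)"] 
          by (rule mult_right_mono[OF S_bound[OF F0[OF False]]]) simp
      qed simp
    qed
  qed measurable
  moreover have "(\<integral>z. F z * S K z \<partial>lborel) = pi ^ ?n / fact ?n * (\<Sum>k<K. hom_part k f x)" for K
  proof -
    have "(\<integral>z. F z * S K z \<partial>lborel) = (\<integral>z. (\<Sum>k<K. of_nat ((?n + k) choose k) * (F z * vec_inner x z ^ k)) \<partial>lborel)"
      unfolding S_def sum_distrib_left by (simp add: mult_ac)
    also have "\<dots> = (\<Sum>k<K. of_nat ((?n + k) choose k) * (\<integral>z. F z * vec_inner x z ^ k \<partial>lborel))"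
    proof (subst Bochner_Integration.integral_sum)
      fix k
      have "integrable lborel (\<lambda>z. F z * vec_inner x z ^ k)"
        by (rule integrable_mult_bounded[OF F, where B = "norm x ^ k"])
          (auto simp: norm_power intro!: power_mono vx F0)
      then show "integrable lborel (\<lambda>z. of_nat ((?n + k) choose k) * (F z * vec_inner x z ^ k))"
        by (rule integrable_mult_right)
    qed simp
    also have "\<dots> = (\<Sum>k<K. pi ^ ?n / fact ?n * hom_part k f x)"
    proof (rule sum.cong[OF refl])
      fix k
      have "(\<integral>z. F z * vec_inner x z ^ k \<partial>lborel) = (LINT z:ball 0 1|lborel. f z * vec_inner x z ^ k)"
        by (simp add: F_def set_lebesgue_integral_def)
      also have "\<dots> = fact k * pi ^ ?n / fact (?n + k) * hom_part k f x" by (rule ball_moment_eq_hom_part[OF int])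
      finally have "(\<integral>z. F z * vec_inner x z ^ k \<partial>lborel) = fact k * pi ^ ?n / fact (?n + k) * hom_part k f x" .
      moreover have "(of_nat ((?n + k) choose k) :: complex) = fact (?n + k) / (fact k * fact ?n)"
        by (subst binomial_fact) auto
      ultimately show "of_nat ((?n + k) choose k) * (\<integral>z. F z * vec_inner x z ^ k \<partial>lborel) = pi ^ ?n / fact ?n * hom_part k f x"
        by simp
    qed
    finally show ?thesis by (simp add: sum_distrib_left)
  qed
  moreover have "(\<lambda>K. pi ^ ?n / fact ?n * (\<Sum>k<K. hom_part k f x)) \<longlonglongrightarrow> pi ^ ?n / fact ?n * f x"
    using hom_part_sums[OF x] unfolding sums_def by (intro tendsto_intros)
  ultimately have "(\<integral>z. F z * (1 / (1 - vec_inner x z) ^ (?n + 1)) \<partial>lborel) = pi ^ ?n / fact ?n * f x"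
    by (simp add: LIMSEQ_unique)
  then show ?thesis by (simp only: F_def set_lebesgue_integral_def mult_scaleR_left)
qed

text \<open>The reproducing kernel with base point \<open>w\<close>, analytic in \<open>z\<close>.
  The inner product is normalised by the volume, so the constant in front is 1; extension by 0 makes
  it an element of \<open>A2\<close>.\<close>

definition bergman :: "complex ^ 'n \<Rightarrow> real \<Rightarrow> complex ^ 'n \<Rightarrow> complex ^ 'n \<Rightarrow> complex" where
  "bergman \<omega> R w z = (if z \<in> ball \<omega> R then 1 / (1 - vec_inner (z - \<omega>) (w - \<omega>) / of_real (R\<^sup>2)) ^ (CARD('n) + 1) else 0)"

lemma bounded_linear_smult_vec: "bounded_linear (\<lambda>c. c *s (y :: complex ^ 'n))"
  by (rule bounded_linear_intro[where K = "norm y"])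
    (simp_all add: vec_eq_iff algebra_simps norm_smult_vec)

lemma has_field_derivative_on_line:
  fixes f :: "complex ^ 'n \<Rightarrow> complex"
  assumes f: "(f has_derivative f') (at (x + c *s y))" and lin: "Vector_Spaces.linear (*s) (*) f'"
  shows "((\<lambda>c. f (x + c *s y)) has_field_derivative f' y) (at c)"
proof -
  have "((\<lambda>c. x + c *s y) has_derivative (\<lambda>h. 0 + h *s y)) (at c)"
    by (intro derivative_intros bounded_linear_imp_has_derivative[OF bounded_linear_smult_vec])
  then have "((\<lambda>c. x + c *s y) has_derivative (\<lambda>h. h *s y)) (at c)" by simp
  from has_derivative_compose[OF this f] have "((\<lambda>c. f (x + c *s y)) has_derivative (\<lambda>h. f' (h *s y))) (at c)" .
  moreover have "f' (h *s y) = f' y * h" for h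
  proof -
    interpret Vector_Spaces.linear "(*s)" "(*)" f' by fact
    show ?thesis by (simp add: scale mult.commute)
  qed
  ultimately show ?thesis by (simp add: has_field_derivative_def)
qed

lemma analytic_fun_on_imp_line_holomorphic:
  assumes "analytic_fun_on f S"
  shows "line_holomorphic f S"
  unfolding line_holomorphic_def
proof (intro allI)
  fix x y
  show "(\<lambda>c. f (x + c *s y)) holomorphic_on {c. x + c *s y \<in> S}"
    unfolding holomorphic_on_def
  proof
    fix c assume "c \<in> {c. x + c *s y \<in> S}"
    then obtain f' where "(f has_derivative f') (at (x + c *s y))" "Vector_Spaces.linear (*s) (*) f'"
      using assms unfolding analytic_fun_on_def by auto
    from has_field_derivative_on_line[OF this]
    show "(\<lambda>c. f (x + c *s y)) field_differentiable at c within {c. x + c *s y \<in> S}"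
      using field_differentiable_at_within field_differentiable_def by blast
  qed
qed

lemma analytic_fun_on_imp_continuous_on: "analytic_fun_on f S \<Longrightarrow> continuous_on S f"
  unfolding analytic_fun_on_def by (meson continuous_at_imp_continuous_on has_derivative_continuous)

lemma set_integrable_mult_square:
  fixes f g :: "'a \<Rightarrow> complex"
  assumes [measurable]: "(\<lambda>z. indicator A z *\<^sub>R f z) \<in> borel_measurable M" "(\<lambda>z. indicator A z *\<^sub>R g z) \<in> borel_measurable M"
    and f: "set_integrable M A (\<lambda>z. (cmod (f z))\<^sup>2)" and g: "set_integrable M A (\<lambda>z. (cmod (g z))\<^sup>2)"
  shows "set_integrable M A (\<lambda>z. f z * g z)"
  unfolding set_integrable_def
proof (rule Bochner_Integration.integrable_bound)
  show "integrable M (\<lambda>z. indicator A z *\<^sub>R (cmod (f z))\<^sup>2 + indicator A z *\<^sub>R (cmod (g z))\<^sup>2)"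
    using f g unfolding set_integrable_def by (rule Bochner_Integration.integrable_add)
  have "indicator A z *\<^sub>R (f z * g z) = (indicator A z *\<^sub>R f z) * (indicator A z *\<^sub>R g z)" for z
    by (simp add: indicator_def)
  then show "(\<lambda>z. indicator A z *\<^sub>R (f z * g z)) \<in> borel_measurable M" by (simp only:) measurable
  have "cmod (f z) * cmod (g z) \<le> (cmod (f z))\<^sup>2 + (cmod (g z))\<^sup>2" for z
  proof -
    have "2 * (cmod (f z) * cmod (g z)) \<le> (cmod (f z))\<^sup>2 + (cmod (g z))\<^sup>2"
      using zero_le_power2[of "cmod (f z) - cmod (g z)"] by (simp add: power2_diff)
    moreover have "0 \<le> cmod (f z) * cmod (g z)" by simp
    ultimately show ?thesis by linarith
  qed
  then show "AE z in M. norm (indicator A z *\<^sub>R (f z * g z)) \<le> norm (indicator A z *\<^sub>R (cmod (f z))\<^sup>2 + indicator A z *\<^sub>R (cmod (g z))\<^sup>2)"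
    by (intro AE_I2) (simp add: indicator_def norm_mult)
qed

section \<open>Square-integrable analytic functions on a ball and the reproducing property\<close>

locale bergman_ball =
  fixes \<omega> :: "complex ^ 'n" and R :: real
  assumes R: "R > 0"
begin

lemma A2D:
  assumes "f \<in> A2 \<omega> R"
  shows "analytic_fun_on f (ball \<omega> R)" "set_integrable lborel (ball \<omega> R) (\<lambda>z. (cmod (f z))\<^sup>2)" 
    "z \<notin> ball \<omega> R \<Longrightarrow> f z = 0"
  using assms unfolding A2_def by auto

lemma A2_measurable:
  assumes "f \<in> A2 \<omega> R"
  shows "f \<in> borel_measurable borel"
proof -
  have "(\<lambda>z. indicator (ball \<omega> R) z *\<^sub>R f z) \<in> borel_measurable borel"
    by (rule borel_measurable_continuous_on_indicator) 
      (simp_all add: analytic_fun_on_imp_continuous_on A2D(1)[OF assms])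
  moreover have "indicator (ball \<omega> R) z *\<^sub>R f z = f z" for z
    using A2D(3)[OF assms] by (auto simp: indicator_def)
  ultimately show ?thesis by simp
qed

lemma A2_integrable_square:
  assumes "f \<in> A2 \<omega> R"
  shows "integrable lborel (\<lambda>z. (cmod (f z))\<^sup>2)"
proof -
  have "indicator (ball \<omega> R) z *\<^sub>R (cmod (f z))\<^sup>2 = (cmod (f z))\<^sup>2" for z
    using A2D(3)[OF assms] by (cases "z \<in> ball \<omega> R") (auto simp: indicator_def)
  then show ?thesis using A2D(2)[OF assms] unfolding set_integrable_def by (simp only:)
qed

lemma A2_mult_cnj_integrable:
  assumes f: "f \<in> A2 \<omega> R" and g: "g \<in> A2 \<omega> R"
  shows "integrable lborel (\<lambda>z. f z * cnj (g z))"
proof -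
  have "set_integrable lborel UNIV (\<lambda>z. f z * cnj (g z))"
    by (rule set_integrable_mult_square)
      (use A2_measurable[OF f] A2_measurable[OF g] A2_integrable_square[OF f] A2_integrable_square[OF g] in \<open>auto simp: set_integrable_def\<close>)
  then show ?thesis by (simp add: set_integrable_def)
qed

text \<open>The ball has finite measure, so \<open>f\<close> is a product of two square-integrable
  functions. Integrability of \<open>f\<close> itself supplies the majorants when \<open>f\<close>
  is multiplied by bounded kernels.\<close>

lemma A2_integrable:
  assumes f: "f \<in> A2 \<omega> R"
  shows "integrable lborel f"
proof -
  have "set_integrable lborel (ball \<omega> R) (\<lambda>z. f z * 1)"
  proof (rule set_integrable_mult_square)
    have [measurable]: "f \<in> borel_measurable borel" by (rule A2_measurable[OF f])
    show "(\<lambda>z. indicator (ball \<omega> R) z *\<^sub>R f z) \<in> borel_measurable lborel" by measurable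
    show "(\<lambda>z. indicat_real (ball \<omega> R) z *\<^sub>R (1::complex)) \<in> borel_measurable lborel" by measurable
    show "set_integrable lborel (ball \<omega> R) (\<lambda>z. (cmod 1)\<^sup>2)"
      using emeasure_lborel_ball_finite[of \<omega> R] by (simp add: set_integrable_def integrable_indicator_iff)
  qed (rule A2D(2)[OF f])
  moreover have "indicator (ball \<omega> R) z *\<^sub>R (f z * 1) = f z" for z
    using A2D(3)[OF f] by (auto simp: indicator_def)
  ultimately show ?thesis by (simp add: set_integrable_def)
qed

lemma A2_inner_alt:
  assumes f: "f \<in> A2 \<omega> R"
  shows "A2_inner \<omega> R f g = complex_of_real ((fact CARD('n) / pi ^ CARD('n)) / R ^ (2 * CARD('n))) * (\<integral>z. f z * cnj (g z) \<partial>lborel)"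
proof -
  have "indicator (ball \<omega> R) z *\<^sub>R (f z * cnj (g z)) = f z * cnj (g z)" for z
    using A2D(3)[OF f] by (auto simp: indicator_def)
  then show ?thesis by (simp add: A2_inner_def set_lebesgue_integral_def)
qed

text \<open>An affine substitution reduces to the unit ball; its Jacobian and the volume factor of
  \<open>unit_ball_reproducing\<close> cancel against the normalisation of the inner
  product.\<close>

lemma A2_reproducing:
  assumes f: "f \<in> A2 \<omega> R" and x: "x \<in> ball \<omega> R"
  shows "A2_inner \<omega> R f (bergman \<omega> R x) = f x"
proof -
  let ?n = "CARD('n)"
  define F where "F z = f (\<omega> + R *\<^sub>R z)" for z
  define \<xi> where "\<xi> = (1 / R) *\<^sub>R (x - \<omega>)"
  have \<xi>: "norm \<xi> < 1" using x R by (simp add: \<xi>_def dist_norm norm_minus_commute)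
  have x_eq: "x = \<omega> + R *\<^sub>R \<xi>" using R by (simp add: \<xi>_def)
  have in_ball: "\<omega> + R *\<^sub>R z \<in> ball \<omega> R \<longleftrightarrow> norm z < 1" for z using R by (simp add: dist_norm)
  interpret F: ball_holomorphic F
  proof
    show "line_holomorphic F (ball 0 1)"
      unfolding line_holomorphic_def
    proof (intro allI)
      fix a y
      have "(\<lambda>c. f ((\<omega> + R *\<^sub>R a) + c *s (R *\<^sub>R y))) holomorphic_on {c. (\<omega> + R *\<^sub>R a) + c *s (R *\<^sub>R y) \<in> ball \<omega> R}"
        using analytic_fun_on_imp_line_holomorphic[OF A2D(1)[OF f]] unfolding line_holomorphic_def by blast
      moreover have "(\<omega> + R *\<^sub>R a) + c *s (R *\<^sub>R y) = \<omega> + R *\<^sub>R (a + c *s y)" for c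
        by (simp add: vec_eq_iff algebra_simps)
      ultimately show "(\<lambda>c. F (a + c *s y)) holomorphic_on {c. a + c *s y \<in> ball 0 1}"
        by (simp only: in_ball F_def mem_ball_0)
    qed
    show "continuous_on (ball 0 1) F" unfolding F_def
      by (intro continuous_on_compose2[OF analytic_fun_on_imp_continuous_on[OF A2D(1)[OF f]]] continuous_intros)
        (use in_ball in auto)
  qed
  have [measurable]: "f \<in> borel_measurable borel" by (rule A2_measurable[OF f])
  have F_int: "set_integrable lborel (ball 0 1) F"
  proof -
    have "integrable lborel F"
      unfolding F_def using A2_integrable[OF f] R by (subst lborel_integrable_affine_iff) auto
    then show ?thesis unfolding set_integrable_def by (intro integrable_mult_indicator) auto
  qed
  have [measurable]: "(\<lambda>z. vec_inner z (x - \<omega>)) \<in> borel_measurable borel"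
    by (intro borel_measurable_continuous_onI continuous_intros)
  have [measurable]: "bergman \<omega> R x \<in> borel_measurable borel"
    unfolding bergman_def by measurable
  have "(\<integral>z. f z * cnj (bergman \<omega> R x z) \<partial>lborel) = R ^ (2 * ?n) *\<^sub>R (\<integral>z. f (\<omega> + R *\<^sub>R z) * cnj (bergman \<omega> R x (\<omega> + R *\<^sub>R z)) \<partial>lborel)"
    using R by (subst lborel_integral_affine[of _ R \<omega>]) (simp_all add: mult.commute)
  also have "(\<integral>z. f (\<omega> + R *\<^sub>R z) * cnj (bergman \<omega> R x (\<omega> + R *\<^sub>R z)) \<partial>lborel) = 
      (LINT z:ball 0 1|lborel. F z * (1 / (1 - vec_inner \<xi> z) ^ (?n + 1)))"
    unfolding set_lebesgue_integral_def
  proof (rule Bochner_Integration.integral_cong[OF refl])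
    fix z
    have "cnj (vec_inner (R *\<^sub>R z) (x - \<omega>) / of_real (R\<^sup>2)) = vec_inner \<xi> z"
      using R by (simp add: cnj_vec_inner \<xi>_def vec_inner_scaleR_left vec_inner_scaleR_right power2_eq_square)
    then show "f (\<omega> + R *\<^sub>R z) * cnj (bergman \<omega> R x (\<omega> + R *\<^sub>R z)) = indicator (ball 0 1) z *\<^sub>R (F z * (1 / (1 - vec_inner \<xi> z) ^ (?n + 1)))"
      unfolding bergman_def in_ball by (simp add: F_def indicator_def)
  qed
  also have "\<dots> = pi ^ ?n / fact ?n * f x"
    unfolding F.unit_ball_reproducing[OF F_int \<xi>] by (simp add: F_def x_eq)
  finally show ?thesis unfolding A2_inner_alt[OF f] using R by (simp add: scaleR_conv_of_real)
qed

end

subsection \<open>Closure properties of analytic functions\<close>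

lemma complex_linear_iff:
  "Vector_Spaces.linear (*s) (*) (f :: complex ^ 'n \<Rightarrow> complex) \<longleftrightarrow>
     (\<forall>x y. f (x + y) = f x + f y) \<and> (\<forall>c x. f (c *s x) = c * f x)"
  by (simp add: Vector_Spaces.linear_iff vec.vector_space_axioms vector_space_over_itself.vector_space_axioms)

lemma analytic_fun_on_const: "analytic_fun_on (\<lambda>z. c) S"
  unfolding analytic_fun_on_def complex_linear_iff
  by (intro ballI exI[of _ "\<lambda>_. 0"]) auto

lemma analytic_fun_on_vec_inner: "analytic_fun_on (\<lambda>z. vec_inner (z - a) w) S"
  unfolding analytic_fun_on_def complex_linear_iff
proof (intro ballI exI conjI allI)
  fix z
  have "((\<lambda>z. vec_inner z w - vec_inner a w) has_derivative (\<lambda>h. vec_inner h w - 0)) (at z)"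
    by (intro has_derivative_diff bounded_linear_imp_has_derivative[OF bounded_linear_vec_inner_left] has_derivative_const)
  then show "((\<lambda>z. vec_inner (z - a) w) has_derivative (\<lambda>h. vec_inner h w)) (at z)"
    by (simp add: vec_inner_diff_left)
qed (auto simp: vec_inner_add_left vec_inner_smult_left)

lemma analytic_fun_on_add:
  assumes "analytic_fun_on f S" "analytic_fun_on g S"
  shows "analytic_fun_on (\<lambda>z. f z + g z) S"
  unfolding analytic_fun_on_def
proof
  fix z assume "z \<in> S"
  then obtain f' g' where fg: "(f has_derivative f') (at z)" "(g has_derivative g') (at z)" 
    "Vector_Spaces.linear (*s) (*) f'" "Vector_Spaces.linear (*s) (*) g'"
    using assms unfolding analytic_fun_on_def by blast
  have "((\<lambda>z. f z + g z) has_derivative (\<lambda>h. f' h + g' h)) (at z)"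
    by (intro has_derivative_add fg)
  moreover have "Vector_Spaces.linear (*s) (*) (\<lambda>h. f' h + g' h)"
    using fg(3,4) unfolding complex_linear_iff by (simp add: algebra_simps)
  ultimately show "\<exists>F'. ((\<lambda>z. f z + g z) has_derivative F') (at z) \<and> Vector_Spaces.linear (*s) (*) F'" by blast
qed

lemma analytic_fun_on_mult:
  assumes "analytic_fun_on f S" "analytic_fun_on g S"
  shows "analytic_fun_on (\<lambda>z. f z * g z) S"
  unfolding analytic_fun_on_def
proof
  fix z assume "z \<in> S"
  then obtain f' g' where fg: "(f has_derivative f') (at z)" "(g has_derivative g') (at z)" 
    "Vector_Spaces.linear (*s) (*) f'" "Vector_Spaces.linear (*s) (*) g'"
    using assms unfolding analytic_fun_on_def by blast
  have "((\<lambda>z. f z * g z) has_derivative (\<lambda>h. f z * g' h + f' h * g z)) (at z)"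
    by (intro has_derivative_mult fg)
  moreover have "Vector_Spaces.linear (*s) (*) (\<lambda>h. f z * g' h + f' h * g z)"
    using fg(3,4) unfolding complex_linear_iff by (simp add: algebra_simps)
  ultimately show "\<exists>F'. ((\<lambda>z. f z * g z) has_derivative F') (at z) \<and> Vector_Spaces.linear (*s) (*) F'" by blast
qed

lemma analytic_fun_on_inverse:
  assumes "analytic_fun_on f S" "\<And>z. z \<in> S \<Longrightarrow> f z \<noteq> 0"
  shows "analytic_fun_on (\<lambda>z. inverse (f z)) S"
  unfolding analytic_fun_on_def
proof
  fix z assume z: "z \<in> S"
  then obtain f' where f: "(f has_derivative f') (at z)" "Vector_Spaces.linear (*s) (*) f'"
    using assms unfolding analytic_fun_on_def by blast
  have "((\<lambda>z. inverse (f z)) has_derivative (\<lambda>h. - (inverse (f z) * f' h * inverse (f z)))) (at z)"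
    by (rule Deriv.has_derivative_inverse[OF assms(2)[OF z] f(1)])
  moreover have "Vector_Spaces.linear (*s) (*) (\<lambda>h. - (inverse (f z) * f' h * inverse (f z)))"
    using f(2) unfolding complex_linear_iff by (simp add: algebra_simps)
  ultimately show "\<exists>F'. ((\<lambda>z. inverse (f z)) has_derivative F') (at z) \<and> Vector_Spaces.linear (*s) (*) F'" by blast
qed

lemma analytic_fun_on_power: "analytic_fun_on f S \<Longrightarrow> analytic_fun_on (\<lambda>z. f z ^ k) S"
  by (induction k) (auto intro: analytic_fun_on_const analytic_fun_on_mult)

lemma analytic_fun_on_cong:
  assumes "analytic_fun_on f S" "open S" "\<And>z. z \<in> S \<Longrightarrow> f z = g z"
  shows "analytic_fun_on g S"
  unfolding analytic_fun_on_def
proof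
  fix z assume z: "z \<in> S"
  then obtain f' where f: "(f has_derivative f') (at z)" "Vector_Spaces.linear (*s) (*) f'"
    using assms unfolding analytic_fun_on_def by blast
  from has_derivative_transform_within_open[OF f(1) assms(2) z assms(3)] f(2)
  show "\<exists>F'. (g has_derivative F') (at z) \<and> Vector_Spaces.linear (*s) (*) F'" by blast
qed

subsection \<open>The norms of the function spaces\<close>

lemma integral_Cauchy_Schwarz:
  fixes f g :: "'a \<Rightarrow> real"
  assumes f: "integrable M (\<lambda>z. (f z)\<^sup>2)" and g: "integrable M (\<lambda>z. (g z)\<^sup>2)" and fg: "integrable M (\<lambda>z. f z * g z)"
  shows "(\<integral>z. f z * g z \<partial>M)\<^sup>2 \<le> (\<integral>z. (f z)\<^sup>2 \<partial>M) * (\<integral>z. (g z)\<^sup>2 \<partial>M)"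
proof -
  define a b c where "a = (\<integral>z. (f z)\<^sup>2 \<partial>M)" and "b = (\<integral>z. f z * g z \<partial>M)" and "c = (\<integral>z. (g z)\<^sup>2 \<partial>M)"
  have quad: "0 \<le> a * s\<^sup>2 + 2 * b * s * t + c * t\<^sup>2" for s t
  proof -
    have "0 \<le> (\<integral>z. (s * f z + t * g z)\<^sup>2 \<partial>M)" by simp
    also have "(\<lambda>z. (s * f z + t * g z)\<^sup>2) = (\<lambda>z. s\<^sup>2 * (f z)\<^sup>2 + (2 * s * t) * (f z * g z) + t\<^sup>2 * (g z)\<^sup>2)"
      by (simp add: fun_eq_iff power2_eq_square algebra_simps)
    also have "(\<integral>z. s\<^sup>2 * (f z)\<^sup>2 + (2 * s * t) * (f z * g z) + t\<^sup>2 * (g z)\<^sup>2 \<partial>M) = s\<^sup>2 * a + (2 * s * t) * b + t\<^sup>2 * c"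
      using f g fg by (simp add: a_def b_def c_def)
    finally show ?thesis by (simp add: algebra_simps)
  qed
  have ac: "a \<ge> 0" "c \<ge> 0" by (auto simp: a_def c_def)
  show ?thesis
  proof (cases "a = 0")
    case True
    have "b = 0"
    proof (rule ccontr)
      assume "b \<noteq> 0"
      \<comment> \<open>With \<open>a = 0\<close> the form is affine in \<open>s\<close>; this
        witness gives it the value \<open>- (c + 1) + c\<close>, that is -1.\<close>
      then show False using quad[of "- (c + 1) / (2 * b)" 1] True by simp
    qed
    then show ?thesis using True by (simp add: a_def b_def c_def)
  next
    case False
    then have "a > 0" using ac by simp
    \<comment> \<open>At \<open>s = -b\<close>, \<open>t = a\<close> the form factors into
      \<open>a\<close> and \<open>a * c - b\<^sup>2\<close>.\<close>
    have "0 \<le> a * (a * c - b\<^sup>2)" using quad[of "-b" a] by (simp add: power2_eq_square algebra_simps)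
    then have "b\<^sup>2 \<le> a * c" using \<open>a > 0\<close> by (simp add: zero_le_mult_iff)
    then show ?thesis by (simp add: a_def b_def c_def)
  qed
qed

definition A2_norm :: "complex ^ 'n \<Rightarrow> real \<Rightarrow> (complex ^ 'n \<Rightarrow> complex) \<Rightarrow> real" where
  "A2_norm \<omega> R f = sqrt (Re (A2_inner \<omega> R f f))"

lemma A2_inner_cnj: "cnj (A2_inner \<omega> R f g) = A2_inner \<omega> R g f"
proof -
  have "cnj (LINT z:ball \<omega> R|lborel. f z * cnj (g z)) = (LINT z:ball \<omega> R|lborel. g z * cnj (f z))"
    unfolding set_lebesgue_integral_def
    using Bochner_Integration.integral_cnj[of lborel "\<lambda>z. indicator (ball \<omega> R) z *\<^sub>R (f z * cnj (g z))"]
    by (simp add: mult.commute)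
  then show ?thesis by (simp add: A2_inner_def)
qed

lemma A2s_inner_cnj: "cnj (A2s_inner \<omega> R f g) = A2s_inner \<omega> R g f"
  by (simp add: A2s_inner_def A2_inner_cnj)

lemma prod_inner_cnj: "cnj (prod_inner \<omega> R p q) = prod_inner \<omega> R q p"
  by (simp add: prod_inner_def A2s_inner_cnj cnj_vec_inner)

context bergman_ball
begin

definition \<kappa> :: real where "\<kappa> = (fact CARD('n) / pi ^ CARD('n)) / R ^ (2 * CARD('n))"

lemma \<kappa>_pos: "\<kappa> > 0" using R by (simp add: \<kappa>_def)

lemma A2_inner_eq: "f \<in> A2 \<omega> R \<Longrightarrow> A2_inner \<omega> R f g = complex_of_real \<kappa> * (\<integral>z. f z * cnj (g z) \<partial>lborel)"
  unfolding \<kappa>_def by (rule A2_inner_alt)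

lemma A2_norm_sq: 
  assumes "f \<in> A2 \<omega> R" 
  shows "(A2_norm \<omega> R f)\<^sup>2 = \<kappa> * (\<integral>z. (cmod (f z))\<^sup>2 \<partial>lborel)" "A2_inner \<omega> R f f = of_real ((A2_norm \<omega> R f)\<^sup>2)" "A2_norm \<omega> R f \<ge> 0"
proof -
  have "A2_inner \<omega> R f f = complex_of_real (\<kappa> * (\<integral>z. (cmod (f z))\<^sup>2 \<partial>lborel))"
    unfolding A2_inner_eq[OF assms] complex_norm_square[symmetric] by (simp flip: of_real_power)
  moreover have "\<kappa> * (\<integral>z. (cmod (f z))\<^sup>2 \<partial>lborel) \<ge> 0" using \<kappa>_pos by simp
  ultimately show "(A2_norm \<omega> R f)\<^sup>2 = \<kappa> * (\<integral>z. (cmod (f z))\<^sup>2 \<partial>lborel)" "A2_inner \<omega> R f f = of_real ((A2_norm \<omega> R f)\<^sup>2)" "A2_norm \<omega> R f \<ge> 0"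
    by (simp_all add: A2_norm_def)
qed

lemma A2_Cauchy_Schwarz:
  assumes f: "f \<in> A2 \<omega> R" and g: "g \<in> A2 \<omega> R"
  shows "cmod (A2_inner \<omega> R f g) \<le> A2_norm \<omega> R f * A2_norm \<omega> R g"
proof -
  have int: "integrable lborel (\<lambda>z. cmod (f z) * cmod (g z))"
    using integrable_norm[OF A2_mult_cnj_integrable[OF f g]] by (simp add: norm_mult)
  have "cmod (A2_inner \<omega> R f g) = \<kappa> * cmod (\<integral>z. f z * cnj (g z) \<partial>lborel)"
    using \<kappa>_pos by (simp add: A2_inner_eq[OF f] norm_mult)
  also have "\<dots> \<le> \<kappa> * (\<integral>z. cmod (f z) * cmod (g z) \<partial>lborel)"
    using integral_norm_bound[of lborel "\<lambda>z. f z * cnj (g z)"] \<kappa>_pos by (simp add: norm_mult)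
  finally have 1: "cmod (A2_inner \<omega> R f g) \<le> \<kappa> * (\<integral>z. cmod (f z) * cmod (g z) \<partial>lborel)" .
  have "(cmod (A2_inner \<omega> R f g))\<^sup>2 \<le> (\<kappa> * (\<integral>z. cmod (f z) * cmod (g z) \<partial>lborel))\<^sup>2"
    by (rule power_mono[OF 1]) simp
  also have "\<dots> \<le> \<kappa>\<^sup>2 * ((\<integral>z. (cmod (f z))\<^sup>2 \<partial>lborel) * (\<integral>z. (cmod (g z))\<^sup>2 \<partial>lborel))"
    unfolding power_mult_distrib
    by (intro mult_left_mono integral_Cauchy_Schwarz A2_integrable_square f g int) simp
  also have "\<dots> = (A2_norm \<omega> R f * A2_norm \<omega> R g)\<^sup>2"
    unfolding power_mult_distrib A2_norm_sq(1)[OF f] A2_norm_sq(1)[OF g] by (simp add: power2_eq_square)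
  finally show ?thesis by (rule power2_le_imp_le) (simp add: A2_norm_sq f g)
qed

lemma A2_bounded:
  assumes g: "analytic_fun_on g (ball \<omega> R)" and B: "\<And>z. z \<in> ball \<omega> R \<Longrightarrow> cmod (g z) \<le> B"
  shows "(\<lambda>z. if z \<in> ball \<omega> R then g z else 0) \<in> A2 \<omega> R"
  unfolding A2_def
proof (intro CollectI conjI allI impI)
  show "analytic_fun_on (\<lambda>z. if z \<in> ball \<omega> R then g z else 0) (ball \<omega> R)"
    by (rule analytic_fun_on_cong[OF g]) auto
  have eq: "indicator (ball \<omega> R) z *\<^sub>R (cmod (if z \<in> ball \<omega> R then g z else 0))\<^sup>2 = (cmod (indicator (ball \<omega> R) z *\<^sub>R g z))\<^sup>2" for z
    by (simp add: indicator_def)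
  show "set_integrable lborel (ball \<omega> R) (\<lambda>z. (cmod (if z \<in> ball \<omega> R then g z else 0))\<^sup>2)"
    unfolding set_integrable_def eq
  proof (rule Bochner_Integration.integrable_bound)
    show "integrable lborel (\<lambda>z. B\<^sup>2 * indicator (ball \<omega> R) z)"
      using emeasure_lborel_ball_finite[of \<omega> R] by (intro integrable_mult_right) (simp add: integrable_indicator_iff)
    have [measurable]: "(\<lambda>z. indicator (ball \<omega> R) z *\<^sub>R g z) \<in> borel_measurable borel"
      by (rule borel_measurable_continuous_on_indicator) (simp_all add: analytic_fun_on_imp_continuous_on g)
    show "(\<lambda>z. (cmod (indicator (ball \<omega> R) z *\<^sub>R g z))\<^sup>2) \<in> borel_measurable lborel" by measurable
    show "AE z in lborel. norm ((cmod (indicator (ball \<omega> R) z *\<^sub>R g z))\<^sup>2) \<le> norm (B\<^sup>2 * indicator (ball \<omega> R) z)"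
      by (intro AE_I2) (auto simp: indicator_def B power_mono)
  qed
qed auto

lemma A2_add_scaled:
  assumes f: "f \<in> A2 \<omega> R" and g: "g \<in> A2 \<omega> R"
  shows "(\<lambda>z. a * f z + b * g z) \<in> A2 \<omega> R"
  unfolding A2_def
proof (intro CollectI conjI allI impI)
  show "analytic_fun_on (\<lambda>z. a * f z + b * g z) (ball \<omega> R)"
    by (intro analytic_fun_on_add analytic_fun_on_mult analytic_fun_on_const A2D f g)
  show "a * f z + b * g z = 0" if "z \<notin> ball \<omega> R" for z using A2D(3)[OF f that] A2D(3)[OF g that] by simp
  show "set_integrable lborel (ball \<omega> R) (\<lambda>z. (cmod (a * f z + b * g z))\<^sup>2)"
    unfolding set_integrable_def
  proof (rule integrable_mult_indicator)
    show "integrable lborel (\<lambda>z. (cmod (a * f z + b * g z))\<^sup>2)"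
    proof (rule Bochner_Integration.integrable_bound)
      show "integrable lborel (\<lambda>z. 2 * (cmod a)\<^sup>2 * (cmod (f z))\<^sup>2 + 2 * (cmod b)\<^sup>2 * (cmod (g z))\<^sup>2)"
        by (intro Bochner_Integration.integrable_add integrable_mult_right A2_integrable_square f g)
      have [measurable]: "f \<in> borel_measurable borel" "g \<in> borel_measurable borel" using A2_measurable f g by auto
      show "(\<lambda>z. (cmod (a * f z + b * g z))\<^sup>2) \<in> borel_measurable lborel" by measurable
      show "AE z in lborel. norm ((cmod (a * f z + b * g z))\<^sup>2) \<le> norm (2 * (cmod a)\<^sup>2 * (cmod (f z))\<^sup>2 + 2 * (cmod b)\<^sup>2 * (cmod (g z))\<^sup>2)"
      proof (rule AE_I2)
        fix z
        have "(cmod (a * f z + b * g z))\<^sup>2 \<le> (cmod (a * f z) + cmod (b * g z))\<^sup>2"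
          by (intro power_mono norm_triangle_ineq) simp
        also have "\<dots> \<le> 2 * (cmod (a * f z))\<^sup>2 + 2 * (cmod (b * g z))\<^sup>2"
          using zero_le_power2[of "cmod (a * f z) - cmod (b * g z)"] by (simp add: power2_eq_square algebra_simps)
        finally show "norm ((cmod (a * f z + b * g z))\<^sup>2) \<le> norm (2 * (cmod a)\<^sup>2 * (cmod (f z))\<^sup>2 + 2 * (cmod b)\<^sup>2 * (cmod (g z))\<^sup>2)"
          by (simp add: norm_mult power_mult_distrib)
      qed
    qed
  qed simp
qed

lemma A2_zero: "(\<lambda>_. 0) \<in> A2 \<omega> R"
  using A2_bounded[OF analytic_fun_on_const[of 0], of 0] by simp

lemma A2_sum:
  assumes "finite I" "\<And>i. i \<in> I \<Longrightarrow> (\<lambda>z. f i z) \<in> A2 \<omega> R"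
  shows "(\<lambda>z. \<Sum>i\<in>I. a i * f i z) \<in> A2 \<omega> R"
  using assms
proof (induction I rule: finite_induct)
  case (insert i I)
  then show ?case using A2_add_scaled[of "f i" "\<lambda>z. \<Sum>i\<in>I. a i * f i z" "a i" 1] by simp
qed (simp add: A2_zero)

lemma A2sD: "f \<in> A2s \<omega> R \<Longrightarrow> (\<lambda>z. f z $ i) \<in> A2 \<omega> R"
  by (simp add: A2s_def)

lemma A2s_vec_inner:
  assumes "f \<in> A2s \<omega> R"
  shows "(\<lambda>z. vec_inner (f z) u) \<in> A2 \<omega> R"
  using A2_sum[of UNIV "\<lambda>i z. f z $ i" "\<lambda>i. cnj (u $ i)"] A2sD[OF assms]
  by (simp add: vec_inner_def mult.commute)

lemma A2s_minus: 
  assumes "f \<in> A2s \<omega> R" "g \<in> A2s \<omega> R"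
  shows "f - g \<in> A2s \<omega> R"
  using A2_add_scaled[OF A2sD[OF assms(1)] A2sD[OF assms(2)], of 1 _ "-1"] by (simp add: A2s_def)

lemma A2s_smult: 
  assumes "e \<in> A2 \<omega> R" 
  shows "(\<lambda>z. e z *s u) \<in> A2s \<omega> R"
proof -
  have "(\<lambda>z. u $ i * e z + 0 * 0) \<in> A2 \<omega> R" for i by (rule A2_add_scaled[OF assms A2_zero])
  then show ?thesis by (simp add: A2s_def mult.commute)
qed

lemma A2s_measurable:
  assumes "f \<in> A2s \<omega> R"
  shows "f \<in> borel_measurable borel"
proof -
  have m: "(\<lambda>z. f z $ i) \<in> borel_measurable borel" for i by (rule A2_measurable[OF A2sD[OF assms]])
  have "(\<lambda>z. f z \<bullet> b) \<in> borel_measurable borel" if b: "b \<in> Basis" for b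
    unfolding inner_vec_def by (intro borel_measurable_sum borel_measurable_inner m borel_measurable_const)
  then show ?thesis by (subst borel_measurable_euclidean_space) blast
qed

lemma norm_vec_sq: "(norm (v :: complex ^ 'm))\<^sup>2 = (\<Sum>i\<in>UNIV. (cmod (v $ i))\<^sup>2)"
  by (simp add: norm_vec_def L2_set_def sum_nonneg)

lemma A2s_integrable_square:
  assumes "f \<in> A2s \<omega> R"
  shows "integrable lborel (\<lambda>z. (norm (f z))\<^sup>2)"
  unfolding norm_vec_sq by (intro Bochner_Integration.integrable_sum A2_integrable_square A2sD assms)

lemma A2s_norm_sq:
  fixes f :: "complex ^ 'n \<Rightarrow> complex ^ 's"
  assumes f: "f \<in> A2s \<omega> R" 
  shows "(A2s_norm \<omega> R f)\<^sup>2 = \<kappa> * (\<integral>z. (norm (f z))\<^sup>2 \<partial>lborel)" 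
    "A2s_inner \<omega> R f f = of_real ((A2s_norm \<omega> R f)\<^sup>2)" "A2s_norm \<omega> R f \<ge> 0"
proof -
  have "A2s_inner \<omega> R f f = of_real (\<Sum>i\<in>UNIV. \<kappa> * (\<integral>z. (cmod (f z $ i))\<^sup>2 \<partial>lborel))"
    by (simp add: A2s_inner_def A2_norm_sq(2)[OF A2sD[OF f]] A2_norm_sq(1)[OF A2sD[OF f]] del: of_real_power)
  also have "(\<Sum>i\<in>UNIV. \<kappa> * (\<integral>z. (cmod (f z $ i))\<^sup>2 \<partial>lborel)) = \<kappa> * (\<integral>z. (norm (f z))\<^sup>2 \<partial>lborel)"
    unfolding norm_vec_sq
    by (subst Bochner_Integration.integral_sum) (simp_all add: A2_integrable_square A2sD f sum_distrib_left)
  finally have eq: "A2s_inner \<omega> R f f = of_real (\<kappa> * (\<integral>z. (norm (f z))\<^sup>2 \<partial>lborel))" .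
  moreover have "\<kappa> * (\<integral>z. (norm (f z))\<^sup>2 \<partial>lborel) \<ge> 0" using \<kappa>_pos by simp
  ultimately show "(A2s_norm \<omega> R f)\<^sup>2 = \<kappa> * (\<integral>z. (norm (f z))\<^sup>2 \<partial>lborel)" 
    "A2s_inner \<omega> R f f = of_real ((A2s_norm \<omega> R f)\<^sup>2)" "A2s_norm \<omega> R f \<ge> 0"
    by (simp_all add: A2s_norm_def)
qed

text \<open>Vector-valued estimates are reduced to scalar ones by pairing with a fixed vector, in
  applications the very vector to be estimated; one factor \<open>norm u\<close> then
  cancels.\<close>

lemma A2_norm_vec_inner_le:
  assumes f: "f \<in> A2s \<omega> R"
  shows "A2_norm \<omega> R (\<lambda>z. vec_inner (f z) u) \<le> A2s_norm \<omega> R f * norm u"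
proof (rule power2_le_imp_le)
  have "(\<integral>z. (cmod (vec_inner (f z) u))\<^sup>2 \<partial>lborel) \<le> (\<integral>z. (norm u)\<^sup>2 * (norm (f z))\<^sup>2 \<partial>lborel)"
  proof (rule integral_mono)
    show "integrable lborel (\<lambda>z. (cmod (vec_inner (f z) u))\<^sup>2)" by (rule A2_integrable_square[OF A2s_vec_inner[OF f]])
    show "integrable lborel (\<lambda>z. (norm u)\<^sup>2 * (norm (f z))\<^sup>2)" by (intro integrable_mult_right A2s_integrable_square f)
    fix z
    have "(cmod (vec_inner (f z) u))\<^sup>2 \<le> (norm (f z) * norm u)\<^sup>2" by (intro power_mono norm_vec_inner_le) simp
    then show "(cmod (vec_inner (f z) u))\<^sup>2 \<le> (norm u)\<^sup>2 * (norm (f z))\<^sup>2" by (simp add: power_mult_distrib mult.commute)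
  qed
  then have "\<kappa> * (\<integral>z. (cmod (vec_inner (f z) u))\<^sup>2 \<partial>lborel) \<le> \<kappa> * ((norm u)\<^sup>2 * (\<integral>z. (norm (f z))\<^sup>2 \<partial>lborel))"
    using \<kappa>_pos by simp
  then show "(A2_norm \<omega> R (\<lambda>z. vec_inner (f z) u))\<^sup>2 \<le> (A2s_norm \<omega> R f * norm u)\<^sup>2"
    unfolding A2_norm_sq(1)[OF A2s_vec_inner[OF f]] power_mult_distrib A2s_norm_sq(1)[OF f] by (simp add: mult_ac)
qed (simp add: A2s_norm_sq f)

text \<open>The functions do not form a normed type, so the triangle inequality is derived from the
  integral Cauchy-Schwarz inequality. It is stated for differences because Newton's iteration
  subtracts.\<close>

lemma A2s_norm_triangle:
  assumes f: "f \<in> A2s \<omega> R" and g: "g \<in> A2s \<omega> R"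
  shows "A2s_norm \<omega> R (f - g) \<le> A2s_norm \<omega> R f + A2s_norm \<omega> R g"
proof (rule power2_le_imp_le)
  have [measurable]: "f \<in> borel_measurable borel" "g \<in> borel_measurable borel" using A2s_measurable f g by auto
  let ?F = "\<integral>z. (norm (f z))\<^sup>2 \<partial>lborel" and ?G = "\<integral>z. (norm (g z))\<^sup>2 \<partial>lborel" and ?H = "\<integral>z. norm (f z) * norm (g z) \<partial>lborel"
  have intF: "integrable lborel (\<lambda>z. (norm (f z))\<^sup>2)" and intG: "integrable lborel (\<lambda>z. (norm (g z))\<^sup>2)"
    using A2s_integrable_square f g by auto
  have int: "integrable lborel (\<lambda>z. norm (f z) * norm (g z))"
  proof (rule Bochner_Integration.integrable_bound)
    show "integrable lborel (\<lambda>z. (norm (f z))\<^sup>2 + (norm (g z))\<^sup>2)"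
      by (intro Bochner_Integration.integrable_add intF intG)
    have "norm (f z) * norm (g z) \<le> (norm (f z))\<^sup>2 + (norm (g z))\<^sup>2" for z
    proof -
      have "2 * (norm (f z) * norm (g z)) \<le> (norm (f z))\<^sup>2 + (norm (g z))\<^sup>2"
        using zero_le_power2[of "norm (f z) - norm (g z)"] by (simp add: power2_diff)
      moreover have "0 \<le> norm (f z) * norm (g z)" by simp
      ultimately show ?thesis by linarith
    qed
    then show "AE z in lborel. norm (norm (f z) * norm (g z)) \<le> norm ((norm (f z))\<^sup>2 + (norm (g z))\<^sup>2)"
      by (intro AE_I2) simp
  qed measurable
  have "(\<integral>z. (norm ((f - g) z))\<^sup>2 \<partial>lborel) \<le> (\<integral>z. (norm (f z))\<^sup>2 + 2 * (norm (f z) * norm (g z)) + (norm (g z))\<^sup>2 \<partial>lborel)"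
  proof (rule integral_mono)
    show "integrable lborel (\<lambda>z. (norm ((f - g) z))\<^sup>2)" by (rule A2s_integrable_square[OF A2s_minus[OF f g]])
    show "integrable lborel (\<lambda>z. (norm (f z))\<^sup>2 + 2 * (norm (f z) * norm (g z)) + (norm (g z))\<^sup>2)"
      by (intro Bochner_Integration.integrable_add integrable_mult_right intF intG int)
    fix z
    have "(norm ((f - g) z))\<^sup>2 \<le> (norm (f z) + norm (g z))\<^sup>2"
      by (intro power_mono) (auto simp: norm_triangle_ineq4)
    then show "(norm ((f - g) z))\<^sup>2 \<le> (norm (f z))\<^sup>2 + 2 * (norm (f z) * norm (g z)) + (norm (g z))\<^sup>2"
      by (simp add: power2_sum)
  qed
  also have "\<dots> = ?F + 2 * ?H + ?G"
    using intF intG int by simp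
  finally have 1: "(\<integral>z. (norm ((f - g) z))\<^sup>2 \<partial>lborel) \<le> ?F + 2 * ?H + ?G" .
  have "(\<kappa> * ?H)\<^sup>2 \<le> \<kappa>\<^sup>2 * (?F * ?G)"
    unfolding power_mult_distrib by (intro mult_left_mono integral_Cauchy_Schwarz intF intG int) simp
  also have "\<dots> = (A2s_norm \<omega> R f * A2s_norm \<omega> R g)\<^sup>2"
    unfolding power_mult_distrib A2s_norm_sq(1)[OF f] A2s_norm_sq(1)[OF g] by (simp add: power2_eq_square)
  finally have 2: "\<kappa> * ?H \<le> A2s_norm \<omega> R f * A2s_norm \<omega> R g"
    by (rule power2_le_imp_le) (simp add: A2s_norm_sq f g)
  have "(A2s_norm \<omega> R (f - g))\<^sup>2 = \<kappa> * (\<integral>z. (norm ((f - g) z))\<^sup>2 \<partial>lborel)" by (rule A2s_norm_sq(1)[OF A2s_minus[OF f g]])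
  also have "\<dots> \<le> \<kappa> * (?F + 2 * ?H + ?G)" using \<kappa>_pos 1 by simp
  also have "\<dots> = (A2s_norm \<omega> R f)\<^sup>2 + 2 * (\<kappa> * ?H) + (A2s_norm \<omega> R g)\<^sup>2"
    by (simp add: A2s_norm_sq f g algebra_simps)
  also have "\<dots> \<le> (A2s_norm \<omega> R f + A2s_norm \<omega> R g)\<^sup>2" using 2 by (simp add: power2_sum)
  finally show "(A2s_norm \<omega> R (f - g))\<^sup>2 \<le> (A2s_norm \<omega> R f + A2s_norm \<omega> R g)\<^sup>2" .
qed (simp add: A2s_norm_sq f g)

lemma prod_inner_self: 
  assumes "fst p \<in> A2s \<omega> R"
  shows "prod_inner \<omega> R p p = of_real ((prod_norm \<omega> R p)\<^sup>2)" "prod_norm \<omega> R p = norm (A2s_norm \<omega> R (fst p), norm (snd p))"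
proof -
  have "prod_inner \<omega> R p p = of_real ((A2s_norm \<omega> R (fst p))\<^sup>2 + (norm (snd p))\<^sup>2)"
    by (simp add: prod_inner_def A2s_norm_sq(2) assms vec_inner_self)
  then show "prod_inner \<omega> R p p = of_real ((prod_norm \<omega> R p)\<^sup>2)" "prod_norm \<omega> R p = norm (A2s_norm \<omega> R (fst p), norm (snd p))"
    by (simp_all add: prod_norm_def norm_Pair)
qed

lemma prod_norm_nonneg: "fst p \<in> A2s \<omega> R \<Longrightarrow> prod_norm \<omega> R p \<ge> 0"
  by (simp add: prod_inner_self)

lemma A2s_norm_le_prod_norm: "fst p \<in> A2s \<omega> R \<Longrightarrow> A2s_norm \<omega> R (fst p) \<le> prod_norm \<omega> R p"
  and norm_snd_le_prod_norm: "fst p \<in> A2s \<omega> R \<Longrightarrow> norm (snd p) \<le> prod_norm \<omega> R p"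
  by (auto simp: prod_inner_self norm_Pair intro!: real_le_rsqrt)

lemma prod_norm_triangle:
  assumes p: "fst p \<in> A2s \<omega> R" and q: "fst q \<in> A2s \<omega> R"
  shows "prod_norm \<omega> R (p - q) \<le> prod_norm \<omega> R p + prod_norm \<omega> R q"
proof -
  have pq: "fst (p - q) \<in> A2s \<omega> R" using A2s_minus p q by simp
  have "prod_norm \<omega> R (p - q) = norm (A2s_norm \<omega> R (fst p - fst q), norm (snd p - snd q))"
    using prod_inner_self(2)[OF pq] by simp
  also have "\<dots> \<le> norm (A2s_norm \<omega> R (fst p) + A2s_norm \<omega> R (fst q), norm (snd p) + norm (snd q))"
    unfolding norm_Pair real_norm_def power2_abs
    by (intro real_sqrt_le_mono add_mono power_mono A2s_norm_triangle p q norm_triangle_ineq4) (auto simp: A2s_norm_sq A2s_minus p q)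
  also have "\<dots> = norm ((A2s_norm \<omega> R (fst p), norm (snd p)) + (A2s_norm \<omega> R (fst q), norm (snd q)))" by simp
  also have "\<dots> \<le> prod_norm \<omega> R p + prod_norm \<omega> R q"
    unfolding prod_inner_self(2)[OF p] prod_inner_self(2)[OF q] by (rule norm_triangle_ineq)
  finally show ?thesis .
qed

lemma A2s_inner_minus_minus: "A2s_inner \<omega> R (f - g) (f - g) = A2s_inner \<omega> R (g - f) (g - f)"
proof -
  have "(f z - g z) $ i * cnj ((f z - g z) $ i) = (g z - f z) $ i * cnj ((g z - f z) $ i)" for z i
    by (metis (no_types, lifting) complex_cnj_minus minus_diff_eq minus_mult_minus vector_uminus_component)
  then show ?thesis by (simp only: A2s_inner_def A2_inner_def fun_diff_def)
qed

lemma A2s_norm_minus_commute: "A2s_norm \<omega> R (f - g) = A2s_norm \<omega> R (g - f)"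
  by (simp only: A2s_norm_def A2s_inner_minus_minus[of f g])

lemma prod_norm_minus_commute: "prod_norm \<omega> R (p - q) = prod_norm \<omega> R (q - p)"
  by (simp add: prod_norm_def prod_inner_def vec_inner_self norm_minus_commute A2s_inner_minus_minus[of "fst p"])

lemma prod_norm_dist_triangle:
  assumes "fst p \<in> A2s \<omega> R" "fst q \<in> A2s \<omega> R" "fst r \<in> A2s \<omega> R"
  shows "prod_norm \<omega> R (p - r) \<le> prod_norm \<omega> R (p - q) + prod_norm \<omega> R (q - r)"
proof -
  have "p - r = (p - q) - (r - q)" by (simp add: prod_eq_iff fun_eq_iff)
  moreover have "prod_norm \<omega> R ((p - q) - (r - q)) \<le> prod_norm \<omega> R (p - q) + prod_norm \<omega> R (r - q)"
    by (rule prod_norm_triangle) (simp_all add: A2s_minus assms)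
  ultimately show ?thesis by (simp only: prod_norm_minus_commute[of r q])
qed

end

subsection \<open>Representing functions of derivatives\<close>

lemma has_field_derivative_Re_of_real:
  assumes "(g has_field_derivative d) (at (of_real t))"
  shows "((\<lambda>t::real. Re (g (of_real t))) has_real_derivative Re d) (at t)"
proof -
  have "((\<lambda>t::real. g (of_real t)) has_derivative (\<lambda>h. d * of_real h)) (at t)"
    using has_derivative_compose[OF bounded_linear_imp_has_derivative[OF bounded_linear_of_real], where g = g and g' = "(*) d" and x = t and s = UNIV]
      assms by (simp add: has_field_derivative_def)
  from bounded_linear.has_derivative[OF bounded_linear_Re this]
  have "((\<lambda>t::real. Re (g (of_real t))) has_derivative (\<lambda>h. Re (d * of_real h))) (at t)" .
  moreover have "(\<lambda>h. Re (d * of_real h)) = (*) (Re d)" by (auto simp: fun_eq_iff)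
  ultimately show ?thesis by (simp add: has_field_derivative_def)
qed

lemma has_field_derivative_divide_linear_power:
  fixes p :: "complex \<Rightarrow> complex"
  assumes p: "(p has_field_derivative p') (at c)" and nz: "A - c * B \<noteq> 0"
  shows "((\<lambda>c. p c / (A - c * B) ^ m) has_field_derivative
     p' / (A - c * B) ^ m + of_nat m * B * p c / (A - c * B) ^ Suc m) (at c)"
proof -
  define Y where "Y = A - c * B"
  have Y: "Y \<noteq> 0" using nz by (simp add: Y_def)
  have "((\<lambda>c. A - c * B) has_field_derivative - B) (at c)"
    by (auto intro!: derivative_eq_intros)
  from DERIV_divide[OF p DERIV_power[OF this, of m]]
  have "((\<lambda>c. p c / (A - c * B) ^ m) has_field_derivative 
     (p' * Y ^ m - p c * (of_nat m * (- B * Y ^ (m - Suc 0)))) / (Y ^ m * Y ^ m)) (at c)"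
    using nz by (simp add: Y_def)
  moreover have "(p' * Y ^ m - p c * (of_nat m * (- B * Y ^ (m - Suc 0)))) / (Y ^ m * Y ^ m) = p' / Y ^ m + of_nat m * B * p c / Y ^ Suc m"
    using Y by (cases m) (simp_all add: field_simps)
  ultimately show ?thesis by (simp only: Y_def)
qed

context bergman_ball
begin

text \<open>Up to a constant factor, \<open>bk (n + 1 + j) j x y\<close> represents the \<open>j\<close>-th derivative at
  \<open>x\<close> in the direction \<open>y\<close>; the parameter \<open>y\<close> is irrelevant for \<open>j = 0\<close>.\<close>

definition bk :: "nat \<Rightarrow> nat \<Rightarrow> complex ^ 'n \<Rightarrow> complex ^ 'n \<Rightarrow> complex ^ 'n \<Rightarrow> complex" where
  "bk m j x y z = (if z \<in> ball \<omega> R then (vec_inner (z - \<omega>) y / of_real (R\<^sup>2)) ^ j / (1 - vec_inner (z - \<omega>) (x - \<omega>) / of_real (R\<^sup>2)) ^ m else 0)"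

lemma bergman_eq_bk: "bergman \<omega> R x = bk (CARD('n) + 1) 0 x y"
  by (simp add: fun_eq_iff bergman_def bk_def)

lemma norm_vec_inner_ball:
  assumes "z \<in> ball \<omega> R"
  shows "cmod (vec_inner (z - \<omega>) y / of_real (R\<^sup>2)) \<le> norm y / R"
proof -
  have "cmod (vec_inner (z - \<omega>) y) \<le> norm (z - \<omega>) * norm y" by (rule norm_vec_inner_le)
  also have "\<dots> \<le> R * norm y" using assms by (intro mult_right_mono) (auto simp: dist_norm norm_minus_commute)
  finally show ?thesis using R by (simp add: norm_divide norm_mult power2_eq_square field_simps)
qed

text \<open>\<open>norm (z - \<omega>)\<close> is at most \<open>R\<close>, so one factor
  \<open>R\<close> cancels in the Cauchy-Schwarz bound. Uniformity in \<open>z\<close> makes kernels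
  with base points in a smaller ball uniformly bounded.\<close>

lemma kernel_denominator:
  assumes "z \<in> ball \<omega> R"
  shows "1 - norm (x - \<omega>) / R \<le> cmod (1 - vec_inner (z - \<omega>) (x - \<omega>) / of_real (R\<^sup>2))"
  using norm_vec_inner_ball[OF assms, of "x - \<omega>"] norm_triangle_ineq2[of 1 "vec_inner (z - \<omega>) (x - \<omega>) / of_real (R\<^sup>2)"]
  by (simp del: of_real_power)

lemma ball_ratio: "x \<in> ball \<omega> R \<longleftrightarrow> norm (x - \<omega>) / R < 1"
  using R by (simp add: dist_norm norm_minus_commute)

lemma bk_bound:
  assumes x: "norm (x - \<omega>) / R \<le> r" "r < 1"
  shows "cmod (bk m j x y z) \<le> (norm y / R) ^ j / (1 - r) ^ m"
proof (cases "z \<in> ball \<omega> R")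
  case True
  define P Q where "P = vec_inner (z - \<omega>) y / of_real (R\<^sup>2)" and "Q = 1 - vec_inner (z - \<omega>) (x - \<omega>) / of_real (R\<^sup>2)"
  have PQ: "cmod P \<le> norm y / R" "1 - r \<le> cmod Q"
    using norm_vec_inner_ball[OF True, of y] kernel_denominator[OF True, of x] x by (simp_all add: P_def Q_def)
  have "bk m j x y z = P ^ j / Q ^ m" using True by (simp add: bk_def P_def Q_def)
  moreover have "cmod (P ^ j / Q ^ m) \<le> (norm y / R) ^ j / (1 - r) ^ m"
    unfolding norm_divide norm_power
    by (rule frac_le) (use PQ x R in \<open>auto intro: power_mono\<close>)
  ultimately show ?thesis by simp
next
  case False
  then show ?thesis using R x by (simp add: bk_def)
qed

lemma bk_in_A2:
  assumes "x \<in> ball \<omega> R"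
  shows "bk m j x y \<in> A2 \<omega> R"
proof -
  define r where "r = norm (x - \<omega>) / R"
  have r: "r < 1" using assms ball_ratio by (simp add: r_def)
  \<comment> \<open>The kernel rewritten with sums, products, powers and \<open>inverse\<close>, so
    that the closure properties of analytic functions apply.\<close>
  define g where "g z = (vec_inner (z - \<omega>) y * (1 / of_real (R\<^sup>2))) ^ j * inverse ((1 + vec_inner (z - \<omega>) (x - \<omega>) * (- 1 / of_real (R\<^sup>2))) ^ m)" for z
  have gb: "g z = bk m j x y z" if "z \<in> ball \<omega> R" for z
    using that by (simp add: g_def bk_def divide_inverse)
  have nz: "1 + vec_inner (z - \<omega>) (x - \<omega>) * (- 1 / of_real (R\<^sup>2)) \<noteq> 0" if "z \<in> ball \<omega> R" for z
    using kernel_denominator[OF that, of x] r by (auto simp: r_def)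
  have an: "analytic_fun_on g (ball \<omega> R)"
    unfolding g_def
    by (intro analytic_fun_on_mult analytic_fun_on_power analytic_fun_on_inverse analytic_fun_on_add analytic_fun_on_const analytic_fun_on_vec_inner)
      (erule power_not_zero[OF nz])
  have "(\<lambda>z. if z \<in> ball \<omega> R then g z else 0) \<in> A2 \<omega> R"
    by (rule A2_bounded[OF an]) (use bk_bound[of x r, OF _ r] gb in \<open>force simp: r_def\<close>)
  moreover have "(\<lambda>z. if z \<in> ball \<omega> R then g z else 0) = bk m j x y"
    using gb by (auto simp: fun_eq_iff bk_def)
  ultimately show ?thesis by simp
qed

lemma line_in_ball_open: "open {c. x + c *s y \<in> ball \<omega> R}"
proof -
  have "open ((\<lambda>c. x + c *s y) -` ball \<omega> R)"
    by (intro open_vimage continuous_intros) simp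
  then show ?thesis by (simp add: vimage_def)
qed

text \<open>Differentiation under the integral. The kernel enters conjugated, so it is holomorphic
  in the base point, and each derivative raises \<open>m\<close> and \<open>j\<close> by one with
  factor \<open>m\<close>. The mean value inequality bounds the difference quotients uniformly in
  \<open>z\<close>, and \<open>f\<close> is integrable.\<close>

lemma A2_inner_bk_has_derivative:
  assumes f: "f \<in> A2 \<omega> R" and x: "x + c *s y \<in> ball \<omega> R"
  shows "((\<lambda>c. A2_inner \<omega> R f (bk m j (x + c *s y) y)) has_field_derivative
     of_nat m * A2_inner \<omega> R f (bk (Suc m) (Suc j) (x + c *s y) y)) (at c)"
proof -
  define r0 where "r0 = norm (x + c *s y - \<omega>) / R"
  have r0: "r0 < 1" using x ball_ratio by (simp add: r0_def)
  define r where "r = (r0 + 1) / 2"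
  have r: "r0 < r" "r < 1" using r0 by (auto simp: r_def)
  \<comment> \<open>Parameters in the disc of this radius move the base point by at most
    \<open>(r - r0) * R\<close>, which keeps its relative distance from the centre at most
    \<open>r < 1\<close>.\<close>
  define \<epsilon> where "\<epsilon> = (r - r0) * R / (norm y + 1)"
  have \<epsilon>: "\<epsilon> > 0" using r R by (simp add: \<epsilon>_def add_nonneg_pos)
  have near: "norm (x + d *s y - \<omega>) / R \<le> r" if "d \<in> cball c \<epsilon>" for d
  proof -
    have "x + d *s y - \<omega> = (x + c *s y - \<omega>) + (d - c) *s y" by (simp add: vec_eq_iff algebra_simps)
    then have "norm (x + d *s y - \<omega>) \<le> norm (x + c *s y - \<omega>) + cmod (d - c) * norm y"
      by (metis norm_triangle_ineq norm_smult_vec)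
    also have "cmod (d - c) * norm y \<le> \<epsilon> * (norm y + 1)"
      using that \<epsilon> by (intro mult_mono) (auto simp: dist_norm norm_minus_commute)
    also have "\<dots> = (r - r0) * R" by (simp add: \<epsilon>_def add_nonneg_pos less_imp_neq[symmetric])
    finally show ?thesis using R by (simp add: r0_def field_simps)
  qed
  define B where "B = real m * ((norm y / R) ^ Suc j / (1 - r) ^ Suc m)"
  define q where "q z d = cnj (bk m j (x + d *s y) y z)" for z d
  define q' where "q' z d = of_nat m * cnj (bk (Suc m) (Suc j) (x + d *s y) y z)" for z d
  have q'_bound: "cmod (q' z d) \<le> B" if "d \<in> cball c \<epsilon>" for z d
    unfolding q'_def B_def norm_mult norm_of_nat complex_mod_cnj
    by (intro mult_left_mono bk_bound[OF near[OF that] r(2)]) simp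
  have q_deriv: "(q z has_field_derivative q' z d) (at d)" if d: "d \<in> cball c \<epsilon>" for z d
  proof (cases "z \<in> ball \<omega> R")
    case True
    define u where "u = vec_inner (x - \<omega>) (z - \<omega>) / of_real (R\<^sup>2)"
    define v where "v = vec_inner y (z - \<omega>) / of_real (R\<^sup>2)"
    have den: "cnj (1 - vec_inner (z - \<omega>) (x + d *s y - \<omega>) / of_real (R\<^sup>2)) = 1 - u - d * v" for d
    proof -
      have e: "x + d *s y - \<omega> = (x - \<omega>) + d *s y" by simp
      show ?thesis unfolding e
        by (simp add: u_def v_def vec_inner_add_right vec_inner_smult_right cnj_vec_inner add_divide_distrib)
    qed
    have vj: "cnj (vec_inner (z - \<omega>) y / of_real (R\<^sup>2)) = v" by (simp add: v_def cnj_vec_inner)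
    have gen: "cnj (P ^ j' / Q ^ m') = cnj P ^ j' / cnj Q ^ m'" for P Q and j' m' :: nat by simp
    have qe: "cnj (bk m' j' (x + d *s y) y z) = v ^ j' / (1 - u - d * v) ^ m'" for d m' j'
      unfolding bk_def if_P[OF True] gen den vj ..
    have "cmod (1 - vec_inner (z - \<omega>) (x + d *s y - \<omega>) / of_real (R\<^sup>2)) > 0"
      using kernel_denominator[OF True, of "x + d *s y"] near[OF d] r by linarith
    then have nz: "1 - u - d * v \<noteq> 0" unfolding den[symmetric] complex_cnj_zero_iff by (metis norm_zero less_irrefl)
    have "((\<lambda>d. v ^ j / (1 - u - d * v) ^ m) has_field_derivative of_nat m * (v ^ Suc j / (1 - u - d * v) ^ Suc m)) (at d)"
      using has_field_derivative_divide_linear_power[OF DERIV_const[of "v ^ j"] nz, of m] by (simp add: mult_ac)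
    then show ?thesis unfolding q_def[abs_def] q'_def qe .
  next
    case False
    then show ?thesis by (simp add: q_def[abs_def] q'_def bk_def)
  qed
  have q_diff: "cmod ((q z (c + h) - q z c) / h) \<le> B" if h: "h \<noteq> 0" "cmod h < \<epsilon>" for z h
  proof -
    have "cmod (q z (c + h) - q z c) \<le> B * cmod (c + h - c)"
    proof (rule field_differentiable_bound)
      show "convex (cball c \<epsilon>)" by (rule convex_cball)
      show "(q z has_field_derivative q' z d) (at d within cball c \<epsilon>)" if "d \<in> cball c \<epsilon>" for d
        using q_deriv[OF that] by (rule has_field_derivative_at_within)
    qed (use q'_bound h \<epsilon> in \<open>auto simp: dist_norm\<close>)
    then show ?thesis using h by (simp add: norm_divide field_simps)
  qed
  have f_meas [measurable]: "f \<in> borel_measurable borel" by (rule A2_measurable[OF f])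
  have near_ball: "x + d *s y \<in> ball \<omega> R" if "d \<in> cball c \<epsilon>" for d
    using near[OF that] r unfolding ball_ratio by linarith
  have q_meas [measurable]: "(\<lambda>z. q z d) \<in> borel_measurable borel" if "d \<in> cball c \<epsilon>" for d
    unfolding q_def using A2_measurable[OF bk_in_A2[OF near_ball[OF that]], of m j y] by measurable
  have q'_meas [measurable]: "(\<lambda>z. q' z c) \<in> borel_measurable borel"
    unfolding q'_def using A2_measurable[OF bk_in_A2[OF x], of "Suc m" "Suc j" y] by measurable
  define F where "F d = (\<integral>z. f z * q z d \<partial>lborel)" for d
  have int_q: "integrable lborel (\<lambda>z. f z * q z d)" if "d \<in> cball c \<epsilon>" for d
    unfolding q_def by (rule A2_mult_cnj_integrable[OF f bk_in_A2[OF near_ball[OF that]]])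
  have "(F has_field_derivative (\<integral>z. f z * q' z c \<partial>lborel)) (at c)"
    unfolding DERIV_def tendsto_at_iff_sequentially comp_def
  proof (intro allI impI)
    fix X :: "nat \<Rightarrow> complex" assume X: "\<forall>i. X i \<in> UNIV - {0}" "X \<longlonglongrightarrow> 0"
    have "\<forall>\<^sub>F i in sequentially. cmod (X i) < \<epsilon>" 
      using tendstoD[OF X(2) \<epsilon>] by (simp add: dist_norm)
    \<comment> \<open>The difference quotients are bounded only for increments below
      \<open>\<epsilon>\<close>, so an initial part of the sequence is dropped.\<close>
    then obtain K where "\<forall>i\<ge>K. cmod (X i) < \<epsilon>" by (auto simp: eventually_sequentially)
    then have K: "cmod (X (i + K)) < \<epsilon>" for i by simp
    have XK: "c + X (i + K) \<in> cball c \<epsilon>" for i using K[of i] by (simp add: dist_norm)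
    have cK: "c \<in> cball c \<epsilon>" using \<epsilon> by simp
    have "(\<lambda>i. \<integral>z. f z * ((q z (c + X (i + K)) - q z c) / X (i + K)) \<partial>lborel) \<longlonglongrightarrow> (\<integral>z. f z * q' z c \<partial>lborel)"
    proof (rule integral_dominated_convergence)
      show "integrable lborel (\<lambda>z. B * cmod (f z))"
        using A2_integrable[OF f] by (intro integrable_mult_right integrable_norm)
      note [measurable] = q_meas[OF XK] q_meas[OF cK]
      show "(\<lambda>z. f z * ((q z (c + X (i + K)) - q z c) / X (i + K))) \<in> borel_measurable lborel" for i by measurable
      show "(\<lambda>z. f z * q' z c) \<in> borel_measurable lborel" by measurable
      show "AE z in lborel. (\<lambda>i. f z * ((q z (c + X (i + K)) - q z c) / X (i + K))) \<longlonglongrightarrow> f z * q' z c"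
      proof (intro AE_I2 tendsto_mult tendsto_const)
        fix z
        have "((\<lambda>h. (q z (c + h) - q z c) / h) \<longlongrightarrow> q' z c) (at 0)" using q_deriv[OF cK] by (simp add: DERIV_def)
        then have "(\<lambda>i. (q z (c + X i) - q z c) / X i) \<longlonglongrightarrow> q' z c"
          using X unfolding tendsto_at_iff_sequentially comp_def by blast
        then show "(\<lambda>i. (q z (c + X (i + K)) - q z c) / X (i + K)) \<longlonglongrightarrow> q' z c"
          by (rule LIMSEQ_ignore_initial_segment)
      qed
      show "AE z in lborel. norm (f z * ((q z (c + X (i + K)) - q z c) / X (i + K))) \<le> B * cmod (f z)" for i
      proof (rule AE_I2)
        fix z
        have "cmod ((q z (c + X (i + K)) - q z c) / X (i + K)) \<le> B" by (rule q_diff) (use X(1) K in auto)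
        then show "norm (f z * ((q z (c + X (i + K)) - q z c) / X (i + K))) \<le> B * cmod (f z)"
          unfolding norm_mult mult.commute[of "cmod (f z)"] by (rule mult_right_mono) simp
      qed
    qed
    also have eqF: "(\<lambda>i. \<integral>z. f z * ((q z (c + X (i + K)) - q z c) / X (i + K)) \<partial>lborel) = (\<lambda>i. (F (c + X (i + K)) - F c) / X (i + K))"
    proof
      fix i
      have "(\<integral>z. f z * ((q z (c + X (i + K)) - q z c) / X (i + K)) \<partial>lborel) = (\<integral>z. (f z * q z (c + X (i + K)) - f z * q z c) / X (i + K) \<partial>lborel)"
        by (simp add: right_diff_distrib)
      also have "\<dots> = (F (c + X (i + K)) - F c) / X (i + K)"
        using int_q[OF XK[of i]] int_q[OF cK] by (simp add: F_def)
      finally show "(\<integral>z. f z * ((q z (c + X (i + K)) - q z c) / X (i + K)) \<partial>lborel) = (F (c + X (i + K)) - F c) / X (i + K)" .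
    qed
    finally show "(\<lambda>i. (F (c + X i) - F c) / X i) \<longlonglongrightarrow> (\<integral>z. f z * q' z c \<partial>lborel)"
      by (rule LIMSEQ_offset)
  qed
  then have "((\<lambda>d. of_real \<kappa> * F d) has_field_derivative of_real \<kappa> * (\<integral>z. f z * q' z c \<partial>lborel)) (at c)"
    by (rule DERIV_cmult)
  moreover have "(\<integral>z. f z * q' z c \<partial>lborel) = of_nat m * (\<integral>z. f z * cnj (bk (Suc m) (Suc j) (x + c *s y) y z) \<partial>lborel)"
    unfolding q'_def by (simp add: mult.left_commute)
  ultimately show ?thesis
    unfolding F_def q_def A2_inner_eq[OF f] by (simp add: mult.left_commute)
qed

lemma A2_line_derivative1:
  assumes f: "f \<in> A2 \<omega> R" and x: "x + c *s y \<in> ball \<omega> R"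
  shows "((\<lambda>c. f (x + c *s y)) has_field_derivative of_nat (CARD('n) + 1) * A2_inner \<omega> R f (bk (CARD('n) + 2) 1 (x + c *s y) y)) (at c)"
proof (rule has_field_derivative_transform_within_open[OF _ line_in_ball_open[of x y]])
  show "((\<lambda>c. A2_inner \<omega> R f (bk (CARD('n) + 1) 0 (x + c *s y) y)) has_field_derivative of_nat (CARD('n) + 1) * A2_inner \<omega> R f (bk (CARD('n) + 2) 1 (x + c *s y) y)) (at c)"
    using A2_inner_bk_has_derivative[OF f x, of "CARD('n) + 1" 0] by simp
  show "A2_inner \<omega> R f (bk (CARD('n) + 1) 0 (x + c *s y) y) = f (x + c *s y)" if "c \<in> {c. x + c *s y \<in> ball \<omega> R}" for c
    using A2_reproducing[OF f, of "x + c *s y"] that by (simp add: bergman_eq_bk[of _ y])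
qed (use x in simp)

lemma A2_line_derivative2:
  assumes f: "f \<in> A2 \<omega> R" and x: "x + c *s y \<in> ball \<omega> R"
  shows "((\<lambda>c. of_nat (CARD('n) + 1) * A2_inner \<omega> R f (bk (CARD('n) + 2) 1 (x + c *s y) y)) has_field_derivative 
    of_nat (CARD('n) + 1) * (of_nat (CARD('n) + 2) * A2_inner \<omega> R f (bk (CARD('n) + 3) 2 (x + c *s y) y))) (at c)"
proof -
  have e: "Suc (CARD('n) + 2) = CARD('n) + 3" "Suc 1 = 2" by auto
  show ?thesis by (rule DERIV_cmult[OF A2_inner_bk_has_derivative[OF f x, of "CARD('n) + 2" 1, unfolded e]])
qed

text \<open>The norm of a representing function is the value of the functional at this function.\<close>

lemma A2_norm_bergman:
  assumes x: "x \<in> ball \<omega> R"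
  shows "(A2_norm \<omega> R (bergman \<omega> R x))\<^sup>2 = 1 / (1 - (norm (x - \<omega>) / R)\<^sup>2) ^ (CARD('n) + 1)"
proof -
  have "of_real ((A2_norm \<omega> R (bergman \<omega> R x))\<^sup>2) = bergman \<omega> R x x"
    using A2_norm_sq(2)[OF bk_in_A2[OF x]] A2_reproducing[OF bk_in_A2[OF x] x] unfolding bergman_eq_bk[of _ 0] by metis
  also have "\<dots> = of_real (1 / (1 - (norm (x - \<omega>) / R)\<^sup>2) ^ (CARD('n) + 1))"
    using x by (simp add: bergman_def vec_inner_self power_divide)
  finally show ?thesis unfolding of_real_eq_iff .
qed

text \<open>On its own line a representing function is a quotient of powers of two affine functions
  of \<open>c\<close>, which can be differentiated by hand.\<close>

lemma bk_on_line:
  assumes "x + c *s y \<in> ball \<omega> R"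
  defines "b \<equiv> vec_inner (x - \<omega>) y / of_real (R\<^sup>2)"
  shows "bk m j x y (x + c *s y) = (b + c * of_real ((norm y / R)\<^sup>2)) ^ j / (of_real (1 - (norm (x - \<omega>) / R)\<^sup>2) - c * cnj b) ^ m"
proof -
  have e: "x + c *s y - \<omega> = (x - \<omega>) + c *s y" by simp
  show ?thesis using assms(1)
    unfolding bk_def e
    by (simp add: vec_inner_add_left vec_inner_smult_left vec_inner_self add_divide_distrib power_divide cnj_vec_inner b_def diff_diff_eq)
qed

lemma cmod_vec_inner_div_sq_le:
  "(cmod (vec_inner (x - \<omega>) y / of_real (R\<^sup>2)))\<^sup>2 \<le> (norm (x - \<omega>) / R)\<^sup>2 * (norm y / R)\<^sup>2"
proof -
  have "(cmod (vec_inner (x - \<omega>) y))\<^sup>2 \<le> (norm (x - \<omega>) * norm y)\<^sup>2"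
    by (intro power_mono norm_vec_inner_le) simp
  then show ?thesis using R by (simp add: norm_divide norm_power power_divide power_mult_distrib field_simps)
qed

text \<open>The derivative of the representing function along its own line is computed twice:
  through the inner product with itself, and from the explicit formula. Equating both gives its norm
  exactly; Cauchy-Schwarz for \<open>b\<close> then removes the dependence on the direction of
  \<open>y\<close>.\<close>

lemma bk1_norm_bound:
  assumes x: "x \<in> ball \<omega> R"
  defines "a \<equiv> 1 - (norm (x - \<omega>) / R)\<^sup>2" and "n \<equiv> real CARD('n)"
  shows "((n + 1) * A2_norm \<omega> R (bk (CARD('n) + 2) 1 x y))\<^sup>2 \<le> (n + 1) * (n + 2) * (norm y / R)\<^sup>2 / a ^ (CARD('n) + 3)"
proof -
  let ?n = "CARD('n)"
  define b where "b = vec_inner (x - \<omega>) y / of_real (R\<^sup>2)"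
  define \<beta> where "\<beta> = (norm y / R)\<^sup>2"
  have x0: "x + 0 *s y \<in> ball \<omega> R" using x by simp
  have "0 \<le> norm (x - \<omega>) / R" "norm (x - \<omega>) / R < 1" using x R unfolding ball_ratio by auto
  then have a: "a > 0" "a \<le> 1" unfolding a_def by (simp_all add: power_less_one_iff abs_square_less_1)
  let ?E = "bk (?n + 2) 1 x y"
  have D1: "((\<lambda>c. ?E (x + c *s y)) has_field_derivative of_nat (?n + 1) * A2_inner \<omega> R ?E ?E) (at 0)"
    using A2_line_derivative1[OF bk_in_A2[OF x] x0, of "?n + 2" 1 y] by simp
  have D2: "((\<lambda>c. ?E (x + c *s y)) has_field_derivative of_real \<beta> / of_real a ^ (?n + 2) + of_nat (?n + 2) * (b * cnj b) / of_real a ^ (?n + 3)) (at 0)"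
  proof (rule has_field_derivative_transform_within_open[OF _ line_in_ball_open[of x y]])
    show "((\<lambda>c. (b + c * of_real \<beta>) ^ 1 / (of_real a - c * cnj b) ^ (?n + 2)) has_field_derivative 
       of_real \<beta> / of_real a ^ (?n + 2) + of_nat (?n + 2) * (b * cnj b) / of_real a ^ (?n + 3)) (at 0)"
    proof -
      have p: "((\<lambda>c. (b + c * of_real \<beta>) ^ 1) has_field_derivative of_real \<beta>) (at 0)"
        by (auto intro!: derivative_eq_intros)
      have nz: "complex_of_real a - 0 * cnj b \<noteq> 0" using a by simp
      have e: "Suc (?n + 2) = ?n + 3" by simp
      show ?thesis using has_field_derivative_divide_linear_power[OF p nz, of "?n + 2", unfolded e] by (simp only: mult_zero_left add_0_right diff_zero power_one_right mult_ac)
    qed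
    show "(b + c * of_real \<beta>) ^ 1 / (of_real a - c * cnj b) ^ (?n + 2) = ?E (x + c *s y)" if "c \<in> {c. x + c *s y \<in> ball \<omega> R}" for c
      using bk_on_line[of x c y "?n + 2" 1] that by (simp add: a_def b_def \<beta>_def)
  qed (use x in simp)
  have "of_nat (?n + 1) * A2_inner \<omega> R ?E ?E = of_real \<beta> / of_real a ^ (?n + 2) + of_nat (?n + 2) * (b * cnj b) / of_real a ^ (?n + 3)"
    by (rule DERIV_unique[OF D1 D2])
  also have "b * cnj b = of_real ((cmod b)\<^sup>2)" by (rule complex_norm_square[symmetric])
  finally have "complex_of_real ((n + 1) * (A2_norm \<omega> R ?E)\<^sup>2) = of_real (\<beta> / a ^ (?n + 2) + (n + 2) * (cmod b)\<^sup>2 / a ^ (?n + 3))"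
    unfolding A2_norm_sq(2)[OF bk_in_A2[OF x]] by (simp add: n_def mult_ac add.commute[of 1] add.commute[of 2])
  then have eq: "(n + 1) * (A2_norm \<omega> R ?E)\<^sup>2 = \<beta> / a ^ (?n + 2) + (n + 2) * (cmod b)\<^sup>2 / a ^ (?n + 3)"
    unfolding of_real_eq_iff .
  also have "\<dots> \<le> \<beta> / a ^ (?n + 2) + (n + 2) * ((1 - a) * \<beta>) / a ^ (?n + 3)"
    using cmod_vec_inner_div_sq_le[of x y] a by (intro add_left_mono divide_right_mono mult_left_mono) (auto simp: b_def a_def \<beta>_def n_def)
  also have "\<dots> = \<beta> * (a + (n + 2) * (1 - a)) / a ^ (?n + 3)"
    using a by (simp add: field_simps power_add power2_eq_square power3_eq_cube)
  \<comment> \<open>The bracket is affine and decreasing in \<open>a\<close>, so its value at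
    \<open>a = 0\<close> bounds it.\<close>
  also have "\<dots> \<le> \<beta> * (n + 2) / a ^ (?n + 3)"
  proof (intro divide_right_mono mult_left_mono)
    have "a + (n + 2) * (1 - a) = (n + 2) - (n + 1) * a" by (simp add: algebra_simps)
    then show "a + (n + 2) * (1 - a) \<le> n + 2" using a by (simp add: n_def)
  qed (use a in \<open>auto simp: \<beta>_def\<close>)
  finally have "(n + 1) * ((n + 1) * (A2_norm \<omega> R ?E)\<^sup>2) \<le> (n + 1) * (\<beta> * (n + 2) / a ^ (?n + 3))"
    by (rule mult_left_mono) (simp add: n_def)
  then show ?thesis by (simp add: power2_eq_square \<beta>_def mult_ac)
qed

text \<open>The same double computation for the second derivative. The first derivative must now be
  known on a neighbourhood of 0, not only at 0, before it can be differentiated again.\<close>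

lemma bk2_norm_bound:
  assumes x: "x \<in> ball \<omega> R"
  defines "a \<equiv> 1 - (norm (x - \<omega>) / R)\<^sup>2" and "n \<equiv> real CARD('n)"
  shows "((n + 1) * (n + 2) * A2_norm \<omega> R (bk (CARD('n) + 3) 2 x y))\<^sup>2 
    \<le> (n + 1) * (n + 2) * (n + 3) * (n + 4) * (norm y / R) ^ 4 / a ^ (CARD('n) + 5)"
proof -
  let ?n = "CARD('n)"
  define b where "b = vec_inner (x - \<omega>) y / of_real (R\<^sup>2)"
  define \<beta> where "\<beta> = (norm y / R)\<^sup>2"
  define A B where "A = complex_of_real a" and "B = complex_of_real \<beta>"
  have x0: "x + 0 *s y \<in> ball \<omega> R" using x by simp
  have "0 \<le> norm (x - \<omega>) / R" "norm (x - \<omega>) / R < 1" using x R unfolding ball_ratio by auto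
  then have a: "a > 0" "a \<le> 1" unfolding a_def by (simp_all add: power_less_one_iff abs_square_less_1)
  have A: "A \<noteq> 0" using a by (simp add: A_def)
  let ?E = "bk (?n + 3) 2 x y"
  \<comment> \<open>An open neighbourhood of 0 on which both formulas for the first derivative are
    valid.\<close>
  let ?S = "{c. x + c *s y \<in> ball \<omega> R} \<inter> {c. A - c * cnj b \<noteq> 0}"
  have "open ((\<lambda>c. A - c * cnj b) -` (- {0}))" by (intro open_vimage continuous_intros)
  then have S: "open ?S" by (intro open_Int line_in_ball_open) (simp add: vimage_def)
  define \<phi>1 where "\<phi>1 c = 2 * B * (b + c * B) / (A - c * cnj b) ^ (?n + 3) + of_nat (?n + 3) * cnj b * (b + c * B)\<^sup>2 / (A - c * cnj b) ^ (?n + 4)" for c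
  define \<phi>2 where "\<phi>2 = 2 * B\<^sup>2 / A ^ (?n + 3) + 4 * of_nat (?n + 3) * B * (b * cnj b) / A ^ (?n + 4) + of_nat ((?n + 3) * (?n + 4)) * (b * cnj b)\<^sup>2 / A ^ (?n + 5)"
  have p2: "((\<lambda>c. (b + c * B) ^ 2) has_field_derivative 2 * B * (b + c * B)) (at c)" for c
    by (auto intro!: derivative_eq_intros)
  have D1: "of_nat (?n + 1) * A2_inner \<omega> R ?E (bk (?n + 2) 1 (x + c *s y) y) = \<phi>1 c" if c: "c \<in> ?S" for c
  proof -
    have D: "((\<lambda>c. ?E (x + c *s y)) has_field_derivative \<phi>1 c) (at c)"
    proof (rule has_field_derivative_transform_within_open[OF _ line_in_ball_open[of x y]])
      show "((\<lambda>c. (b + c * B) ^ 2 / (A - c * cnj b) ^ (?n + 3)) has_field_derivative \<phi>1 c) (at c)"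
      proof -
        have nz: "A - c * cnj b \<noteq> 0" using c by simp
        have e: "Suc (?n + 3) = ?n + 4" by simp
        show ?thesis using has_field_derivative_divide_linear_power[OF p2 nz, of "?n + 3", unfolded e] by (simp only: \<phi>1_def mult_ac)
      qed
      show "(b + c * B) ^ 2 / (A - c * cnj b) ^ (?n + 3) = ?E (x + c *s y)" if "c \<in> {c. x + c *s y \<in> ball \<omega> R}" for c
        using bk_on_line[of x c y "?n + 3" 2] that by (simp add: a_def b_def \<beta>_def A_def B_def)
    qed (use c in simp)
    have "((\<lambda>c. ?E (x + c *s y)) has_field_derivative of_nat (?n + 1) * A2_inner \<omega> R ?E (bk (?n + 2) 1 (x + c *s y) y)) (at c)"
      using A2_line_derivative1[OF bk_in_A2[OF x], of x c y "?n + 3" 2 y] c by simp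
    from DERIV_unique[OF this D] show ?thesis .
  qed
  have D2: "(\<phi>1 has_field_derivative of_nat (?n + 1) * (of_nat (?n + 2) * A2_inner \<omega> R ?E ?E)) (at 0)"
  proof (rule has_field_derivative_transform_within_open[OF _ S _ D1])
    show "((\<lambda>c. of_nat (?n + 1) * A2_inner \<omega> R ?E (bk (?n + 2) 1 (x + c *s y) y)) has_field_derivative
        of_nat (?n + 1) * (of_nat (?n + 2) * A2_inner \<omega> R ?E ?E)) (at 0)"
      using A2_line_derivative2[OF bk_in_A2[OF x] x0, of "?n + 3" 2 y] by (simp only: vector_smult_lzero add_0_right)
  qed (use x A in simp_all)
  have D3: "(\<phi>1 has_field_derivative \<phi>2) (at 0)"
  proof -
    have nz: "A - 0 * cnj b \<noteq> 0" using A by simp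
    have e: "Suc (?n + 3) = ?n + 4" "Suc (?n + 4) = ?n + 5" by simp_all
    have p1: "((\<lambda>c. 2 * B * (b + c * B)) has_field_derivative 2 * B * B) (at 0)"
      by (auto intro!: derivative_eq_intros)
    have p2': "((\<lambda>c. of_nat (?n + 3) * cnj b * (b + c * B)\<^sup>2) has_field_derivative of_nat (?n + 3) * cnj b * (2 * B * (b + 0 * B))) (at 0)"
      by (rule DERIV_cmult[OF p2])
    have "(2 * B * B / A ^ (?n + 3) + of_nat (?n + 3) * cnj b * (2 * B * b) / A ^ (?n + 4)) +
       (of_nat (?n + 3) * cnj b * (2 * B * b) / A ^ (?n + 4) + of_nat (?n + 4) * cnj b * (of_nat (?n + 3) * cnj b * b\<^sup>2) / A ^ (?n + 5)) = \<phi>2"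
      unfolding \<phi>2_def add_divide_distrib[symmetric] of_nat_mult power_mult_distrib power2_eq_square by algebra
    with DERIV_add[OF has_field_derivative_divide_linear_power[OF p1 nz, of "?n + 3", unfolded e] has_field_derivative_divide_linear_power[OF p2' nz, of "?n + 4", unfolded e]]
    show ?thesis unfolding \<phi>1_def[abs_def] by (simp only: mult_zero_left add_0_right diff_zero)
  qed
  have "of_nat (?n + 1) * (of_nat (?n + 2) * A2_inner \<omega> R ?E ?E) = \<phi>2" by (rule DERIV_unique[OF D2 D3])
  also have "\<phi>2 = of_real (2 * \<beta>\<^sup>2 / a ^ (?n + 3) + 4 * (n + 3) * \<beta> * (cmod b)\<^sup>2 / a ^ (?n + 4) + (n + 3) * (n + 4) * ((cmod b)\<^sup>2)\<^sup>2 / a ^ (?n + 5))"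
    unfolding \<phi>2_def complex_norm_square[symmetric] by (simp add: A_def B_def n_def)
  finally have "complex_of_real ((n + 1) * (n + 2) * (A2_norm \<omega> R ?E)\<^sup>2) = 
      of_real (2 * \<beta>\<^sup>2 / a ^ (?n + 3) + 4 * (n + 3) * \<beta> * (cmod b)\<^sup>2 / a ^ (?n + 4) + (n + 3) * (n + 4) * ((cmod b)\<^sup>2)\<^sup>2 / a ^ (?n + 5))"
    unfolding A2_norm_sq(2)[OF bk_in_A2[OF x]] by (simp add: n_def mult_ac add.commute[of 1] add.commute[of 2])
  then have "(n + 1) * (n + 2) * (A2_norm \<omega> R ?E)\<^sup>2 = 
      2 * \<beta>\<^sup>2 / a ^ (?n + 3) + 4 * (n + 3) * \<beta> * (cmod b)\<^sup>2 / a ^ (?n + 4) + (n + 3) * (n + 4) * ((cmod b)\<^sup>2)\<^sup>2 / a ^ (?n + 5)"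
    unfolding of_real_eq_iff .
  also have "\<dots> \<le> 2 * \<beta>\<^sup>2 / a ^ (?n + 3) + 4 * (n + 3) * \<beta> * ((1 - a) * \<beta>) / a ^ (?n + 4) + (n + 3) * (n + 4) * ((1 - a) * \<beta>)\<^sup>2 / a ^ (?n + 5)"
    using cmod_vec_inner_div_sq_le[of x y] a by (intro add_mono divide_right_mono mult_left_mono power_mono) (auto simp: b_def a_def \<beta>_def n_def)
  also have "\<dots> = \<beta>\<^sup>2 * (2 * a\<^sup>2 + 4 * (n + 3) * (a * (1 - a)) + (n + 3) * (n + 4) * (1 - a)\<^sup>2) / a ^ (?n + 5)"
    using a by (simp add: divide_simps power_add power2_eq_square power3_eq_cube power4_eq_xxxx numeral_eq_Suc algebra_simps)
  \<comment> \<open>Each coefficient is at most the corresponding one in the expansion of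
    \<open>(n + 3) * (n + 4) * (a + (1 - a))\<^sup>2\<close>.\<close>
  also have "\<dots> \<le> \<beta>\<^sup>2 * ((n + 3) * (n + 4)) / a ^ (?n + 5)"
  proof (intro divide_right_mono mult_left_mono)
    have "2 * a\<^sup>2 + 4 * (n + 3) * (a * (1 - a)) + (n + 3) * (n + 4) * (1 - a)\<^sup>2 \<le> (n + 3) * (n + 4) * a\<^sup>2 + (n + 3) * (n + 4) * (2 * (a * (1 - a))) + (n + 3) * (n + 4) * (1 - a)\<^sup>2"
    proof (intro add_mono order_refl)
      have 1: "2 \<le> (n + 3) * (n + 4)" by (simp add: n_def algebra_simps)
      show "2 * a\<^sup>2 \<le> (n + 3) * (n + 4) * a\<^sup>2" by (rule mult_right_mono[OF 1]) simp
      have "4 * (n + 3) \<le> (n + 3) * (n + 4) * 2" by (simp add: n_def algebra_simps)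
      then have "4 * (n + 3) * (a * (1 - a)) \<le> (n + 3) * (n + 4) * 2 * (a * (1 - a))" by (rule mult_right_mono) (use a in simp)
      then show "4 * (n + 3) * (a * (1 - a)) \<le> (n + 3) * (n + 4) * (2 * (a * (1 - a)))" by (simp only: mult.assoc)
    qed
    also have "\<dots> = (n + 3) * (n + 4)" by (simp add: power2_eq_square algebra_simps)
    finally show "2 * a\<^sup>2 + 4 * (n + 3) * (a * (1 - a)) + (n + 3) * (n + 4) * (1 - a)\<^sup>2 \<le> (n + 3) * (n + 4)" .
  qed (use a in auto)
  finally have *: "(n + 1) * (n + 2) * ((n + 1) * (n + 2) * (A2_norm \<omega> R ?E)\<^sup>2) \<le> (n + 1) * (n + 2) * (\<beta>\<^sup>2 * ((n + 3) * (n + 4)) / a ^ (?n + 5))"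
    by (rule mult_left_mono) (simp add: n_def)
  have "\<beta>\<^sup>2 = (norm y / R) ^ 4" by (simp add: \<beta>_def flip: power_mult)
  then show ?thesis using * by (simp only:) (simp add: power2_eq_square mult_ac)
qed

end

subsection \<open>Derivative bounds\<close>

context bergman_ball
begin

text \<open>Cauchy-Schwarz against the representing function. With a lower bound
  \<open>\<sigma>\<close> for the square root of the weight, half-integral powers become natural
  ones, and one \<open>\<sigma>\<close> can serve a whole segment.\<close>

lemma deriv1_bound:
  assumes g: "g \<in> A2 \<omega> R" and x: "x \<in> ball \<omega> R" and \<sigma>: "\<sigma> > 0" "\<sigma>\<^sup>2 \<le> 1 - (norm (x - \<omega>) / R)\<^sup>2"
  defines "n \<equiv> real CARD('n)"
  shows "cmod (of_nat (CARD('n) + 1) * A2_inner \<omega> R g (bk (CARD('n) + 2) 1 x y)) 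
    \<le> sqrt ((n + 1) * (n + 2)) * A2_norm \<omega> R g * norm y / (R * \<sigma> ^ (CARD('n) + 3))"
proof -
  let ?E = "bk (CARD('n) + 2) 1 x y"
  have a0: "0 < 1 - (norm (x - \<omega>) / R)\<^sup>2" using \<sigma> zero_less_power[OF \<sigma>(1), of 2] by linarith
  have "((n + 1) * A2_norm \<omega> R ?E)\<^sup>2 \<le> (n + 1) * (n + 2) * (norm y / R)\<^sup>2 / (1 - (norm (x - \<omega>) / R)\<^sup>2) ^ (CARD('n) + 3)"
    unfolding n_def by (rule bk1_norm_bound[OF x])
  also have "\<dots> \<le> (n + 1) * (n + 2) * (norm y / R)\<^sup>2 / (\<sigma>\<^sup>2) ^ (CARD('n) + 3)"
    by (intro divide_left_mono power_mono \<sigma> mult_pos_pos zero_less_power) (use \<sigma> a0 in \<open>auto simp: n_def\<close>)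
  also have "\<dots> = (sqrt ((n + 1) * (n + 2)) * (norm y / R) / \<sigma> ^ (CARD('n) + 3))\<^sup>2"
    by (simp add: power_divide power_mult_distrib n_def mult.commute flip: power_mult)
  finally have "(n + 1) * A2_norm \<omega> R ?E \<le> sqrt ((n + 1) * (n + 2)) * (norm y / R) / \<sigma> ^ (CARD('n) + 3)"
    by (rule power2_le_imp_le) (use \<sigma> R in \<open>auto simp: n_def\<close>)
  then have "A2_norm \<omega> R g * ((n + 1) * A2_norm \<omega> R ?E) \<le> A2_norm \<omega> R g * (sqrt ((n + 1) * (n + 2)) * (norm y / R) / \<sigma> ^ (CARD('n) + 3))"
    by (rule mult_left_mono) (simp add: A2_norm_sq g)
  moreover have "cmod (of_nat (CARD('n) + 1) * A2_inner \<omega> R g ?E) \<le> (n + 1) * (A2_norm \<omega> R g * A2_norm \<omega> R ?E)"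
  proof -
    have "cmod (of_nat (CARD('n) + 1)) = n + 1" unfolding norm_of_nat by (simp add: n_def)
    then show ?thesis unfolding norm_mult
      using A2_Cauchy_Schwarz[OF g bk_in_A2[OF x]] by (simp add: n_def mult_left_mono)
  qed
  ultimately show ?thesis by (simp add: mult_ac)
qed

lemma deriv2_bound:
  assumes g: "g \<in> A2 \<omega> R" and x: "x \<in> ball \<omega> R" and \<sigma>: "\<sigma> > 0" "\<sigma>\<^sup>2 \<le> 1 - (norm (x - \<omega>) / R)\<^sup>2"
  defines "n \<equiv> real CARD('n)"
  shows "cmod (of_nat (CARD('n) + 1) * (of_nat (CARD('n) + 2) * A2_inner \<omega> R g (bk (CARD('n) + 3) 2 x y))) 
    \<le> 2 * (n + 1) * (n + 2) * A2_norm \<omega> R g * (norm y)\<^sup>2 / (R\<^sup>2 * \<sigma> ^ (CARD('n) + 5))"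
proof -
  let ?E = "bk (CARD('n) + 3) 2 x y"
  have a0: "0 < 1 - (norm (x - \<omega>) / R)\<^sup>2" using \<sigma> zero_less_power[OF \<sigma>(1), of 2] by linarith
  have n: "n \<ge> 1" by (simp add: n_def Suc_leI)
  have "((n + 1) * (n + 2) * A2_norm \<omega> R ?E)\<^sup>2 \<le> (n + 1) * (n + 2) * (n + 3) * (n + 4) * (norm y / R) ^ 4 / (1 - (norm (x - \<omega>) / R)\<^sup>2) ^ (CARD('n) + 5)"
    unfolding n_def by (rule bk2_norm_bound[OF x])
  also have "\<dots> \<le> (n + 1) * (n + 2) * (n + 3) * (n + 4) * (norm y / R) ^ 4 / (\<sigma>\<^sup>2) ^ (CARD('n) + 5)"
    by (intro divide_left_mono power_mono \<sigma> mult_pos_pos zero_less_power) (use \<sigma> n R a0 in auto)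
  also have "\<dots> \<le> (2 * (n + 1) * (n + 2))\<^sup>2 * (norm y / R) ^ 4 / (\<sigma>\<^sup>2) ^ (CARD('n) + 5)"
  proof (intro divide_right_mono mult_right_mono)
    \<comment> \<open>This rounds the product of four factors up to a square, whose root
      \<open>2 * (n + 1) * (n + 2)\<close> is later halved by Taylor's formula.\<close>
    have "(n + 3) * (n + 4) \<le> 4 * ((n + 1) * (n + 2))"
      using n mult_mono[OF n n] by (simp add: algebra_simps)
    then have "(n + 1) * (n + 2) * ((n + 3) * (n + 4)) \<le> (n + 1) * (n + 2) * (4 * ((n + 1) * (n + 2)))"
      by (rule mult_left_mono) (use n in simp)
    then show "(n + 1) * (n + 2) * (n + 3) * (n + 4) \<le> (2 * (n + 1) * (n + 2))\<^sup>2"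
      by (simp add: power2_eq_square algebra_simps)
  qed (use \<sigma> R in auto)
  also have "\<dots> = (2 * (n + 1) * (n + 2) * (norm y / R)\<^sup>2 / \<sigma> ^ (CARD('n) + 5))\<^sup>2"
    by (simp add: power_divide power_mult_distrib mult.commute flip: power_mult)
  finally have "(n + 1) * (n + 2) * A2_norm \<omega> R ?E \<le> 2 * (n + 1) * (n + 2) * (norm y / R)\<^sup>2 / \<sigma> ^ (CARD('n) + 5)"
    by (rule power2_le_imp_le) (use \<sigma> R n in auto)
  then have "A2_norm \<omega> R g * ((n + 1) * (n + 2) * A2_norm \<omega> R ?E) \<le> A2_norm \<omega> R g * (2 * (n + 1) * (n + 2) * (norm y / R)\<^sup>2 / \<sigma> ^ (CARD('n) + 5))"
    by (rule mult_left_mono) (simp add: A2_norm_sq g)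
  moreover have "cmod (of_nat (CARD('n) + 1) * (of_nat (CARD('n) + 2) * A2_inner \<omega> R g ?E)) \<le> (n + 1) * ((n + 2) * (A2_norm \<omega> R g * A2_norm \<omega> R ?E))"
  proof -
    have "cmod (of_nat (CARD('n) + 1)) = n + 1" "cmod (of_nat (CARD('n) + 2)) = n + 2" unfolding norm_of_nat by (simp_all add: n_def)
    then show ?thesis unfolding norm_mult
      using A2_Cauchy_Schwarz[OF g bk_in_A2[OF x]] n by (simp add: mult_left_mono)
  qed
  ultimately show ?thesis by (simp add: mult_ac power_divide)
qed

text \<open>Pairing \<open>f\<close> with its own value \<open>f x\<close> turns the scalar kernel
  estimate at \<open>x\<close> into one for the Euclidean norm.\<close>

lemma A2s_norm_at:
  assumes f: "f \<in> A2s \<omega> R" and x: "x \<in> ball \<omega> R" and \<sigma>: "\<sigma> > 0" "\<sigma>\<^sup>2 \<le> 1 - (norm (x - \<omega>) / R)\<^sup>2"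
  shows "norm (f x) \<le> A2s_norm \<omega> R f / \<sigma> ^ (CARD('n) + 1)"
proof (cases "f x = 0")
  case False
  define g where "g z = vec_inner (f z) (f x)" for z
  have a0: "0 < 1 - (norm (x - \<omega>) / R)\<^sup>2" using \<sigma> zero_less_power[OF \<sigma>(1), of 2] by linarith
  have g: "g \<in> A2 \<omega> R" unfolding g_def by (rule A2s_vec_inner[OF f])
  have E: "bergman \<omega> R x \<in> A2 \<omega> R" unfolding bergman_eq_bk[of _ 0] by (rule bk_in_A2[OF x])
  have "(A2_norm \<omega> R (bergman \<omega> R x))\<^sup>2 \<le> 1 / (\<sigma>\<^sup>2) ^ (CARD('n) + 1)"
    unfolding A2_norm_bergman[OF x] by (intro divide_left_mono power_mono \<sigma> mult_pos_pos zero_less_power) (use \<sigma> a0 in auto)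
  also have "\<dots> = (1 / \<sigma> ^ (CARD('n) + 1))\<^sup>2" by (simp add: power_divide power_mult_distrib power2_eq_square)
  finally have nE: "A2_norm \<omega> R (bergman \<omega> R x) \<le> 1 / \<sigma> ^ (CARD('n) + 1)"
    by (rule power2_le_imp_le) (use \<sigma> in simp)
  have "(norm (f x))\<^sup>2 = cmod (g x)" by (simp add: g_def vec_inner_self norm_power)
  also have "\<dots> \<le> A2_norm \<omega> R g * A2_norm \<omega> R (bergman \<omega> R x)"
    using A2_Cauchy_Schwarz[OF g E] A2_reproducing[OF g x] by simp
  also have "\<dots> \<le> (A2s_norm \<omega> R f * norm (f x)) * (1 / \<sigma> ^ (CARD('n) + 1))"
    using A2_norm_vec_inner_le[OF f, of "f x"] unfolding g_def[symmetric]
    by (intro mult_mono nE) (auto simp: A2s_norm_sq f A2_norm_sq E)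
  finally have "norm (f x) * norm (f x) \<le> norm (f x) * (A2s_norm \<omega> R f / \<sigma> ^ (CARD('n) + 1))"
    by (simp add: power2_eq_square mult_ac)
  then show ?thesis by (rule mult_left_le_imp_le) (use False in simp)
qed (use \<sigma> in \<open>simp add: A2s_norm_sq f\<close>)

lemma A2s_has_derivative:
  fixes f :: "complex ^ 'n \<Rightarrow> complex ^ 's"
  assumes f: "f \<in> A2s \<omega> R" and x: "x \<in> ball \<omega> R"
  shows "(f has_derivative frechet_derivative f (at x)) (at x)"
    and "frechet_derivative f (at x) (c *s v) = c *s frechet_derivative f (at x) v"
    and "frechet_derivative f (at x) (v + w) = frechet_derivative f (at x) v + frechet_derivative f (at x) w"
proof -
  have "\<forall>i. \<exists>d. ((\<lambda>z. f z $ i) has_derivative d) (at x) \<and> Vector_Spaces.linear (*s) (*) d"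
    using A2D(1)[OF A2sD[OF f]] x unfolding analytic_fun_on_def by blast
  then obtain d where d: "\<And>i. ((\<lambda>z. f z $ i) has_derivative d i) (at x)" "\<And>i. Vector_Spaces.linear (*s) (*) (d i)"
    by metis
  define D where "D h = (\<Sum>i\<in>UNIV. d i h *s axis i (1::complex))" for h
  have "((\<lambda>z. \<Sum>i\<in>UNIV. (f z $ i) *s axis i 1) has_derivative D) (at x)"
    unfolding D_def by (intro has_derivative_sum bounded_linear.has_derivative[OF bounded_linear_smult_vec] d)
  then have fD: "(f has_derivative D) (at x)" by (simp add: basis_expansion)
  then have eq: "frechet_derivative f (at x) = D" using frechet_derivative_at by metis
  show "(f has_derivative frechet_derivative f (at x)) (at x)" using fD eq by simp
  show "frechet_derivative f (at x) (c *s v) = c *s frechet_derivative f (at x) v"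
    using d(2) unfolding complex_linear_iff eq D_def by (simp add: vec_eq_iff sum_distrib_left mult.assoc)
  show "frechet_derivative f (at x) (v + w) = frechet_derivative f (at x) v + frechet_derivative f (at x) w"
    using d(2) unfolding complex_linear_iff eq D_def by (simp add: vec_eq_iff sum.distrib algebra_simps)
qed

text \<open>Both sides are the derivative at 0 of the same scalar function on the line through
  \<open>x\<close> in direction \<open>y\<close>.\<close>

lemma vec_inner_frechet_derivative:
  assumes f: "f \<in> A2s \<omega> R" and x: "x \<in> ball \<omega> R"
  shows "vec_inner (frechet_derivative f (at x) y) u = of_nat (CARD('n) + 1) * A2_inner \<omega> R (\<lambda>z. vec_inner (f z) u) (bk (CARD('n) + 2) 1 x y)"
proof -
  have "((\<lambda>z. vec_inner (f z) u) has_derivative (\<lambda>h. vec_inner (frechet_derivative f (at x) h) u)) (at (x + 0 *s y))"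
    using bounded_linear.has_derivative[OF bounded_linear_vec_inner_left A2s_has_derivative(1)[OF f x]] by simp
  then have "((\<lambda>c. vec_inner (f (x + c *s y)) u) has_field_derivative vec_inner (frechet_derivative f (at x) y) u) (at 0)"
    by (rule has_field_derivative_on_line)
      (simp add: complex_linear_iff A2s_has_derivative(2,3)[OF f x] vec_inner_add_left vec_inner_smult_left)
  moreover have "((\<lambda>c. vec_inner (f (x + c *s y)) u) has_field_derivative of_nat (CARD('n) + 1) * A2_inner \<omega> R (\<lambda>z. vec_inner (f z) u) (bk (CARD('n) + 2) 1 x y)) (at 0)"
    using A2_line_derivative1[OF A2s_vec_inner[OF f], of x 0 y u] x by simp
  ultimately show ?thesis by (rule DERIV_unique)
qed

text \<open>The mean value theorem is applied to the real part of \<open>f\<close> paired with the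
  increment \<open>u\<close> itself: this real function increases by the square of
  \<open>norm u\<close>. The segment has to stay where \<open>\<sigma>\<close> controls the
  weight.\<close>

lemma A2s_increment_bound:
  assumes f: "f \<in> A2s \<omega> R" and \<sigma>: "\<sigma> > 0"
    and seg: "\<And>t. 0 \<le> t \<Longrightarrow> t \<le> 1 \<Longrightarrow> x + t *\<^sub>R y \<in> ball \<omega> R \<and> \<sigma>\<^sup>2 \<le> 1 - (norm (x + t *\<^sub>R y - \<omega>) / R)\<^sup>2"
  defines "n \<equiv> real CARD('n)"
  shows "norm (f (x + y) - f x) \<le> sqrt ((n + 1) * (n + 2)) * A2s_norm \<omega> R f * norm y / (R * \<sigma> ^ (CARD('n) + 3))"
proof (cases "f (x + y) = f x")
  case True
  then show ?thesis using R \<sigma> by (simp add: A2s_norm_sq f n_def)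
next
  case False
  define u where "u = f (x + y) - f x"
  define g where "g z = vec_inner (f z) u" for z
  have g: "g \<in> A2 \<omega> R" unfolding g_def by (rule A2s_vec_inner[OF f])
  define \<phi>1 where "\<phi>1 c = of_nat (CARD('n) + 1) * A2_inner \<omega> R g (bk (CARD('n) + 2) 1 (x + c *s y) y)" for c
  define M where "M = sqrt ((n + 1) * (n + 2)) * norm y / (R * \<sigma> ^ (CARD('n) + 3))"
  have M: "M \<ge> 0" using R \<sigma> by (simp add: M_def n_def)
  define diff where "diff m t = (if m = 0 then Re (g (x + of_real t *s y)) else Re (\<phi>1 (of_real t)))" for m :: nat and t
  have "\<exists>t::real. 0 < t \<and> t < 1 \<and> diff 0 1 = (\<Sum>m<1. (diff m 0 / fact m) * 1 ^ m) + (diff 1 t / fact 1) * 1 ^ 1"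
  proof (rule Maclaurin)
    show "\<forall>m t. m < 1 \<and> 0 \<le> t \<and> t \<le> 1 \<longrightarrow> (diff m has_real_derivative diff (Suc m) t) (at t)"
    proof (intro allI impI)
      fix m and t :: real assume "m < (1::nat) \<and> 0 \<le> t \<and> t \<le> 1"
      then have m: "m = 0" and t: "0 \<le> t" "t \<le> 1" by auto
      have xt: "x + of_real t *s y \<in> ball \<omega> R" using seg[OF t] by (simp add: smult_vec_of_real)
      have "((\<lambda>t. Re (g (x + of_real t *s y))) has_real_derivative Re (\<phi>1 (of_real t))) (at t)"
        unfolding \<phi>1_def by (rule has_field_derivative_Re_of_real[OF A2_line_derivative1[OF g xt]])
      then show "(diff m has_real_derivative diff (Suc m) t) (at t)" by (simp add: m diff_def[abs_def])
    qed
  qed auto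
  then obtain t where t: "0 < t" "t < 1" "Re (g (x + y)) = Re (g x) + Re (\<phi>1 (of_real t))"
    by (auto simp: diff_def)
  have "(norm u)\<^sup>2 = Re (g (x + y)) - Re (g x)"
    using vec_inner_self[of u] by (simp add: g_def u_def vec_inner_diff_left flip: minus_complex.sel)
  also have "\<dots> \<le> cmod (\<phi>1 (of_real t))" using t(3) complex_Re_le_cmod[of "\<phi>1 (of_real t)"] by simp
  also have "\<dots> \<le> sqrt ((n + 1) * (n + 2)) * A2_norm \<omega> R g * norm y / (R * \<sigma> ^ (CARD('n) + 3))"
    unfolding \<phi>1_def n_def using seg[of t] t by (intro deriv1_bound g \<sigma>) (auto simp: smult_vec_of_real)
  also have "\<dots> = M * A2_norm \<omega> R g" by (simp add: M_def)
  also have "\<dots> \<le> M * (A2s_norm \<omega> R f * norm u)"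
    unfolding g_def by (intro mult_left_mono A2_norm_vec_inner_le f M)
  finally have "norm u * norm u \<le> norm u * (M * A2s_norm \<omega> R f)" by (simp add: power2_eq_square mult_ac)
  then have "norm u \<le> M * A2s_norm \<omega> R f" using False by (simp add: u_def)
  then show ?thesis by (simp add: M_def u_def mult_ac)
qed

text \<open>The same pairing, with the Taylor remainder as \<open>u\<close> and to second order. The
  factor 1/2 of Taylor's formula cancels the 2 in \<open>deriv2_bound\<close>.\<close>

lemma A2s_taylor_bound:
  assumes f: "f \<in> A2s \<omega> R" and \<sigma>: "\<sigma> > 0"
    and seg: "\<And>t. 0 \<le> t \<Longrightarrow> t \<le> 1 \<Longrightarrow> x + t *\<^sub>R y \<in> ball \<omega> R \<and> \<sigma>\<^sup>2 \<le> 1 - (norm (x + t *\<^sub>R y - \<omega>) / R)\<^sup>2"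
  defines "n \<equiv> real CARD('n)"
  shows "norm (f (x + y) - f x - frechet_derivative f (at x) y) \<le> (n + 1) * (n + 2) * A2s_norm \<omega> R f * (norm y)\<^sup>2 / (R\<^sup>2 * \<sigma> ^ (CARD('n) + 5))"
proof (cases "f (x + y) - f x - frechet_derivative f (at x) y = 0")
  case True
  then show ?thesis using R \<sigma> by (simp add: A2s_norm_sq f n_def)
next
  case False
  define u where "u = f (x + y) - f x - frechet_derivative f (at x) y"
  define g where "g z = vec_inner (f z) u" for z
  have g: "g \<in> A2 \<omega> R" unfolding g_def by (rule A2s_vec_inner[OF f])
  define \<phi>1 where "\<phi>1 c = of_nat (CARD('n) + 1) * A2_inner \<omega> R g (bk (CARD('n) + 2) 1 (x + c *s y) y)" for c
  define \<phi>2 where "\<phi>2 c = of_nat (CARD('n) + 1) * (of_nat (CARD('n) + 2) * A2_inner \<omega> R g (bk (CARD('n) + 3) 2 (x + c *s y) y))" for c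
  define M where "M = (n + 1) * (n + 2) * (norm y)\<^sup>2 / (R\<^sup>2 * \<sigma> ^ (CARD('n) + 5))"
  have M: "M \<ge> 0" using R \<sigma> by (simp add: M_def n_def)
  have x: "x \<in> ball \<omega> R" using seg[of 0] by simp
  define diff where "diff m t = (if m = 0 then Re (g (x + of_real t *s y)) else if m = 1 then Re (\<phi>1 (of_real t)) else Re (\<phi>2 (of_real t)))" for m :: nat and t
  have "\<exists>t::real. 0 < t \<and> t < 1 \<and> diff 0 1 = (\<Sum>m<2. (diff m 0 / fact m) * 1 ^ m) + (diff 2 t / fact 2) * 1 ^ 2"
  proof (rule Maclaurin)
    show "\<forall>m t. m < 2 \<and> 0 \<le> t \<and> t \<le> 1 \<longrightarrow> (diff m has_real_derivative diff (Suc m) t) (at t)"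
    proof (intro allI impI)
      fix m and t :: real assume "m < (2::nat) \<and> 0 \<le> t \<and> t \<le> 1"
      then have m: "m = 0 \<or> m = 1" and t: "0 \<le> t" "t \<le> 1" by auto
      have xt: "x + of_real t *s y \<in> ball \<omega> R" using seg[OF t] by (simp add: smult_vec_of_real)
      have 0: "((\<lambda>t. Re (g (x + of_real t *s y))) has_real_derivative Re (\<phi>1 (of_real t))) (at t)"
        unfolding \<phi>1_def by (rule has_field_derivative_Re_of_real[OF A2_line_derivative1[OF g xt]])
      have 1: "((\<lambda>t. Re (\<phi>1 (of_real t))) has_real_derivative Re (\<phi>2 (of_real t))) (at t)"
        unfolding \<phi>1_def \<phi>2_def by (rule has_field_derivative_Re_of_real[OF A2_line_derivative2[OF g xt]])
      show "(diff m has_real_derivative diff (Suc m) t) (at t)"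
        using m 0 1 by (auto simp: diff_def[abs_def])
    qed
  qed auto
  then obtain t where t: "0 < t" "t < 1" "Re (g (x + y)) = Re (g x) + Re (\<phi>1 0) + Re (\<phi>2 (of_real t)) / 2"
    by (auto simp: diff_def numeral_2_eq_2)
  have \<phi>10: "\<phi>1 0 = vec_inner (frechet_derivative f (at x) y) u"
    unfolding vec_inner_frechet_derivative[OF f x] \<phi>1_def g_def by simp
  have "(norm u)\<^sup>2 = Re (vec_inner u u)" by (simp add: vec_inner_self)
  also have "vec_inner u u = g (x + y) - g x - \<phi>1 0"
    unfolding \<phi>10 g_def by (subst (1) u_def) (simp add: vec_inner_diff_left)
  also have "Re (g (x + y) - g x - \<phi>1 0) \<le> cmod (\<phi>2 (of_real t)) / 2" using t(3) complex_Re_le_cmod[of "\<phi>2 (of_real t)"] by simp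
  also have "\<dots> \<le> (2 * (n + 1) * (n + 2) * A2_norm \<omega> R g * (norm y)\<^sup>2 / (R\<^sup>2 * \<sigma> ^ (CARD('n) + 5))) / 2"
    unfolding \<phi>2_def n_def using seg[of t] t by (intro divide_right_mono deriv2_bound g \<sigma>) (auto simp: smult_vec_of_real)
  also have "\<dots> = M * A2_norm \<omega> R g" using R \<sigma> by (simp add: M_def divide_simps)
  also have "\<dots> \<le> M * (A2s_norm \<omega> R f * norm u)"
    unfolding g_def by (intro mult_left_mono A2_norm_vec_inner_le f M)
  finally have "norm u * norm u \<le> norm u * (M * A2s_norm \<omega> R f)" by (simp add: power2_eq_square mult_ac)
  then have "norm u \<le> M * A2s_norm \<omega> R f" using False by (simp add: u_def)
  then show ?thesis by (simp add: M_def u_def mult_ac)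
qed

end

subsection \<open>The Newton step\<close>

text \<open>By the symmetries, \<open>AX = AY\<close>, and \<open>XA = YA\<close> on
  \<open>V\<close>; then \<open>X = XAX = YAX = YAY = Y\<close>. Nondegeneracy of the two pairings
  suffices, so the candidates may be arbitrary functions.\<close>

lemma penrose_unique:
  assumes X: "penrose V innerV innerW A X" and Y: "penrose V innerV innerW A Y"
    and W: "\<And>a b. (\<And>w. innerW a w = innerW b w) \<Longrightarrow> a = b"
    and V: "\<And>a b. a \<in> V \<Longrightarrow> b \<in> V \<Longrightarrow> (\<And>v. v \<in> V \<Longrightarrow> innerV a v = innerV b v) \<Longrightarrow> a = b"
  shows "X = Y"
proof
  fix w
  note x = X[unfolded penrose_def] and y = Y[unfolded penrose_def]
  have XV: "X w \<in> V" and YV: "Y w \<in> V" for w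
    using subsetD[OF conjunct1[OF x]] subsetD[OF conjunct1[OF y]] by simp_all
  note AXA = x[THEN conjunct2, THEN conjunct1, rule_format] and AYA = y[THEN conjunct2, THEN conjunct1, rule_format]
  note x3 = x[THEN conjunct2, THEN conjunct2] and y3 = y[THEN conjunct2, THEN conjunct2]
  note XAX = x3[THEN conjunct1, rule_format] and YAY = y3[THEN conjunct1, rule_format]
  note Wx = x3[THEN conjunct2, THEN conjunct1, rule_format] and Wy = y3[THEN conjunct2, THEN conjunct1, rule_format]
  note Vx = x3[THEN conjunct2, THEN conjunct2, rule_format] and Vy = y3[THEN conjunct2, THEN conjunct2, rule_format]
  have AXY: "A (X w) = A (Y w)"
  proof (rule W)
    fix w'
    have "innerW (A (X w)) w' = innerW (A (Y (A (X w)))) w'" by (simp add: AYA XV)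
    also have "\<dots> = innerW (A (X w)) (A (Y w'))" by (rule Wy)
    also have "\<dots> = innerW w (A (X (A (Y w'))))" by (rule Wx)
    also have "\<dots> = innerW w (A (Y w'))" by (simp add: AXA YV)
    also have "\<dots> = innerW (A (Y w)) w'" by (rule Wy[symmetric])
    finally show "innerW (A (X w)) w' = innerW (A (Y w)) w'" .
  qed
  have XYA: "X (A v) = Y (A v)" if v: "v \<in> V" for v
  proof (rule V)
    fix v' assume v': "v' \<in> V"
    have "innerV (X (A v)) v' = innerV (X (A (Y (A v)))) v'" by (simp add: AYA v)
    also have "\<dots> = innerV (Y (A v)) (X (A v'))" by (rule Vx[OF YV v'])
    also have "\<dots> = innerV v (Y (A (X (A v'))))" by (rule Vy[OF v XV])
    also have "\<dots> = innerV v (Y (A v'))" by (simp add: AXA v')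
    also have "\<dots> = innerV (Y (A v)) v'" by (rule Vy[OF v v', symmetric])
    finally show "innerV (X (A v)) v' = innerV (Y (A v)) v'" .
  qed (rule XV YV)+
  have "X w = X (A (X w))" by (rule XAX[symmetric])
  also have "\<dots> = Y (A (X w))" by (rule XYA[OF XV])
  also have "\<dots> = Y w" by (simp only: AXY YAY)
  finally show "X w = Y w" .
qed

lemma vec_inner_eqI:
  assumes "\<And>w. vec_inner a w = vec_inner b w"
  shows "a = b"
  using assms[of "a - b"] vec_inner_self[of "a - b"] by (simp add: vec_inner_diff_left)

context bergman_ball
begin

lemma bergman_in_A2: "x \<in> ball \<omega> R \<Longrightarrow> bergman \<omega> R x \<in> A2 \<omega> R"
  unfolding bergman_eq_bk[of _ 0] by (rule bk_in_A2)

lemma A2s_inner_bergman: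
  assumes g: "g \<in> A2s \<omega> R" and x: "x \<in> ball \<omega> R"
  shows "A2s_inner \<omega> R g (\<lambda>z. bergman \<omega> R x z *s w) = vec_inner (g x) w"
proof -
  have "A2_inner \<omega> R (\<lambda>z. g z $ i) (\<lambda>z. bergman \<omega> R x z * w $ i) = g x $ i * cnj (w $ i)" for i
  proof -
    have "A2_inner \<omega> R (\<lambda>z. g z $ i) (\<lambda>z. bergman \<omega> R x z * w $ i) = A2_inner \<omega> R (\<lambda>z. g z $ i) (bergman \<omega> R x) * cnj (w $ i)"
      unfolding A2_inner_eq[OF A2sD[OF g]] by (simp flip: mult.assoc)
    then show ?thesis by (simp add: A2_reproducing[OF A2sD[OF g] x])
  qed
  then show ?thesis by (simp add: A2s_inner_def vec_inner_def)
qed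

text \<open>Testing with kernels times constant vectors recovers all values inside the ball;
  outside, elements vanish by the encoding of the space.\<close>

lemma prod_inner_nondegenerate:
  fixes p q :: "('n, 's::finite) point"
  assumes p: "p \<in> A2s \<omega> R \<times> UNIV" and q: "q \<in> A2s \<omega> R \<times> UNIV"
    and eq: "\<And>r. r \<in> A2s \<omega> R \<times> UNIV \<Longrightarrow> prod_inner \<omega> R p r = prod_inner \<omega> R q r"
  shows "p = q"
proof -
  have zero: "(\<lambda>_. 0) \<in> A2s \<omega> R" using A2_zero by (simp add: A2s_def)
  have z0: "A2s_inner \<omega> R f (\<lambda>_. 0) = 0" for f :: "complex ^ 'n \<Rightarrow> complex ^ 's"
    by (simp add: A2s_inner_def A2_inner_def set_lebesgue_integral_def)
  have "snd p = snd q"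
  proof (rule vec_inner_eqI)
    fix w
    show "vec_inner (snd p) w = vec_inner (snd q) w"
      using eq[of "(\<lambda>_. 0, w)"] zero by (simp add: prod_inner_def z0)
  qed
  moreover have "fst p z = fst q z" for z
  proof (cases "z \<in> ball \<omega> R")
    case True
    show ?thesis
    proof (rule vec_inner_eqI)
      fix w :: "complex ^ 's"
      have "(\<lambda>z'. bergman \<omega> R z z' *s w) \<in> A2s \<omega> R" by (rule A2s_smult[OF bergman_in_A2[OF True]])
      then show "vec_inner (fst p z) w = vec_inner (fst q z) w"
        using eq[of "(\<lambda>z'. bergman \<omega> R z z' *s w, 0)"] p q
        by (auto simp: prod_inner_def A2s_inner_bergman[OF _ True])
    qed
  next
    case False
    then have "fst p z $ i = 0" "fst q z $ i = 0" for i
      using A2D(3)[OF A2sD[of "fst p" i] False] A2D(3)[OF A2sD[of "fst q" i] False] p q by (simp_all add: mem_Times_iff)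
    then show ?thesis by (simp add: vec_eq_iff)
  qed
  ultimately show ?thesis by (simp add: prod_eq_iff fun_eq_iff)
qed

text \<open>The adjoint \<open>B\<close> of the derivative \<open>A\<close> is explicit, since the
  kernel represents evaluation. \<open>M\<close>, which is \<open>A\<close> after \<open>B\<close>,
  equals \<open>k\<close> times the identity plus \<open>T\<close> after its adjoint, hence is
  positive definite and invertible; the Moore-Penrose inverse is \<open>B\<close> after the inverse
  of \<open>M\<close>. So the function part of a step is a kernel times a vector.\<close>

lemma newton_step:
  fixes f :: "complex ^ 'n \<Rightarrow> complex ^ 's"
  assumes f: "f \<in> A2s \<omega> R" and x: "x \<in> ball \<omega> R"
  defines "a \<equiv> 1 - (norm (x - \<omega>) / R)\<^sup>2"
  obtains u y where 
    "moore_penrose (A2s \<omega> R \<times> UNIV) (prod_inner \<omega> R) vec_inner (D_evaluation (f, x)) (f x) = ((\<lambda>z. bergman \<omega> R x z *s u), y)"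
    "bergman \<omega> R x x *s u + frechet_derivative f (at x) y = f x"
    "prod_norm \<omega> R ((\<lambda>z. bergman \<omega> R x z *s u), y) \<le> sqrt a ^ (CARD('n) + 1) * norm (f x)"
    "norm u \<le> a ^ (CARD('n) + 1) * norm (f x)"
proof -
  let ?K = "bergman \<omega> R x"
  define T where "T = frechet_derivative f (at x)"
  define k where "k = 1 / a ^ (CARD('n) + 1)"
  have "0 \<le> norm (x - \<omega>) / R" "norm (x - \<omega>) / R < 1" using x R unfolding ball_ratio by auto
  then have a: "a > 0" unfolding a_def by (simp add: power_less_one_iff abs_square_less_1)
  have k: "k > 0" using a by (simp add: k_def)
  have Kx: "?K x = of_real k"
    using x by (simp add: bergman_def vec_inner_self k_def a_def power_divide)
  define A where "A = D_evaluation (f, x)"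
  have A: "A q = fst q x + T (snd q)" for q by (simp add: A_def D_evaluation_def T_def)
  have T_smult: "T (c *s v) = c *s T v" and T_add: "T (v + w) = T v + T w" for c v w
    unfolding T_def by (rule A2s_has_derivative(2,3)[OF f x])+
  \<comment> \<open>The adjoint of the complex linear map \<open>T\<close>, read off from the
    standard basis.\<close>
  define T' where "T' w = (\<chi> j. cnj (vec_inner (T (axis j 1)) w))" for w
  have T': "vec_inner (T y) w = vec_inner y (T' w)" for y w
  proof -
    have T_sum: "T (sum g I) = (\<Sum>i\<in>I. T (g i))" if "finite I" for g and I :: "'n set"
      using that
    proof (induction I rule: finite_induct)
      case empty
      show ?case using T_smult[of 0 0] by simp
    qed (simp add: T_add)
    have v_sum: "vec_inner (sum g I) w = (\<Sum>i\<in>I. vec_inner (g i) w)" for g :: "'n \<Rightarrow> complex ^ 's" and I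
      by (induction I rule: infinite_finite_induct) (auto simp: vec_inner_add_left)
    have "vec_inner (T y) w = vec_inner (T (\<Sum>j\<in>UNIV. (y $ j) *s axis j 1)) w" by (simp only: basis_expansion)
    also have "\<dots> = (\<Sum>j\<in>UNIV. y $ j * vec_inner (T (axis j 1)) w)"
      by (simp add: T_sum v_sum T_smult vec_inner_smult_left)
    also have "\<dots> = vec_inner y (T' w)" by (simp add: vec_inner_def[of y] T'_def)
    finally show ?thesis .
  qed
  define B where "B w = ((\<lambda>z. ?K z *s w), T' w)" for w
  have BV: "fst (B w) \<in> A2s \<omega> R" for w unfolding B_def using A2s_smult[OF bergman_in_A2[OF x]] by simp
  have adj: "prod_inner \<omega> R q (B w) = vec_inner (A q) w" if "fst q \<in> A2s \<omega> R" for q w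
    using that by (simp add: prod_inner_def B_def A A2s_inner_bergman[OF _ x] vec_inner_add_left T')
  define M where "M w = A (B w)" for w
  have M_eq: "M w = of_real k *s w + T (T' w)" for w by (simp add: M_def A B_def Kx)
  have M_sa: "vec_inner (M v) w = vec_inner v (M w)" for v w
  proof -
    have "vec_inner (M v) w = prod_inner \<omega> R (B v) (B w)" by (simp add: adj BV M_def)
    also have "\<dots> = cnj (prod_inner \<omega> R (B w) (B v))" by (simp add: prod_inner_cnj)
    also have "\<dots> = vec_inner v (M w)" by (simp add: adj BV M_def cnj_vec_inner)
    finally show ?thesis .
  qed
  have M_pos: "vec_inner (M w) w = of_real (k * (norm w)\<^sup>2 + (norm (T' w))\<^sup>2)" for w
    by (simp add: M_eq vec_inner_add_left vec_inner_smult_left vec_inner_self T')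
  have T'_add: "T' (v + w) = T' v + T' w" and T'_scaleR: "T' (r *\<^sub>R v) = r *\<^sub>R T' v" for v w r
    by (simp_all add: T'_def vec_eq_iff vec_inner_add_right vec_inner_scaleR_right scaleR_conv_of_real[where 'a = complex])
  have T_scaleR: "T (r *\<^sub>R v) = r *\<^sub>R T v" for r v
    using T_smult[of "of_real r" v] by (simp only: smult_vec_of_real)
  have M_lin: "linear M"
    by (rule linearI) (simp_all add: M_eq T'_add T'_scaleR T_add T_scaleR smult_vec_of_real algebra_simps)
  \<comment> \<open>The term with \<open>k > 0\<close> already forces injectivity, so the derivative
    is onto even where \<open>T\<close> is degenerate.\<close>
  have "inj M" unfolding linear_injective_0[OF M_lin]
  proof (intro allI impI)
    fix w assume "M w = 0"
    then have "complex_of_real (k * (norm w)\<^sup>2 + (norm (T' w))\<^sup>2) = 0" using M_pos[of w] by simp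
    then have "k * (norm w)\<^sup>2 + (norm (T' w))\<^sup>2 = 0" unfolding of_real_eq_0_iff .
    moreover have "0 \<le> k * (norm w)\<^sup>2" "0 \<le> (norm (T' w))\<^sup>2" using k by simp_all
    ultimately have "k * (norm w)\<^sup>2 = 0" by linarith
    then show "w = 0" using k by simp
  qed
  then have "surj M" using linear_injective_imp_surjective[OF M_lin] by blast
  define N where "N = inv M"
  have MN: "M (N w) = w" for w unfolding N_def by (rule surj_f_inv_f[OF \<open>surj M\<close>])
  define X where "X w = B (N w)" for w
  have AX: "A (X w) = w" for w using MN by (simp add: X_def M_def)
  \<comment> \<open>Since \<open>A (X w) = w\<close>, three of the Penrose equations are immediate;
    the symmetry of \<open>X\<close> after \<open>A\<close> is where self-adjointness of
    \<open>M\<close> enters.\<close>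
  have pen: "penrose (A2s \<omega> R \<times> UNIV) (prod_inner \<omega> R) vec_inner A X"
    unfolding penrose_def AX
  proof (intro conjI allI ballI)
    show "range X \<subseteq> A2s \<omega> R \<times> UNIV" by (intro image_subsetI) (simp add: X_def mem_Times_iff BV)
    fix v v' :: "('n, 's) point" assume v: "v \<in> A2s \<omega> R \<times> UNIV" and v': "v' \<in> A2s \<omega> R \<times> UNIV"
    have "prod_inner \<omega> R (X (A v)) v' = cnj (prod_inner \<omega> R v' (B (N (A v))))" by (simp add: prod_inner_cnj X_def)
    also have "\<dots> = vec_inner (N (A v)) (A v')" using v' by (simp add: adj mem_Times_iff cnj_vec_inner)
    also have "\<dots> = vec_inner (N (A v)) (M (N (A v')))" by (simp add: MN)
    also have "\<dots> = vec_inner (M (N (A v))) (N (A v'))" by (simp only: M_sa)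
    also have "\<dots> = prod_inner \<omega> R v (X (A v'))" using v by (simp add: MN adj mem_Times_iff X_def)
    finally show "prod_inner \<omega> R (X (A v)) v' = prod_inner \<omega> R v (X (A v'))" .
  qed simp_all
  have mp: "moore_penrose (A2s \<omega> R \<times> UNIV) (prod_inner \<omega> R) vec_inner A = X"
    unfolding moore_penrose_def
  proof (rule the_equality)
    show "penrose (A2s \<omega> R \<times> UNIV) (prod_inner \<omega> R) vec_inner A X" by (rule pen)
    fix Y assume Y: "penrose (A2s \<omega> R \<times> UNIV) (prod_inner \<omega> R) vec_inner A Y"
    show "Y = X"
    proof (rule penrose_unique[OF Y pen])
      show "a = b" if "\<And>w. vec_inner a w = vec_inner b w" for a b :: "complex ^ 's"
        using that by (rule vec_inner_eqI)
      show "p = q" if "p \<in> A2s \<omega> R \<times> UNIV" "q \<in> A2s \<omega> R \<times> UNIV" 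
        "\<And>r. r \<in> A2s \<omega> R \<times> UNIV \<Longrightarrow> prod_inner \<omega> R p r = prod_inner \<omega> R q r" for p q :: "('n, 's) point"
        using that by (rule prod_inner_nondegenerate)
    qed
  qed
  define u where "u = N (f x)"
  have Mu: "M u = f x" by (simp add: u_def MN)
  have P: "(prod_norm \<omega> R (B u))\<^sup>2 = k * (norm u)\<^sup>2 + (norm (T' u))\<^sup>2"
  proof -
    have "complex_of_real ((prod_norm \<omega> R (B u))\<^sup>2) = of_real (k * (norm u)\<^sup>2 + (norm (T' u))\<^sup>2)"
      unfolding prod_inner_self(1)[OF BV, symmetric] adj[OF BV] M_def[symmetric] by (rule M_pos)
    then show ?thesis unfolding of_real_eq_iff .
  qed
  \<comment> \<open>The squared length of the step is the pairing of \<open>f x\<close> with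
    \<open>u\<close>. With the bound on \<open>norm u\<close> below it yields the factor
    \<open>1 / k\<close>, whose square root is \<open>sqrt a ^ (CARD('n) + 1)\<close>.\<close>
  have le: "(prod_norm \<omega> R (B u))\<^sup>2 \<le> norm (f x) * norm u"
  proof -
    have "(prod_norm \<omega> R (B u))\<^sup>2 = cmod (vec_inner (f x) u)"
      using M_pos[of u] k unfolding Mu P by (simp del: of_real_add)
    then show ?thesis using norm_vec_inner_le[of "f x" u] by simp
  qed
  have "k * (norm u)\<^sup>2 \<le> norm (f x) * norm u" using le P by (smt (verit) zero_le_power2)
  then have "norm u * (k * norm u) \<le> norm u * norm (f x)" by (simp add: power2_eq_square mult_ac)
  then have ku: "k * norm u \<le> norm (f x)"
    by (cases "u = 0") (auto elim: mult_left_le_imp_le)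
  then have nu: "norm u \<le> a ^ (CARD('n) + 1) * norm (f x)" using a by (simp add: k_def field_simps)
  have "(prod_norm \<omega> R (B u))\<^sup>2 \<le> norm (f x) * (a ^ (CARD('n) + 1) * norm (f x))"
    using le mult_left_mono[OF nu norm_ge_zero[of "f x"]] by linarith
  also have "\<dots> = (sqrt a ^ (CARD('n) + 1) * norm (f x))\<^sup>2"
  proof -
    have "a ^ (CARD('n) + 1) = sqrt a ^ (CARD('n) + 1) * sqrt a ^ (CARD('n) + 1)"
      using a by (simp only: power_mult_distrib[symmetric] real_sqrt_mult_self abs_of_pos)
    then show ?thesis by (simp only: power2_eq_square mult_ac)
  qed
  finally have pn: "prod_norm \<omega> R (B u) \<le> sqrt a ^ (CARD('n) + 1) * norm (f x)"
    by (rule power2_le_imp_le) (use a in simp)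
  show ?thesis
  proof (rule that)
    show "moore_penrose (A2s \<omega> R \<times> UNIV) (prod_inner \<omega> R) vec_inner (D_evaluation (f, x)) (f x) = ((\<lambda>z. ?K z *s u), T' u)"
      using mp by (simp add: A_def X_def B_def u_def)
    show "?K x *s u + frechet_derivative f (at x) (T' u) = f x"
      using Mu by (simp add: M_eq Kx T_def)
    show "prod_norm \<omega> R ((\<lambda>z. ?K z *s u), T' u) \<le> sqrt a ^ (CARD('n) + 1) * norm (f x)"
      using pn by (simp add: B_def)
  qed (rule nu)
qed

end

subsection \<open>The constants\<close>

lemma summable_c0: "summable (\<lambda>k. (1 / 2 :: real) ^ (2 ^ k - 1))"
  and c0_le_2: "c0 \<le> 2"
proof -
  have le: "(1 / 2 :: real) ^ (2 ^ k - 1) \<le> (1 / 2) ^ k" for k :: nat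
  proof (rule power_decreasing)
    have "Suc k \<le> 2 ^ k" by (simp add: Suc_leI)
    then show "k \<le> 2 ^ k - 1" by simp
  qed auto
  have g: "summable (\<lambda>k. (1 / 2 :: real) ^ k)" by (simp add: summable_geometric)
  show s: "summable (\<lambda>k. (1 / 2 :: real) ^ (2 ^ k - 1))"
    by (rule summable_comparison_test[OF _ g]) (use le in auto)
  have "c0 \<le> (\<Sum>k. (1 / 2) ^ k)" unfolding c0_def by (rule suminf_le[OF le s g])
  then show "c0 \<le> 2" by (simp add: suminf_geometric)
qed

lemma sum_le_c0: "(\<Sum>j<k. (1 / 2) ^ (2 ^ j - 1)) \<le> c0"
  unfolding c0_def by (rule sum_le_suminf[OF summable_c0]) auto

text \<open>\<open>LEAST\<close> over the reals is meaningful only if a least root exists: the roots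
  in the interval form a nonempty compact set, its minimum is not 0 because the polynomial is 1
  there, and positive roots outside the interval are larger.\<close>

lemma alpha0_le: "alpha0 \<le> 132 / 1000"
proof -
  define p where "p u = (1 - 4 * u + 2 * u\<^sup>2)\<^sup>2 - 2 * u" for u :: real
  define S where "S = {0..132/1000} \<inter> p -` {0}"
  have cont: "continuous_on A p" for A unfolding p_def by (intro continuous_intros)
  \<comment> \<open>The polynomial is 1 at 0 and about -0.007 at 132/1000.\<close>
  have "\<exists>u\<ge>0. u \<le> 132 / 1000 \<and> p u = 0"
    by (rule IVT2'[OF _ _ _ cont]) (simp_all add: p_def power2_eq_square)
  then have ne: "S \<noteq> {}" by (auto simp: S_def)
  have "compact S" unfolding S_def
    by (intro compact_Int_closed compact_Icc closed_vimage cont) simp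
  then obtain u where u: "u \<in> S" "\<And>v. v \<in> S \<Longrightarrow> u \<le> v"
    using compact_attains_inf[OF _ ne] by blast
  have "u \<noteq> 0" using u(1) by (auto simp: S_def p_def)
  then have "0 < u \<and> p u = 0" "u \<le> 132 / 1000" using u(1) by (auto simp: S_def)
  moreover have "u \<le> v" if "0 < v \<and> p v = 0" for v
    using that u(2)[of v] \<open>u \<le> 132 / 1000\<close> by (cases "v \<le> 132 / 1000") (auto simp: S_def)
  ultimately have "alpha0 = u" unfolding alpha0_def p_def by (intro Least_equality) auto
  then show ?thesis using \<open>u \<le> 132 / 1000\<close> by simp
qed

subsection \<open>Series of kernels\<close>

context bergman_ball
begin

lemma bergman_bound:
  assumes "norm (w - \<omega>) / R \<le> r" "r < 1"
  shows "cmod (bergman \<omega> R w z) \<le> 1 / (1 - r) ^ (CARD('n) + 1)"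
  using bk_bound[OF assms, of "CARD('n) + 1" 0 0 z] unfolding bergman_eq_bk[of _ 0] by simp

lemma bergman_has_derivative:
  assumes z: "z \<in> ball \<omega> R" and w: "w \<in> ball \<omega> R"
  shows "(bergman \<omega> R w has_derivative 
    (\<lambda>h. of_nat (CARD('n) + 1) * (vec_inner h (w - \<omega>) / of_real (R\<^sup>2)) / (1 - vec_inner (z - \<omega>) (w - \<omega>) / of_real (R\<^sup>2)) ^ (CARD('n) + 2))) (at z)"
proof (rule has_derivative_transform_within_open[OF _ open_ball z])
  let ?q = "\<lambda>z. 1 - vec_inner (z - \<omega>) (w - \<omega>) / of_real (R\<^sup>2)"
  have nz: "?q z \<noteq> 0"
    using kernel_denominator[OF z, of w] w unfolding ball_ratio by auto
  have "((\<lambda>z. vec_inner z (w - \<omega>) - vec_inner \<omega> (w - \<omega>)) has_derivative (\<lambda>h. vec_inner h (w - \<omega>) - 0)) (at z)"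
    by (intro has_derivative_diff bounded_linear_imp_has_derivative[OF bounded_linear_vec_inner_left] has_derivative_const)
  then have d: "((\<lambda>z. vec_inner (z - \<omega>) (w - \<omega>)) has_derivative (\<lambda>h. vec_inner h (w - \<omega>))) (at z)"
    by (simp add: vec_inner_diff_left)
  have "((\<lambda>c. 1 / (1 - c * (1 / of_real (R\<^sup>2))) ^ (CARD('n) + 1)) has_field_derivative
      of_nat (CARD('n) + 1) * (1 / of_real (R\<^sup>2)) / (?q z) ^ (CARD('n) + 2)) (at (vec_inner (z - \<omega>) (w - \<omega>)))"
    using has_field_derivative_divide_linear_power[OF DERIV_const[of 1], of 1 "vec_inner (z - \<omega>) (w - \<omega>)" "1 / of_real (R\<^sup>2)" "CARD('n) + 1"] nz
    by simp
  from has_derivative_compose[OF d this[unfolded has_field_derivative_def]]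
  show "((\<lambda>z. 1 / ?q z ^ (CARD('n) + 1)) has_derivative 
    (\<lambda>h. of_nat (CARD('n) + 1) * (vec_inner h (w - \<omega>) / of_real (R\<^sup>2)) / ?q z ^ (CARD('n) + 2))) (at z)"
    by (simp add: mult_ac)
qed (simp add: bergman_def)

text \<open>A substitute for completeness: the function parts of the Newton steps add up to such a
  series. Base points in a smaller closed ball make kernels and their derivatives bounded uniformly
  in \<open>z\<close>, so summable coefficients permit termwise differentiation.\<close>

lemma bergman_series_A2:
  fixes W :: "nat \<Rightarrow> complex ^ 'n" and c :: "nat \<Rightarrow> complex"
  assumes W: "\<And>j. norm (W j - \<omega>) / R \<le> r" and r: "r < 1" and c: "summable (\<lambda>j. cmod (c j))"
  shows "(\<lambda>z. \<Sum>j. bergman \<omega> R (W j) z * c j) \<in> A2 \<omega> R"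
    and "summable (\<lambda>j. bergman \<omega> R (W j) z * c j)"
proof -
  let ?n = "CARD('n)"
  define C where "C = 1 / (1 - r) ^ (?n + 1)"
  have Wb: "W j \<in> ball \<omega> R" for j using W[of j] r unfolding ball_ratio by linarith
  have t: "cmod (bergman \<omega> R (W j) z * c j) \<le> C * cmod (c j)" for j z
    unfolding norm_mult C_def by (intro mult_right_mono bergman_bound W r) simp
  have sC: "summable (\<lambda>j. C * cmod (c j))" by (rule summable_mult[OF c])
  show sm: "summable (\<lambda>j. bergman \<omega> R (W j) z * c j)" for z
    by (rule summable_comparison_test[OF _ sC]) (use t in auto)
  define G where "G z = (\<Sum>j. bergman \<omega> R (W j) z * c j)" for z
  have G_bound: "cmod (G z) \<le> (\<Sum>j. C * cmod (c j))" for z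
    unfolding G_def by (rule norm_suminf_le[OF t sC])
  define d where "d j z h = of_nat (?n + 1) * (vec_inner h (W j - \<omega>) / of_real (R\<^sup>2)) / (1 - vec_inner (z - \<omega>) (W j - \<omega>) / of_real (R\<^sup>2)) ^ (?n + 2) * c j" for j z h
  define D where "D = real (?n + 1) / R / (1 - r) ^ (?n + 2)"
  have r1: "r \<ge> 0" using W[of 0] R by (meson divide_nonneg_pos norm_ge_zero order_trans)
  have d_bound: "cmod (d j z h) \<le> D * norm h * cmod (c j)" if z: "z \<in> ball \<omega> R" for j z h
  proof -
    have "cmod (vec_inner h (W j - \<omega>)) \<le> norm h * norm (W j - \<omega>)" by (rule norm_vec_inner_le)
    also have "\<dots> \<le> norm h * R" using W[of j] r R by (intro mult_left_mono) (auto simp: field_simps intro: order_trans[of _ "r * R"])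
    finally have 1: "cmod (vec_inner h (W j - \<omega>) / of_real (R\<^sup>2)) \<le> norm h / R"
      using R by (simp add: norm_divide norm_mult power2_eq_square field_simps)
    have "1 - r \<le> cmod (1 - vec_inner (z - \<omega>) (W j - \<omega>) / of_real (R\<^sup>2))"
      using kernel_denominator[OF z, of "W j"] W[of j] by linarith
    then have 2: "(1 - r) ^ (?n + 2) \<le> cmod ((1 - vec_inner (z - \<omega>) (W j - \<omega>) / of_real (R\<^sup>2)) ^ (?n + 2))"
      unfolding norm_power using r by (intro power_mono) auto
    have "cmod (d j z h) \<le> real (?n + 1) * (norm h / R) / (1 - r) ^ (?n + 2) * cmod (c j)"
      unfolding d_def norm_mult[of _ "c j"] norm_divide[of "of_nat _ * _"] norm_mult[of "of_nat _"] norm_of_nat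
      by (intro mult_right_mono frac_le mult_left_mono 1 2) (use r R in auto)
    then show ?thesis by (simp add: D_def mult_ac)
  qed
  have sD: "summable (\<lambda>j. D * norm h * cmod (c j))" for h :: "complex ^ 'n" by (rule summable_mult[OF c])
  have sd: "summable (\<lambda>j. d j z h)" if "z \<in> ball \<omega> R" for z h
    by (rule summable_comparison_test[OF _ sD[of h]]) (use d_bound[OF that] in auto)
  have D0: "D \<ge> 0" using R r by (simp add: D_def)
  have "analytic_fun_on G (ball \<omega> R)"
    unfolding analytic_fun_on_def complex_linear_iff
  proof (intro ballI exI conjI allI)
    fix z assume z: "z \<in> ball \<omega> R"
    have "\<exists>g. \<forall>z\<in>ball \<omega> R. (\<lambda>j. bergman \<omega> R (W j) z * c j) sums g z \<and> (g has_derivative (\<lambda>h. \<Sum>j. d j z h)) (at z within ball \<omega> R)"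
    proof (rule has_derivative_series[OF convex_ball])
      show "((\<lambda>z. bergman \<omega> R (W j) z * c j) has_derivative d j z) (at z within ball \<omega> R)" if "z \<in> ball \<omega> R" for j z
        unfolding d_def
        by (rule has_derivative_mult_left[OF has_derivative_at_withinI[OF bergman_has_derivative[OF that Wb]]])
      show "\<forall>\<^sub>F m in sequentially. \<forall>z\<in>ball \<omega> R. \<forall>h. norm ((\<Sum>j<m. d j z h) - (\<Sum>j. d j z h)) \<le> e * norm h" if e: "e > 0" for e :: real
      proof -
        \<comment> \<open>This tail depends neither on \<open>z\<close> nor on \<open>h\<close>,
          which gives the uniformity that termwise differentiation requires.\<close>
        have "(\<lambda>m. \<Sum>j. D * cmod (c (j + m))) \<longlonglongrightarrow> 0"
          by (rule suminf_exist_split2[OF summable_mult[OF c]])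
        then have "\<forall>\<^sub>F m in sequentially. (\<Sum>j. D * cmod (c (j + m))) < e" using e by (rule order_tendstoD(2))
        then show ?thesis
        proof eventually_elim
          case (elim m)
          show ?case
          proof (intro ballI allI)
            fix z h assume z: "z \<in> ball \<omega> R"
            have "(\<Sum>j. d j z h) = (\<Sum>j. d (j + m) z h) + (\<Sum>j<m. d j z h)" by (rule suminf_split_initial_segment[OF sd[OF z]])
            then have "norm ((\<Sum>j<m. d j z h) - (\<Sum>j. d j z h)) = norm (\<Sum>j. d (j + m) z h)" by simp
            also have "\<dots> \<le> (\<Sum>j. D * cmod (c (j + m)) * norm h)"
            proof (rule norm_suminf_le)
              show "cmod (d (j + m) z h) \<le> D * cmod (c (j + m)) * norm h" for j
                using d_bound[OF z, of "j + m" h] by (simp add: mult_ac)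
              show "summable (\<lambda>j. D * cmod (c (j + m)) * norm h)"
                by (intro summable_mult2 summable_mult summable_ignore_initial_segment c)
            qed
            also have "\<dots> = (\<Sum>j. D * cmod (c (j + m))) * norm h"
              by (intro suminf_mult2[symmetric] summable_mult summable_ignore_initial_segment c)
            also have "\<dots> \<le> e * norm h" using elim by (intro mult_right_mono) auto
            finally show "norm ((\<Sum>j<m. d j z h) - (\<Sum>j. d j z h)) \<le> e * norm h" .
          qed
        qed
      qed
      show "(\<lambda>j. bergman \<omega> R (W j) z * c j) sums G z" unfolding G_def by (rule summable_sums[OF sm])
    qed (rule z)
    then obtain g where g: "\<And>z. z \<in> ball \<omega> R \<Longrightarrow> (\<lambda>j. bergman \<omega> R (W j) z * c j) sums g z"
       "(g has_derivative (\<lambda>h. \<Sum>j. d j z h)) (at z within ball \<omega> R)"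
      using z by blast
    have gG: "g z = G z" if "z \<in> ball \<omega> R" for z unfolding G_def using g(1)[OF that] by (simp add: sums_iff)
    have "(g has_derivative (\<lambda>h. \<Sum>j. d j z h)) (at z)" using g(2) at_within_open[OF z open_ball] by simp
    from has_derivative_transform_within_open[OF this open_ball z gG]
    show "(G has_derivative (\<lambda>h. \<Sum>j. d j z h)) (at z)" .
    show "(\<Sum>j. d j z (h + h')) = (\<Sum>j. d j z h) + (\<Sum>j. d j z h')" for h h'
      unfolding suminf_add[OF sd[OF z] sd[OF z]] by (simp add: d_def vec_inner_add_left add_divide_distrib algebra_simps)
    show "(\<Sum>j. d j z (b *s h)) = b * (\<Sum>j. d j z h)" for b h
      unfolding suminf_mult[OF sd[OF z], symmetric] by (simp add: d_def vec_inner_smult_left mult_ac)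
  qed
  then have "(\<lambda>z. if z \<in> ball \<omega> R then G z else 0) \<in> A2 \<omega> R" by (rule A2_bounded[OF _ G_bound])
  moreover have "G z = 0" if "z \<notin> ball \<omega> R" for z using that by (simp add: G_def bergman_def)
  then have "(\<lambda>z. if z \<in> ball \<omega> R then G z else 0) = G" by auto
  ultimately show "(\<lambda>z. \<Sum>j. bergman \<omega> R (W j) z * c j) \<in> A2 \<omega> R" by (simp add: G_def[abs_def])
qed

text \<open>Turns uniform convergence of the kernel series into convergence in the norm. By the
  volume normalisation \<open>C\<close> is in fact 1, but its independence of \<open>f\<close> is
  what matters.\<close>

lemma A2s_norm_le_sup:
  obtains C where "C \<ge> 0" "\<And>(f :: complex ^ 'n \<Rightarrow> complex ^ 's) B. f \<in> A2s \<omega> R \<Longrightarrow> (\<And>z. norm (f z) \<le> B) \<Longrightarrow> A2s_norm \<omega> R f \<le> C * B"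
proof
  define C where "C = sqrt (\<kappa> * measure lborel (ball \<omega> R))"
  show "C \<ge> 0" using \<kappa>_pos by (simp add: C_def)
  fix f :: "complex ^ 'n \<Rightarrow> complex ^ 's" and B assume f: "f \<in> A2s \<omega> R" and B: "\<And>z. norm (f z) \<le> B"
  have B0: "B \<ge> 0" using B[of 0] norm_ge_zero order_trans by blast
  have z0: "f z = 0" if "z \<notin> ball \<omega> R" for z
    using A2D(3)[OF A2sD[OF f] that] by (simp add: vec_eq_iff)
  have "(\<integral>z. (norm (f z))\<^sup>2 \<partial>lborel) \<le> (\<integral>z. B\<^sup>2 * indicator (ball \<omega> R) z \<partial>lborel)"
  proof (rule integral_mono)
    show "integrable lborel (\<lambda>z. (norm (f z))\<^sup>2)" by (rule A2s_integrable_square[OF f])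
    show "integrable lborel (\<lambda>z. B\<^sup>2 * indicator (ball \<omega> R) z)"
      using emeasure_lborel_ball_finite[of \<omega> R] by (intro integrable_mult_right) (simp add: integrable_indicator_iff)
    show "(norm (f z))\<^sup>2 \<le> B\<^sup>2 * indicator (ball \<omega> R) z" for z
      using B[of z] z0[of z] by (auto simp: indicator_def power_mono)
  qed
  also have "\<dots> = B\<^sup>2 * measure lborel (ball \<omega> R)" by simp
  finally have "(A2s_norm \<omega> R f)\<^sup>2 \<le> \<kappa> * (B\<^sup>2 * measure lborel (ball \<omega> R))"
    unfolding A2s_norm_sq(1)[OF f] using \<kappa>_pos by simp
  also have "\<dots> = (C * B)\<^sup>2" using \<kappa>_pos by (simp add: C_def power_mult_distrib)
  finally show "A2s_norm \<omega> R f \<le> C * B" by (rule power2_le_imp_le) (use B0 \<open>C \<ge> 0\<close> in simp)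
qed

end

subsection \<open>Convergence of the Newton sequence\<close>

text \<open>\<open>\<beta>\<close> bounds the first Newton step; dividing it by \<open>a\<close>
  lowers the exponent (n + 1)/2 of \<open>a\<close> to (n - 1)/2, so that the left side of
  \<open>small\<close> is that of the second hypothesis. The bound 132/1000 is the one in
  \<open>alpha0_le\<close>.\<close>

locale newton_setup = bergman_ball \<omega> R for \<omega> :: "complex ^ 'n" and R :: real +
  fixes f :: "complex ^ 'n \<Rightarrow> complex ^ 's" and x :: "complex ^ 'n" and a \<beta> N \<Phi> :: real
  assumes f: "f \<in> A2s \<omega> R" and x: "x \<in> ball \<omega> R" and n2: "CARD('n) \<ge> 2"
    and a_eq: "a = 1 - (norm (x - \<omega>) / R)\<^sup>2"
    and \<beta>_eq: "\<beta> = sqrt a ^ (CARD('n) + 1) * norm (f x)"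
    and N_eq: "N = (real CARD('n) + 1) * (real CARD('n) + 2) / 2"
    and \<Phi>_eq: "\<Phi> = A2s_norm \<omega> R f / (R * a)"
    and small: "N * (\<Phi> + 1) * (\<beta> / (R * a)) \<le> 132 / 1000"
begin

text \<open>Since \<open>c0 \<le> 2\<close>, the whole Newton sequence stays in the ball \<open>D\<close>.  There \<open>1 - \<nu>\<^sup>2\<close> varies
  between \<open>amin\<close> and \<open>amax\<close>, where \<open>2 * \<tau> + \<tau>\<^sup>2 \<le> 41 / 20 * \<tau>\<close>.  The constant \<open>37 / 10\<close> in \<open>\<Lambda>\<close> collects all
  losses and is just small enough for \<open>\<Lambda> * \<beta> \<le> 1 / 2\<close>, because \<open>37 / 10 * 132 / 1000 < 1 / 2\<close>.\<close>

definition \<tau> :: real where "\<tau> = 2 * \<beta> / (R * a)"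
definition amin :: real where "amin = a * (1 - (41/20) * \<tau>)"
definition amax :: real where "amax = a * (1 + 2 * \<tau>)"
definition \<sigma> :: real where "\<sigma> = sqrt amin"
definition A :: "complex ^ 'n \<Rightarrow> real" where "A z = 1 - (norm (z - \<omega>) / R)\<^sup>2"
definition D :: "(complex ^ 'n) set" where "D = cball x (2 * \<beta>)"
definition \<Lambda> :: real where "\<Lambda> = (37/10) * N * (\<Phi> + 1) / (R * a)"

lemma nu: "0 \<le> norm (x - \<omega>) / R" "norm (x - \<omega>) / R < 1"
  using x R unfolding ball_ratio by auto

lemma a_bounds: "0 < a" "a \<le> 1"
  using nu unfolding a_eq by (simp_all add: power_less_one_iff abs_square_less_1)

lemma \<beta>_nonneg: "\<beta> \<ge> 0" using a_bounds by (simp add: \<beta>_eq)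
lemma \<Phi>_nonneg: "\<Phi> \<ge> 0" using a_bounds R by (simp add: \<Phi>_eq A2s_norm_sq f)

text \<open>In dimension 2 the value is 3 * 4 / 2. The size of \<open>N\<close> is what makes the
  displacement \<open>\<tau>\<close> small.\<close>

lemma N_ge_6: "N \<ge> 6"
proof -
  have "3 * 4 \<le> (real CARD('n) + 1) * (real CARD('n) + 2)" using n2 by (intro mult_mono) auto
  then show ?thesis by (simp add: N_eq)
qed

lemma \<tau>_nonneg: "\<tau> \<ge> 0" using \<beta>_nonneg a_bounds R by (simp add: \<tau>_def)

text \<open>\<open>\<tau>\<close> contains the factor 2 of the radius of \<open>D\<close>, hence 264
  = 2 * 132; the nonnegative \<open>\<Phi>\<close> is dropped.\<close>

lemma N_times_\<tau>_le: "N * \<tau> \<le> 264 / 1000"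
proof -
  have "N * (0 + 1) * (\<beta> / (R * a)) \<le> N * (\<Phi> + 1) * (\<beta> / (R * a))"
    using N_ge_6 \<Phi>_nonneg \<beta>_nonneg a_bounds R by (intro mult_right_mono mult_left_mono) auto
  moreover have "N * \<tau> = 2 * (N * (0 + 1) * (\<beta> / (R * a)))" by (simp add: \<tau>_def)
  ultimately show ?thesis using small by linarith
qed

lemma \<tau>_le: "\<tau> \<le> 44 / 1000"
proof -
  have "6 * \<tau> \<le> N * \<tau>" using N_ge_6 \<tau>_nonneg by (rule mult_right_mono)
  then show ?thesis using N_times_\<tau>_le by simp
qed

text \<open>The power \<open>CARD('n) + 1\<close> of the weight occurs below, so
  \<open>\<tau>\<close> must be small relative to the dimension. The second factor of
  \<open>N\<close>, at least 4, is traded for the numerical gain.\<close>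

lemma n_times_\<tau>_le: "(real CARD('n) + 1) * \<tau> \<le> 132 / 1000"
proof -
  have "4 * ((real CARD('n) + 1) * \<tau>) \<le> (real CARD('n) + 2) * ((real CARD('n) + 1) * \<tau>)"
    using n2 \<tau>_nonneg by (intro mult_right_mono) auto
  also have "\<dots> = 2 * (N * \<tau>)" by (simp add: N_eq)
  finally show ?thesis using N_times_\<tau>_le by linarith
qed

lemma amin_pos: "amin > 0" using a_bounds \<tau>_le by (simp add: amin_def)
lemma amax_pos: "amax > 0" using a_bounds \<tau>_nonneg by (simp add: amax_def)
lemma \<sigma>_pos: "\<sigma> > 0" using amin_pos by (simp add: \<sigma>_def)
lemma \<sigma>_sq: "\<sigma>\<^sup>2 = amin" using amin_pos by (simp add: \<sigma>_def)

lemma A_bounds: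
  assumes "z \<in> D"
  shows "amin \<le> A z" "A z \<le> amax" "A z \<le> 1"
proof -
  define s where "s = norm (z - \<omega>) / R"
  define v where "v = norm (x - \<omega>) / R"
  have v: "0 \<le> v" "v \<le> 1" "a = 1 - v\<^sup>2" using nu a_eq by (auto simp: v_def)
  have "\<bar>norm (z - \<omega>) - norm (x - \<omega>)\<bar> \<le> norm (z - x)"
    using norm_triangle_ineq3[of "z - \<omega>" "x - \<omega>"] by simp
  also have "\<dots> \<le> 2 * \<beta>" using assms by (simp add: D_def dist_norm norm_minus_commute)
  finally have "\<bar>norm (z - \<omega>) - norm (x - \<omega>)\<bar> / R \<le> 2 * \<beta> / R" using R by (simp add: divide_right_mono)
  moreover have "\<bar>norm (z - \<omega>) - norm (x - \<omega>)\<bar> / R = \<bar>s - v\<bar>"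
    using R by (simp add: s_def v_def abs_divide flip: diff_divide_distrib)
  moreover have "2 * \<beta> / R = \<tau> * a" using a_bounds R by (simp add: \<tau>_def)
  ultimately have sv: "\<bar>s - v\<bar> \<le> \<tau> * a" by simp
  have \<tau>a: "0 \<le> \<tau> * a" using \<tau>_nonneg a_bounds by simp
  have s0: "0 \<le> s" using R by (simp add: s_def)
  have "s\<^sup>2 \<le> (v + \<tau> * a)\<^sup>2" using sv s0 by (intro power_mono) auto
  also have "\<dots> = v\<^sup>2 + 2 * (v * (\<tau> * a)) + \<tau> * a * (\<tau> * a)" by (simp add: power2_eq_square algebra_simps)
  \<comment> \<open>Here \<open>v \<le> 1\<close>, and in the quadratic term one factor
    \<open>\<tau> * a\<close> is at most 1/20: 2 + 1/20 = 41/20.\<close>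
  also have "\<dots> \<le> v\<^sup>2 + 2 * (1 * (\<tau> * a)) + (1/20) * 1 * (\<tau> * a)"
    using v \<tau>a \<tau>_le a_bounds \<tau>_nonneg by (intro add_mono mult_left_mono mult_right_mono mult_mono order_refl) auto
  also have "\<dots> = 1 - amin" using v by (simp add: amin_def algebra_simps)
  finally show "amin \<le> A z" by (simp add: A_def s_def)
  \<comment> \<open>For the upper bound the tangent lies below the square, so there is no quadratic
    loss; hence 2 and not 41/20 in \<open>amax\<close>.\<close>
  have "v\<^sup>2 - 2 * (\<tau> * a) \<le> v\<^sup>2 - 2 * (v * (\<tau> * a))" using mult_right_mono[OF v(2) \<tau>a] by simp
  also have "\<dots> \<le> v\<^sup>2 + 2 * (v * (s - v))"
  proof -
    have "v * (- (\<tau> * a)) \<le> v * (s - v)" using sv v(1) by (intro mult_left_mono) auto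
    then have "- (v * (\<tau> * a)) \<le> v * (s - v)" by (simp only: mult_minus_right)
    then show ?thesis by linarith
  qed
  also have "\<dots> \<le> s\<^sup>2" using zero_le_power2[of "s - v"] by (simp add: power2_eq_square algebra_simps)
  finally have "v\<^sup>2 - 2 * (\<tau> * a) \<le> s\<^sup>2" .
  moreover have "amax = a + 2 * (\<tau> * a)" "A z = 1 - s\<^sup>2" by (simp_all add: amax_def A_def s_def algebra_simps)
  ultimately show "A z \<le> amax" using v(3) by linarith
  show "A z \<le> 1" by (simp add: A_def)
qed

lemma D_ball: "z \<in> D \<Longrightarrow> z \<in> ball \<omega> R"
proof -
  assume "z \<in> D"
  then have "(norm (z - \<omega>) / R)\<^sup>2 < 1" using A_bounds(1)[of z] amin_pos by (simp add: A_def)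
  then have "\<bar>norm (z - \<omega>) / R\<bar> < 1" by (simp only: abs_square_less_1)
  then show "z \<in> ball \<omega> R" unfolding ball_ratio by linarith
qed

text \<open>Lets the weight at a new iterate be replaced by the uniform \<open>\<sigma>\<close>. The
  squares are compared, through \<open>amin / amax\<close>, with Bernoulli's inequality for the
  power.\<close>

lemma A_ratio:
  assumes "z \<in> D"
  shows "sqrt (A z) ^ (CARD('n) + 1) \<le> 3 / 2 * \<sigma> ^ (CARD('n) + 1)"
proof (rule power2_le_imp_le)
  let ?m = "CARD('n) + 1"
  have A0: "A z \<ge> 0" using A_bounds(1)[OF assms] amin_pos by linarith
  \<comment> \<open>81/20 is 41/20 + 2, the first-order loss in the quotient
    \<open>amin / amax\<close>.\<close>
  have "(1 - (81/20) * \<tau>) * (1 + 2 * \<tau>) \<le> 1 - (41/20) * \<tau>"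
    using mult_nonneg_nonneg[OF \<tau>_nonneg \<tau>_nonneg] by (simp add: algebra_simps)
  then have p: "1 - (81/20) * \<tau> \<le> (1 - (41/20) * \<tau>) / (1 + 2 * \<tau>)" using \<tau>_nonneg by (simp add: field_simps)
  have "real ?m * (- (81/20) * \<tau>) = - (81/20) * ((real CARD('n) + 1) * \<tau>)" by (simp add: algebra_simps)
  \<comment> \<open>4.05 * 0.132 is below 5/9; the reciprocal 9/4 is the square of the 3/2 in the
    claim.\<close>
  then have "4 / 9 \<le> 1 + real ?m * (- (81/20) * \<tau>)" using n_times_\<tau>_le by linarith
  also have "\<dots> \<le> (1 + - (81/20) * \<tau>) ^ ?m" by (rule Bernoulli_inequality) (use \<tau>_le in simp)
  also have "\<dots> \<le> ((1 - (41/20) * \<tau>) / (1 + 2 * \<tau>)) ^ ?m" using p \<tau>_le by (intro power_mono) auto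
  also have "\<dots> = (amin / amax) ^ ?m" using a_bounds by (simp add: amin_def amax_def)
  finally have "amax ^ ?m \<le> 9 / 4 * amin ^ ?m" using amax_pos by (simp add: power_divide field_simps)
  have "(sqrt (A z) ^ ?m)\<^sup>2 = A z ^ ?m" using A0 by (metis power_even_eq power_mult mult.commute real_sqrt_pow2)
  also have "\<dots> \<le> amax ^ ?m" by (intro power_mono A_bounds(2) assms A0)
  also have "\<dots> \<le> 9 / 4 * amin ^ ?m" by fact
  also have "\<dots> = (3 / 2 * \<sigma> ^ ?m)\<^sup>2" unfolding power_mult_distrib \<sigma>_sq[symmetric]
    by (simp add: power2_eq_square power_mult_distrib)
  finally show "(sqrt (A z) ^ ?m)\<^sup>2 \<le> (3 / 2 * \<sigma> ^ ?m)\<^sup>2" .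
qed (use \<sigma>_pos in simp)

lemma \<Lambda>_\<beta>: "\<Lambda> * \<beta> \<le> 1 / 2"
proof -
  have "\<Lambda> * \<beta> = (37/10) * (N * (\<Phi> + 1) * (\<beta> / (R * a)))" by (simp add: \<Lambda>_def)
  then show ?thesis using small by linarith
qed

lemma \<Lambda>_nonneg: "\<Lambda> \<ge> 0" using N_ge_6 \<Phi>_nonneg R a_bounds by (simp add: \<Lambda>_def)

lemma segment_in_D:
  assumes "z \<in> D" "z + y \<in> D" "0 \<le> t" "t \<le> 1"
  shows "z + t *\<^sub>R y \<in> D"
proof -
  have "(1 - t) *\<^sub>R z + t *\<^sub>R (z + y) \<in> D"
    using assms by (intro convexD_alt[OF convex_cball[of x "2 * \<beta>"], folded D_def]) auto
  then show ?thesis by (simp add: algebra_simps)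
qed

lemma segment_bounds:
  assumes "z \<in> D" "z + y \<in> D" "0 \<le> t" "t \<le> 1"
  shows "z + t *\<^sub>R y \<in> ball \<omega> R \<and> \<sigma>\<^sup>2 \<le> 1 - (norm (z + t *\<^sub>R y - \<omega>) / R)\<^sup>2"
  using D_ball[OF segment_in_D[OF assms]] A_bounds(1)[OF segment_in_D[OF assms]] by (simp add: \<sigma>_sq A_def)

text \<open>Replaces the square root of \<open>2 * N\<close> by \<open>N\<close>, so that both
  contributions to the residual share this factor.\<close>

lemma sqrt_2N_le: "sqrt ((real CARD('n) + 1) * (real CARD('n) + 2)) \<le> N"
proof (rule real_le_lsqrt)
  have "(real CARD('n) + 1) * (real CARD('n) + 2) = 2 * N" by (simp add: N_eq)
  also have "\<dots> \<le> N * N" using N_ge_6 by (intro mult_right_mono) auto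
  finally show "(real CARD('n) + 1) * (real CARD('n) + 2) \<le> N\<^sup>2" by (simp add: power2_eq_square)
qed (use N_ge_6 in simp)

text \<open>By the linear equation \<open>eq\<close>, the value after the step is the Taylor
  remainder of \<open>F\<close> minus the increment of \<open>h\<close>. Both are quadratic in the
  step: the first in \<open>norm y\<close>, the second as the norm of \<open>h\<close> times
  \<open>norm y\<close>.\<close>

lemma residual_bound:
  assumes F: "F \<in> A2s \<omega> R" and h: "h \<in> A2s \<omega> R" and F_norm: "A2s_norm \<omega> R F \<le> A2s_norm \<omega> R f + 2 * \<beta>"
    and z: "z \<in> D" and zy: "z - y \<in> D"
    and eq: "h z + frechet_derivative F (at z) y = F z" and s: "prod_norm \<omega> R (h, y) \<le> s"
  shows "sqrt (A (z - y)) ^ (CARD('n) + 1) * norm ((F - h) (z - y)) \<le> \<Lambda> * s\<^sup>2"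
proof -
  let ?n = "CARD('n)" and ?q = "1 - (41/20) * \<tau>"
  define H Y where "H = A2s_norm \<omega> R h" and "Y = norm y"
  have H0: "H \<ge> 0" and Y0: "Y \<ge> 0" by (simp_all add: H_def Y_def A2s_norm_sq h)
  have s0: "s \<ge> 0" using s prod_norm_nonneg[of "(h, y)"] h by simp
  have "H\<^sup>2 + Y\<^sup>2 \<le> s\<^sup>2"
  proof -
    have "(prod_norm \<omega> R (h, y))\<^sup>2 \<le> s\<^sup>2" using s prod_norm_nonneg[of "(h, y)"] h by (intro power_mono) auto
    then show ?thesis using prod_inner_self(2)[of "(h, y)"] h by (simp add: norm_Pair H_def Y_def)
  qed
  \<comment> \<open>The two parts of the step share the length \<open>s\<close>, so the mixed term
    gains a factor 1/2.\<close>
  moreover have "0 \<le> H\<^sup>2" "2 * (H * Y) \<le> H\<^sup>2 + Y\<^sup>2"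
    using zero_le_power2[of "H - Y"] by (simp_all add: power2_diff)
  ultimately have Ys: "Y\<^sup>2 \<le> s\<^sup>2" and HYs: "H * Y \<le> s\<^sup>2 / 2" by linarith+
  have seg: "z + t *\<^sub>R (- y) \<in> ball \<omega> R \<and> \<sigma>\<^sup>2 \<le> 1 - (norm (z + t *\<^sub>R (- y) - \<omega>) / R)\<^sup>2" if "0 \<le> t" "t \<le> 1" for t
    by (rule segment_bounds) (use z zy that in auto)
  have Dm: "frechet_derivative F (at z) (- y) = - frechet_derivative F (at z) y"
    using A2s_has_derivative(2)[OF F D_ball[OF z], of "-1" y] by (simp add: vec_eq_iff)
  have "(F - h) (z - y) = (F (z + - y) - F z - frechet_derivative F (at z) (- y)) - (h (z + - y) - h z)"
    using eq by (simp add: Dm algebra_simps)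
  then have "norm ((F - h) (z - y)) \<le> norm (F (z + - y) - F z - frechet_derivative F (at z) (- y)) + norm (h (z + - y) - h z)"
    by (simp only: norm_triangle_ineq4)
  also have "\<dots> \<le> (real ?n + 1) * (real ?n + 2) * A2s_norm \<omega> R F * (norm (- y))\<^sup>2 / (R\<^sup>2 * \<sigma> ^ (?n + 5)) + 
      sqrt ((real ?n + 1) * (real ?n + 2)) * A2s_norm \<omega> R h * norm (- y) / (R * \<sigma> ^ (?n + 3))"
    by (intro add_mono A2s_taylor_bound A2s_increment_bound F h \<sigma>_pos seg)
  also have "\<dots> = (2 * N * A2s_norm \<omega> R F * Y\<^sup>2 / (R\<^sup>2 * amin\<^sup>2) + sqrt ((real ?n + 1) * (real ?n + 2)) * (H * Y) / (R * amin)) / \<sigma> ^ (?n + 1)"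
  proof -
    have "\<sigma> ^ (?n + 5) = amin\<^sup>2 * \<sigma> ^ (?n + 1)" "\<sigma> ^ (?n + 3) = amin * \<sigma> ^ (?n + 1)"
      by (simp_all add: \<sigma>_sq[symmetric] power_add flip: power_mult) (simp_all add: eval_nat_numeral)
    then show ?thesis by (simp add: N_eq H_def Y_def add_divide_distrib mult_ac)
  qed
  finally have "norm ((F - h) (z - y)) \<le> (2 * N * A2s_norm \<omega> R F * Y\<^sup>2 / (R\<^sup>2 * amin\<^sup>2) + sqrt ((real ?n + 1) * (real ?n + 2)) * (H * Y) / (R * amin)) / \<sigma> ^ (?n + 1)" .
  also have "\<dots> \<le> (2 * N * (R * a * (\<Phi> + \<tau>)) * s\<^sup>2 / (R\<^sup>2 * amin\<^sup>2) + N * (s\<^sup>2 / 2) / (R * amin)) / \<sigma> ^ (?n + 1)"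
  proof -
    have "A2s_norm \<omega> R F \<le> R * a * (\<Phi> + \<tau>)"
    proof -
      have "R * a * (\<Phi> + \<tau>) = A2s_norm \<omega> R f + 2 * \<beta>"
        unfolding \<Phi>_eq \<tau>_def distrib_left using R a_bounds by simp
      then show ?thesis using F_norm by simp
    qed
    then show ?thesis
      using Ys HYs H0 Y0 sqrt_2N_le N_ge_6 R amin_pos \<sigma>_pos A2s_norm_sq(3)[OF F]
      by (intro divide_right_mono add_mono mult_mono mult_left_mono) auto
  qed
  finally have res: "norm ((F - h) (z - y)) \<le> (2 * N * (R * a * (\<Phi> + \<tau>)) * s\<^sup>2 / (R\<^sup>2 * amin\<^sup>2) + N * (s\<^sup>2 / 2) / (R * amin)) / \<sigma> ^ (?n + 1)" .
  have "sqrt (A (z - y)) ^ (?n + 1) * norm ((F - h) (z - y)) \<le> (3 / 2 * \<sigma> ^ (?n + 1)) * ((2 * N * (R * a * (\<Phi> + \<tau>)) * s\<^sup>2 / (R\<^sup>2 * amin\<^sup>2) + N * (s\<^sup>2 / 2) / (R * amin)) / \<sigma> ^ (?n + 1))"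
    by (intro mult_mono A_ratio zy res) (use \<sigma>_pos in auto)
  also have "\<dots> = 3 / 2 * (2 * N * (R * a * (\<Phi> + \<tau>)) * s\<^sup>2 / (R\<^sup>2 * amin\<^sup>2) + N * (s\<^sup>2 / 2) / (R * amin))"
    using \<sigma>_pos by simp
  \<comment> \<open>\<open>amin\<close> is \<open>a * ?q\<close>. The 3 is the 3/2 of
    \<open>A_ratio\<close> times 2, and 3/4 is 3/2 times the 1/2 of the mixed term.\<close>
  also have "\<dots> = (N * s\<^sup>2 / (R * a)) * (3 * (\<Phi> + \<tau>) / ?q\<^sup>2 + (3 / 4) / ?q)"
    using R a_bounds \<tau>_le by (simp add: amin_def divide_simps power2_eq_square) (simp add: algebra_simps)
  also have "\<dots> \<le> (N * s\<^sup>2 / (R * a)) * ((37/10) * (\<Phi> + 1))"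
  proof (rule mult_left_mono)
    \<comment> \<open>This is \<open>1 - (41/20) * (44/1000)\<close>, the value of \<open>?q\<close>
      at the largest possible \<open>\<tau>\<close>.\<close>
    have q: "(9098/10000) \<le> ?q" using \<tau>_le by simp
    have q2: "(9098/10000)\<^sup>2 \<le> ?q\<^sup>2" by (rule power_mono[OF q]) simp
    have "3 * (\<Phi> + \<tau>) / ?q\<^sup>2 \<le> 3 * (\<Phi> + (44/1000)) / (9098/10000)\<^sup>2"
      using q2 \<Phi>_nonneg \<tau>_nonneg \<tau>_le by (intro frac_le) auto
    moreover have "(3 / 4) / ?q \<le> (3 / 4) / (9098/10000)" using q by (intro divide_left_mono) auto
    \<comment> \<open>The coefficient of \<open>\<Phi>\<close> decides: it is about 3.62, just below
      3.7, while the constant term is only about 0.98.\<close>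
    moreover have "3 * (\<Phi> + (44/1000)) / (9098/10000)\<^sup>2 + (3 / 4) / (9098/10000) \<le> (37/10) * (\<Phi> + 1)"
      using \<Phi>_nonneg by (simp add: power2_eq_square field_simps)
    ultimately show "3 * (\<Phi> + \<tau>) / ?q\<^sup>2 + (3 / 4) / ?q \<le> (37/10) * (\<Phi> + 1)" by linarith
  qed (use N_ge_6 R a_bounds in simp)
  also have "\<dots> = \<Lambda> * s\<^sup>2" by (simp add: \<Lambda>_def mult_ac)
  finally show ?thesis .
qed

section \<open>The iterates and their inductive invariant\<close>

definition p :: "nat \<Rightarrow> ('n, 's) point" where "p k = newton_seq \<omega> R (f, x) k"
text \<open>The bound of \<open>newton_step\<close> for the length of step \<open>k\<close>, with
  the weight at the current point; \<open>B 0\<close> is \<open>\<beta>\<close>.\<close>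

definition B :: "nat \<Rightarrow> real" where "B k = sqrt (A (snd (p k))) ^ (CARD('n) + 1) * norm (fst (p k) (snd (p k)))"

text \<open>The clauses need each other: decay of \<open>B\<close> limits the displacement, and
  small displacement keeps the iterates in \<open>D\<close>, where \<open>\<Lambda>\<close> is
  valid. Partial sums of \<open>c0\<close> are recorded because they can be continued by one
  term.\<close>

definition newton_inv :: "nat \<Rightarrow> bool" where
  "newton_inv k \<longleftrightarrow> fst (p k) \<in> A2s \<omega> R \<and> B k \<le> (1 / 2) ^ (2 ^ k - 1) * \<beta> \<and>
     prod_norm \<omega> R (p k - p 0) \<le> (\<Sum>j<k. (1 / 2) ^ (2 ^ j - 1)) * \<beta>"

lemma p0: "p 0 = (f, x)" by (simp add: p_def)

lemma near_p0:
  assumes q: "fst q \<in> A2s \<omega> R" and le: "prod_norm \<omega> R (q - p 0) \<le> c0 * \<beta>"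
  shows "snd q \<in> D" "A2s_norm \<omega> R (fst q) \<le> A2s_norm \<omega> R f + 2 * \<beta>"
proof -
  have d: "fst (q - p 0) \<in> A2s \<omega> R" using A2s_minus q f by (simp add: p0)
  have le2: "prod_norm \<omega> R (q - p 0) \<le> 2 * \<beta>"
    using le mult_right_mono[OF c0_le_2 \<beta>_nonneg] by linarith
  show "snd q \<in> D" using norm_snd_le_prod_norm[OF d] le2 by (simp add: D_def dist_norm norm_minus_commute p0)
  \<comment> \<open>The triangle inequality is stated for differences, hence the double
    subtraction.\<close>
  have "fst q = f - (f - fst q)" by (simp add: fun_eq_iff)
  then have "A2s_norm \<omega> R (fst q) = A2s_norm \<omega> R (f - (f - fst q))" by (rule arg_cong)
  also have "\<dots> \<le> A2s_norm \<omega> R f + A2s_norm \<omega> R (f - fst q)"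
    by (intro A2s_norm_triangle A2s_minus f q)
  also have "A2s_norm \<omega> R (f - fst q) = A2s_norm \<omega> R (fst (q - p 0))"
    by (simp add: p0 A2s_norm_minus_commute[of f])
  also have "\<dots> \<le> 2 * \<beta>" using A2s_norm_le_prod_norm[OF d] le2 by linarith
  finally show "A2s_norm \<omega> R (fst q) \<le> A2s_norm \<omega> R f + 2 * \<beta>" by simp
qed

lemma newton_inv_near:
  assumes "newton_inv k"
  shows "snd (p k) \<in> D" "A2s_norm \<omega> R (fst (p k)) \<le> A2s_norm \<omega> R f + 2 * \<beta>" "prod_norm \<omega> R (p k - p 0) \<le> c0 * \<beta>"
proof -
  show le: "prod_norm \<omega> R (p k - p 0) \<le> c0 * \<beta>"
    using assms mult_right_mono[OF sum_le_c0[of k] \<beta>_nonneg] unfolding newton_inv_def by linarith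
  show "snd (p k) \<in> D" "A2s_norm \<omega> R (fst (p k)) \<le> A2s_norm \<omega> R f + 2 * \<beta>"
    using near_p0[OF _ le] assms unfolding newton_inv_def by auto
qed

text \<open>The bound on \<open>u\<close>, with a power of the fixed \<open>\<sigma>\<close>, makes
  the kernel coefficients summable later.\<close>

lemma newton_step_k:
  assumes "newton_inv k"
  obtains u y where "p (Suc k) = p k - ((\<lambda>z. bergman \<omega> R (snd (p k)) z *s u), y)"
    "bergman \<omega> R (snd (p k)) (snd (p k)) *s u + frechet_derivative (fst (p k)) (at (snd (p k))) y = fst (p k) (snd (p k))"
    "prod_norm \<omega> R ((\<lambda>z. bergman \<omega> R (snd (p k)) z *s u), y) \<le> B k"
    "norm u \<le> B k / \<sigma> ^ (CARD('n) + 1)"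
proof -
  have F: "fst (p k) \<in> A2s \<omega> R" using assms by (simp add: newton_inv_def)
  have X: "snd (p k) \<in> D" by (rule newton_inv_near(1)[OF assms])
  from newton_step[OF F D_ball[OF X]] obtain u y where uy:
    "moore_penrose (A2s \<omega> R \<times> UNIV) (prod_inner \<omega> R) vec_inner (D_evaluation (p k)) (fst (p k) (snd (p k))) = ((\<lambda>z. bergman \<omega> R (snd (p k)) z *s u), y)"
    "bergman \<omega> R (snd (p k)) (snd (p k)) *s u + frechet_derivative (fst (p k)) (at (snd (p k))) y = fst (p k) (snd (p k))"
    "prod_norm \<omega> R ((\<lambda>z. bergman \<omega> R (snd (p k)) z *s u), y) \<le> B k"
    "norm u \<le> A (snd (p k)) ^ (CARD('n) + 1) * norm (fst (p k) (snd (p k)))"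
    unfolding B_def A_def prod.collapse by metis
  have A: "amin \<le> A (snd (p k))" "A (snd (p k)) \<le> 1" using A_bounds[OF X] by auto
  have A0: "A (snd (p k)) > 0" using A amin_pos by linarith
  \<comment> \<open>The gain from the power of the weight is given up, since a constant multiple of
    \<open>B k\<close> is enough.\<close>
  have "norm u \<le> 1 * norm (fst (p k) (snd (p k)))"
    using uy(4) A A0 by (elim order_trans) (intro mult_right_mono power_le_one; simp)
  also have "\<dots> \<le> B k / \<sigma> ^ (CARD('n) + 1)"
  proof -
    have "\<sigma> ^ (CARD('n) + 1) \<le> sqrt (A (snd (p k))) ^ (CARD('n) + 1)"
      unfolding \<sigma>_def using A(1) amin_pos by (intro power_mono real_sqrt_le_mono) auto
    then show ?thesis using \<sigma>_pos by (simp add: B_def field_simps mult_right_mono del: power_Suc)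
  qed
  finally have "norm u \<le> B k / \<sigma> ^ (CARD('n) + 1)" .
  moreover have "p (Suc k) = p k - ((\<lambda>z. bergman \<omega> R (snd (p k)) z *s u), y)"
    using uy(1) by (simp add: p_def evaluation_def)
  ultimately show ?thesis using that uy by blast
qed

lemma newton_inv: "newton_inv k"
proof (induction k)
  case 0
  have "prod_norm \<omega> R (p 0 - p 0) = 0"
  proof -
    have "A2s_norm \<omega> R (f - f) = 0"
      by (simp add: A2s_norm_def A2s_inner_def A2_inner_def set_lebesgue_integral_def)
    then show ?thesis using prod_inner_self(2)[of "p 0 - p 0"] A2s_minus[OF f f] by (simp add: p0 norm_Pair)
  qed
  moreover have "B 0 = \<beta>"
    unfolding B_def p0 \<beta>_eq A_def fst_conv snd_conv a_eq[symmetric] ..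
  ultimately show ?case unfolding newton_inv_def by (simp add: p0 f)
next
  case (Suc k)
  from newton_step_k[OF Suc] obtain u y where uy: "p (Suc k) = p k - ((\<lambda>z. bergman \<omega> R (snd (p k)) z *s u), y)"
    "bergman \<omega> R (snd (p k)) (snd (p k)) *s u + frechet_derivative (fst (p k)) (at (snd (p k))) y = fst (p k) (snd (p k))"
    "prod_norm \<omega> R ((\<lambda>z. bergman \<omega> R (snd (p k)) z *s u), y) \<le> B k" by metis
  let ?h = "\<lambda>z. bergman \<omega> R (snd (p k)) z *s u"
  have F: "fst (p k) \<in> A2s \<omega> R" using Suc by (simp add: newton_inv_def)
  have X: "snd (p k) \<in> D" by (rule newton_inv_near(1)[OF Suc])
  have h: "?h \<in> A2s \<omega> R" by (rule A2s_smult[OF bergman_in_A2[OF D_ball[OF X]]])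
  have F': "fst (p (Suc k)) \<in> A2s \<omega> R" using A2s_minus[OF F h] by (simp add: uy(1))
  have Bk: "B k \<le> (1 / 2) ^ (2 ^ k - 1) * \<beta>" using Suc by (simp add: newton_inv_def)
  have B0: "B k \<ge> 0" using uy(3) prod_norm_nonneg[of "(?h, y)"] h by simp
  have pk: "p k - p (Suc k) = (?h, y)" by (simp add: uy(1) prod_eq_iff fun_eq_iff)
  \<comment> \<open>The displacement comes first: it uses only the old bound on \<open>B k\<close>,
    and it places the new point in \<open>D\<close>, which \<open>residual_bound\<close>
    presupposes.\<close>
  have "prod_norm \<omega> R (p (Suc k) - p 0) \<le> prod_norm \<omega> R (p (Suc k) - p k) + prod_norm \<omega> R (p k - p 0)"
    by (rule prod_norm_dist_triangle) (simp_all add: F F' p0 f)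
  also have "\<dots> \<le> B k + (\<Sum>j<k. (1 / 2) ^ (2 ^ j - 1)) * \<beta>"
    using uy(3) Suc by (simp add: prod_norm_minus_commute[of "p (Suc k)"] pk newton_inv_def add_mono)
  also have "\<dots> \<le> (\<Sum>j<Suc k. (1 / 2) ^ (2 ^ j - 1)) * \<beta>" using Bk by (simp add: distrib_right)
  finally have dist: "prod_norm \<omega> R (p (Suc k) - p 0) \<le> (\<Sum>j<Suc k. (1 / 2) ^ (2 ^ j - 1)) * \<beta>" .
  then have "prod_norm \<omega> R (p (Suc k) - p 0) \<le> c0 * \<beta>"
    using mult_right_mono[OF sum_le_c0[of "Suc k"] \<beta>_nonneg] by linarith
  from near_p0(1)[OF F' this] have X': "snd (p k) - y \<in> D" by (simp add: uy(1))
  have "B (Suc k) \<le> \<Lambda> * (B k)\<^sup>2"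
    using residual_bound[OF F h newton_inv_near(2)[OF Suc] X X' uy(2) uy(3)] by (simp add: B_def uy(1))
  also have "\<dots> \<le> \<Lambda> * ((1 / 2) ^ (2 ^ k - 1) * \<beta>)\<^sup>2" using B0 Bk \<Lambda>_nonneg by (intro mult_left_mono power_mono)
  \<comment> \<open>The factor \<open>\<Lambda> * \<beta>\<close>, at most 1/2, raises the exponent
    \<open>2 * (2 ^ k - 1)\<close> by one to \<open>2 ^ Suc k - 1\<close>.\<close>
  also have "\<dots> = (\<Lambda> * \<beta>) * ((1 / 2) ^ (2 * (2 ^ k - 1)) * \<beta>)" 
  proof -
    have e: "((1 / 2 :: real) ^ e)\<^sup>2 = (1 / 2) ^ (2 * e)" for e :: nat by (simp only: power_mult[symmetric] mult.commute)
    show ?thesis unfolding power_mult_distrib e by (simp only: power2_eq_square mult_ac)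
  qed
  also have "\<dots> \<le> (1 / 2) * ((1 / 2) ^ (2 * (2 ^ k - 1)) * \<beta>)" by (intro mult_right_mono \<Lambda>_\<beta>) (simp add: \<beta>_nonneg)
  also have "\<dots> = (1 / 2) ^ (2 ^ Suc k - 1) * \<beta>"
  proof -
    have "2 * m - 1 = Suc (2 * (m - 1))" if "1 \<le> m" for m :: nat using that by arith
    from this[of "2 ^ k"] have "2 ^ Suc k - (1::nat) = Suc (2 * (2 ^ k - 1))" by simp
    then show ?thesis by (simp only: power_Suc mult.assoc)
  qed
  finally show ?case using dist F' by (simp add: newton_inv_def)
qed

end

section \<open>The limit of the iteration and the rate of convergence\<close>

context newton_setup
begin

lemma p_fst: "fst (p k) \<in> A2s \<omega> R"
  using newton_inv[of k] by (simp add: newton_inv_def)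

lemma p_snd: "snd (p k) \<in> D"
  by (rule newton_inv_near(1)[OF newton_inv])

lemma B_nonneg: "B k \<ge> 0"
  unfolding B_def using A_bounds(1)[OF p_snd[of k]] amin_pos by (intro mult_nonneg_nonneg zero_le_power) auto

lemma prod_norm_step: "prod_norm \<omega> R (p k - p (Suc k)) \<le> B k"
proof -
  from newton_step_k[OF newton_inv[of k]] obtain u y where uy: 
    "p (Suc k) = p k - ((\<lambda>z. bergman \<omega> R (snd (p k)) z *s u), y)"
    "prod_norm \<omega> R ((\<lambda>z. bergman \<omega> R (snd (p k)) z *s u), y) \<le> B k" by metis
  have "p k - p (Suc k) = ((\<lambda>z. bergman \<omega> R (snd (p k)) z *s u), y)" by (simp add: uy(1) prod_eq_iff fun_eq_iff)
  then show ?thesis using uy(2) by simp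
qed

lemma B_Suc: "B (Suc k) \<le> \<Lambda> * (B k)\<^sup>2"
proof -
  from newton_step_k[OF newton_inv[of k]] obtain u y where uy: 
    "p (Suc k) = p k - ((\<lambda>z. bergman \<omega> R (snd (p k)) z *s u), y)"
    "bergman \<omega> R (snd (p k)) (snd (p k)) *s u + frechet_derivative (fst (p k)) (at (snd (p k))) y = fst (p k) (snd (p k))"
    "prod_norm \<omega> R ((\<lambda>z. bergman \<omega> R (snd (p k)) z *s u), y) \<le> B k" by metis
  have X': "snd (p k) - y \<in> D" using p_snd[of "Suc k"] by (simp add: uy(1))
  show ?thesis
    using residual_bound[OF p_fst A2s_smult[OF bergman_in_A2[OF D_ball[OF p_snd]]] newton_inv_near(2)[OF newton_inv] p_snd X' uy(2) uy(3)]
    by (simp add: B_def uy(1))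
qed

lemma B_le: "B k \<le> (1 / 2) ^ (2 ^ k - 1) * \<beta>"
  using newton_inv[of k] by (simp add: newton_inv_def)

text \<open>Since \<open>B k \<le> \<beta>\<close>, one factor \<open>\<Lambda> * B k\<close> of the
  quadratic recursion is at most 1/2.\<close>

lemma B_half: "B (Suc k) \<le> B k / 2"
proof -
  have "(1 / 2 :: real) ^ (2 ^ k - 1) * \<beta> \<le> 1 * \<beta>" by (intro mult_right_mono power_le_one \<beta>_nonneg) auto
  then have "B k \<le> \<beta>" using B_le[of k] by simp
  then have "\<Lambda> * B k \<le> \<Lambda> * \<beta>" using \<Lambda>_nonneg by (rule mult_left_mono)
  then have "\<Lambda> * B k * B k \<le> (1 / 2) * B k" using \<Lambda>_\<beta> B_nonneg[of k] by (intro mult_right_mono) auto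
  then show ?thesis using B_Suc[of k] by (simp add: power2_eq_square)
qed

lemma B_shift: "B (k + j) \<le> B k * (1 / 2) ^ j"
proof (induction j)
  case (Suc j)
  then show ?case using B_half[of "k + j"] by simp
qed simp

lemma prod_norm_chain: "prod_norm \<omega> R (p k - p (k + m)) \<le> (\<Sum>j<m. B (k + j))"
proof (induction m)
  case 0
  have "A2s_norm \<omega> R (fst (p k) - fst (p k)) = 0"
    by (simp add: A2s_norm_def A2s_inner_def A2_inner_def set_lebesgue_integral_def)
  then show ?case using prod_inner_self(2)[of "p k - p k"] A2s_minus[OF p_fst[of k] p_fst[of k]] by (simp add: norm_Pair)
next
  case (Suc m)
  have "prod_norm \<omega> R (p k - p (k + Suc m)) \<le> prod_norm \<omega> R (p k - p (k + m)) + prod_norm \<omega> R (p (k + m) - p (Suc (k + m)))"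
    using prod_norm_dist_triangle[of "p k" "p (k + m)" "p (Suc (k + m))", OF p_fst p_fst p_fst] by simp
  then show ?case using Suc prod_norm_step[of "k + m"] by simp
qed

lemma prod_norm_chain_0: "prod_norm \<omega> R (p 0 - p m) \<le> c0 * \<beta>"
  using newton_inv_near(3)[OF newton_inv[of m]] by (simp add: prod_norm_minus_commute)

text \<open>A geometric series from \<open>B_half\<close>. The remaining distance is controlled by
  \<open>B k\<close> itself, as the quadratic rate requires; the sharper \<open>c0\<close> matters
  only for the distance from the start.\<close>

lemma prod_norm_chain_k: "prod_norm \<omega> R (p k - p (k + m)) \<le> 2 * B k"
proof -
  have "(\<Sum>j<m. B (k + j)) \<le> (\<Sum>j<m. B k * (1 / 2) ^ j)" by (intro sum_mono B_shift)
  also have "\<dots> = B k * (\<Sum>j<m. (1 / 2) ^ j)" by (simp add: sum_distrib_left)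
  also have "\<dots> \<le> B k * 2"
    by (intro mult_left_mono B_nonneg) (simp add: geometric_sum)
  finally show ?thesis using prod_norm_chain[of k m] by simp
qed

lemma B_summable: "summable B"
proof (rule summable_comparison_test)
  show "\<exists>N. \<forall>k\<ge>N. norm (B k) \<le> B 0 * (1 / 2) ^ k" using B_shift[of 0] B_nonneg by auto
  show "summable (\<lambda>k. B 0 * (1 / 2) ^ k)" by (intro summable_mult) (simp add: summable_geometric)
qed

lemma D_ratio:
  obtains r where "r < 1" "\<And>z. z \<in> D \<Longrightarrow> norm (z - \<omega>) / R \<le> r"
proof
  have am: "amin \<le> 1" using A_bounds[OF p_snd[of 0]] by linarith
  show "sqrt (1 - amin) < 1" using amin_pos by simp
  fix z assume "z \<in> D"
  then have "(norm (z - \<omega>) / R)\<^sup>2 \<le> 1 - amin" using A_bounds(1)[of z] by (simp add: A_def)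
  then show "norm (z - \<omega>) / R \<le> sqrt (1 - amin)" by (rule real_le_rsqrt)
qed

text \<open>The function part of each iterate is \<open>f\<close> minus a partial sum of kernels
  times vectors, with base points in \<open>D\<close> and summable coefficients. The full series
  lies in the space by \<open>bergman_series_A2\<close>, and its tails are uniformly small, hence
  small in norm. The points converge because their steps are summable, and \<open>D\<close> is
  closed.\<close>

lemma newton_limit:
  obtains g y where "g \<in> A2s \<omega> R" "y \<in> D" "(\<lambda>k. prod_norm \<omega> R (p k - (g, y))) \<longlonglongrightarrow> 0"
proof -
  have "\<forall>k. \<exists>u. \<exists>y. p (Suc k) = p k - ((\<lambda>z. bergman \<omega> R (snd (p k)) z *s u), y) \<and> norm u \<le> B k / \<sigma> ^ (CARD('n) + 1)"
    using newton_step_k[OF newton_inv] by metis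
  then obtain u where "\<forall>k. \<exists>y. p (Suc k) = p k - ((\<lambda>z. bergman \<omega> R (snd (p k)) z *s u k), y) \<and> norm (u k) \<le> B k / \<sigma> ^ (CARD('n) + 1)"
    by metis
  then obtain v where uv: "\<And>k. p (Suc k) = p k - ((\<lambda>z. bergman \<omega> R (snd (p k)) z *s u k), v k)" 
    "\<And>k. norm (u k) \<le> B k / \<sigma> ^ (CARD('n) + 1)" by metis
  define W where "W k = snd (p k)" for k
  obtain r where r: "r < 1" "\<And>z. z \<in> D \<Longrightarrow> norm (z - \<omega>) / R \<le> r" using D_ratio by blast
  have W: "norm (W j - \<omega>) / R \<le> r" for j unfolding W_def by (rule r(2)[OF p_snd])
  have su: "summable (\<lambda>k. norm (u k))"
  proof (rule summable_comparison_test)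
    show "\<exists>N. \<forall>k\<ge>N. norm (norm (u k)) \<le> B k / \<sigma> ^ (CARD('n) + 1)" using uv(2) by simp
    show "summable (\<lambda>k. B k / \<sigma> ^ (CARD('n) + 1))" by (rule summable_divide[OF B_summable])
  qed
  have sui: "summable (\<lambda>k. cmod (u k $ i))" for i
    by (rule summable_comparison_test[OF _ su]) (intro exI[of _ 0] allI impI, simp add: Finite_Cartesian_Product.norm_nth_le)
  define H where "H z = (\<chi> i. \<Sum>j. bergman \<omega> R (W j) z * u j $ i)" for z
  have H: "H \<in> A2s \<omega> R" unfolding A2s_def H_def using bergman_series_A2(1)[OF W r(1) sui] by simp
  define g where "g = f - H"
  have g: "g \<in> A2s \<omega> R" unfolding g_def by (rule A2s_minus[OF f H])
  have Fk: "fst (p k) z = f z - (\<Sum>j<k. bergman \<omega> R (W j) z *s u j)" for k z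
    by (induction k) (simp_all add: p0 uv(1) W_def)
  define C where "C = 1 / (1 - r) ^ (CARD('n) + 1)"
  have su_t: "summable (\<lambda>j. C * norm (u (j + k)))" for k
    by (intro summable_mult summable_ignore_initial_segment su)
  have diff_bound: "norm ((fst (p k) - g) z) \<le> (\<Sum>j. C * norm (u (j + k)))" for k z
  proof -
    define V where "V j = bergman \<omega> R (W j) z *s u j" for j
    have V: "norm (V j) \<le> C * norm (u j)" for j
      unfolding V_def norm_smult_vec C_def by (intro mult_right_mono bergman_bound W r(1)) simp
    have sV: "summable V" by (rule summable_comparison_test[OF _ summable_mult[OF su, of C]]) (use V in auto)
    have "H z = suminf V"
    proof -
      have "suminf V $ i = (\<Sum>j. V j $ i)" for i
        by (rule bounded_linear.suminf[OF bounded_linear_vec_nth sV])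
      then show ?thesis by (simp only: H_def vec_eq_iff vec_lambda_beta) (simp add: V_def)
    qed
    also have "\<dots> = (\<Sum>j. V (j + k)) + (\<Sum>j<k. V j)" by (rule suminf_split_initial_segment[OF sV])
    finally have "(fst (p k) - g) z = (\<Sum>j. V (j + k))" by (simp add: Fk g_def V_def)
    then show ?thesis using norm_suminf_le[OF V su_t] by simp
  qed
  obtain C' where C': "C' \<ge> 0" "\<And>(f :: complex ^ 'n \<Rightarrow> complex ^ 's) B. f \<in> A2s \<omega> R \<Longrightarrow> (\<And>z. norm (f z) \<le> B) \<Longrightarrow> A2s_norm \<omega> R f \<le> C' * B"
    using A2s_norm_le_sup by metis
  have gk: "A2s_norm \<omega> R (fst (p k) - g) \<le> C' * (\<Sum>j. C * norm (u (j + k)))" for k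
    by (rule C'(2)[OF A2s_minus[OF p_fst g] diff_bound])
  have "(\<lambda>k. C' * (\<Sum>j. C * norm (u (j + k)))) \<longlonglongrightarrow> C' * 0"
    by (intro tendsto_mult tendsto_const suminf_exist_split2 summable_mult su)
  then have "(\<lambda>k. C' * (\<Sum>j. C * norm (u (j + k)))) \<longlonglongrightarrow> 0" by simp
  then have lim1: "(\<lambda>k. A2s_norm \<omega> R (fst (p k) - g)) \<longlonglongrightarrow> 0"
    by (rule Lim_null_comparison[rotated]) (use gk A2s_norm_sq(3)[OF A2s_minus[OF p_fst g]] in simp)
  have vB: "norm (v k) \<le> B k" for k
  proof -
    have "fst (p k - p (Suc k)) \<in> A2s \<omega> R" using A2s_minus[OF p_fst p_fst] by simp
    then have "norm (snd (p k - p (Suc k))) \<le> B k" using norm_snd_le_prod_norm prod_norm_step[of k] order_trans by blast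
    then show ?thesis by (simp add: uv(1))
  qed
  have sv: "summable v" by (rule summable_comparison_test[OF _ B_summable]) (use vB in auto)
  have Wk: "W k = x - (\<Sum>j<k. v j)" for k unfolding W_def by (induction k) (simp_all add: p0 uv(1))
  define y where "y = x - suminf v"
  have Wy: "W \<longlonglongrightarrow> y"
    unfolding Wk[abs_def] y_def using summable_sums[OF sv] unfolding sums_def by (intro tendsto_diff tendsto_const)
  have y: "y \<in> D"
  proof (rule closed_sequentially[OF _ _ Wy])
    show "closed D" by (simp add: D_def)
    show "W k \<in> D" for k unfolding W_def by (rule p_snd)
  qed
  have lim2: "(\<lambda>k. norm (W k - y)) \<longlonglongrightarrow> 0" using Wy by (simp add: LIM_zero_iff tendsto_norm_zero)
  have pn: "prod_norm \<omega> R (p k - (g, y)) = sqrt ((A2s_norm \<omega> R (fst (p k) - g))\<^sup>2 + (norm (W k - y))\<^sup>2)" for k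
    using prod_inner_self(2)[of "p k - (g, y)"] A2s_minus[OF p_fst g] by (simp add: norm_Pair W_def)
  have "(\<lambda>k. prod_norm \<omega> R (p k - (g, y))) \<longlonglongrightarrow> sqrt (0\<^sup>2 + 0\<^sup>2)"
    unfolding pn by (intro tendsto_intros lim1 lim2)
  then have "(\<lambda>k. prod_norm \<omega> R (p k - (g, y))) \<longlonglongrightarrow> 0" by simp
  with g y show ?thesis using that by blast
qed

text \<open>The limit is a zero because the values along the sequence tend both to
  \<open>g y\<close> and to 0. For the rate, the error is at most \<open>2 * B k\<close>, and
  conversely \<open>g y = 0\<close> makes \<open>B k\<close> at most a constant times the error; the
  recursion for \<open>B\<close> thus becomes quadratic in the error.\<close>

lemma newton_converges:
  obtains g y where "g \<in> A2s \<omega> R" "y \<in> ball \<omega> R" "converges_quadratically (prod_norm \<omega> R) p (g, y)" "g y = 0"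
    "prod_norm \<omega> R (p 0 - (g, y)) \<le> c0 * \<beta>"
proof -
  obtain g y where g: "g \<in> A2s \<omega> R" and y: "y \<in> D" and lim: "(\<lambda>k. prod_norm \<omega> R (p k - (g, y))) \<longlonglongrightarrow> 0"
    using newton_limit by blast
  let ?l = "(g, y)"
  have l: "fst ?l \<in> A2s \<omega> R" using g by simp
  have dfst: "fst (p k - ?l) \<in> A2s \<omega> R" for k using A2s_minus[OF p_fst g] by simp
  \<comment> \<open>A bound uniform in \<open>m\<close> passes to the limit through the triangle
    inequality.\<close>
  have lim_le: "prod_norm \<omega> R (p k - ?l) \<le> E" if "\<And>m. prod_norm \<omega> R (p k - p (k + m)) \<le> E" for k E
  proof (rule LIMSEQ_le_const)
    have "(\<lambda>m. prod_norm \<omega> R (p (m + k) - ?l)) \<longlonglongrightarrow> 0" using lim by (rule LIMSEQ_ignore_initial_segment)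
    then have "(\<lambda>m. E + prod_norm \<omega> R (p (m + k) - ?l)) \<longlonglongrightarrow> E + 0" by (intro tendsto_intros)
    then show "(\<lambda>m. E + prod_norm \<omega> R (p (m + k) - ?l)) \<longlonglongrightarrow> E" by simp
    show "\<exists>N. \<forall>m\<ge>N. prod_norm \<omega> R (p k - ?l) \<le> E + prod_norm \<omega> R (p (m + k) - ?l)"
    proof (intro exI allI impI)
      fix m
      show "prod_norm \<omega> R (p k - ?l) \<le> E + prod_norm \<omega> R (p (m + k) - ?l)"
        using prod_norm_dist_triangle[OF p_fst[of k] p_fst[of "k + m"] l] that[of m] by (simp add: add.commute)
    qed
  qed
  have final: "prod_norm \<omega> R (p 0 - ?l) \<le> c0 * \<beta>"
    by (rule lim_le) (use prod_norm_chain_0 in simp)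
  have tail: "prod_norm \<omega> R (p k - ?l) \<le> 2 * B k" for k
    by (rule lim_le) (rule prod_norm_chain_k)
  \<comment> \<open>A bound for evaluation at points of \<open>D\<close> plus a Lipschitz constant
    of \<open>g\<close> on \<open>D\<close>.\<close>
  define L where "L = 1 / \<sigma> ^ (CARD('n) + 1) + sqrt ((real CARD('n) + 1) * (real CARD('n) + 2)) * A2s_norm \<omega> R g / (R * \<sigma> ^ (CARD('n) + 3))"
  have residual: "norm (fst (p k) (snd (p k)) - g y) \<le> L * prod_norm \<omega> R (p k - ?l)" for k
  proof -
    define X where "X = snd (p k)"
    have X: "X \<in> D" unfolding X_def by (rule p_snd)
    have "norm ((fst (p k) - g) X) \<le> A2s_norm \<omega> R (fst (p k) - g) / \<sigma> ^ (CARD('n) + 1)"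
      by (rule A2s_norm_at[OF A2s_minus[OF p_fst g] D_ball[OF X] \<sigma>_pos]) (use A_bounds(1)[OF X] in \<open>simp add: \<sigma>_sq A_def\<close>)
    also have "\<dots> \<le> prod_norm \<omega> R (p k - ?l) / \<sigma> ^ (CARD('n) + 1)"
      using A2s_norm_le_prod_norm[OF dfst[of k]] \<sigma>_pos by (intro divide_right_mono) auto
    finally have 1: "norm ((fst (p k) - g) X) \<le> 1 / \<sigma> ^ (CARD('n) + 1) * prod_norm \<omega> R (p k - ?l)" by simp
    have "norm (g (y + (X - y)) - g y) \<le> sqrt ((real CARD('n) + 1) * (real CARD('n) + 2)) * A2s_norm \<omega> R g * norm (X - y) / (R * \<sigma> ^ (CARD('n) + 3))"
      by (rule A2s_increment_bound[OF g \<sigma>_pos segment_bounds]) (use X y in auto)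
    also have "\<dots> \<le> sqrt ((real CARD('n) + 1) * (real CARD('n) + 2)) * A2s_norm \<omega> R g * prod_norm \<omega> R (p k - ?l) / (R * \<sigma> ^ (CARD('n) + 3))"
      using norm_snd_le_prod_norm[OF dfst[of k]] \<sigma>_pos R A2s_norm_sq(3)[OF g]
      by (intro divide_right_mono mult_left_mono) (auto simp: X_def)
    finally have 2: "norm (g X - g y) \<le> sqrt ((real CARD('n) + 1) * (real CARD('n) + 2)) * A2s_norm \<omega> R g / (R * \<sigma> ^ (CARD('n) + 3)) * prod_norm \<omega> R (p k - ?l)" by simp
    have "fst (p k) X - g y = (fst (p k) - g) X + (g X - g y)" by simp
    then have "norm (fst (p k) X - g y) \<le> norm ((fst (p k) - g) X) + norm (g X - g y)" by (metis norm_triangle_ineq)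
    then show ?thesis using 1 2 by (simp only: L_def distrib_right X_def)
  qed
  have "(\<lambda>k. L * prod_norm \<omega> R (p k - ?l)) \<longlonglongrightarrow> L * 0" by (intro tendsto_intros lim)
  then have L0: "(\<lambda>k. L * prod_norm \<omega> R (p k - ?l)) \<longlonglongrightarrow> 0" by simp
  have val: "norm (fst (p k) (snd (p k))) \<le> B k / \<sigma> ^ (CARD('n) + 1)" for k
  proof -
    have "\<sigma> ^ (CARD('n) + 1) \<le> sqrt (A (snd (p k))) ^ (CARD('n) + 1)"
      unfolding \<sigma>_def using A_bounds(1)[OF p_snd[of k]] amin_pos by (intro power_mono real_sqrt_le_mono) auto
    then show ?thesis using \<sigma>_pos by (simp add: B_def field_simps mult_right_mono del: power_Suc)
  qed
  have B0: "B \<longlonglongrightarrow> 0" by (rule summable_LIMSEQ_zero[OF B_summable])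
  have "(\<lambda>k. B k / \<sigma> ^ (CARD('n) + 1)) \<longlonglongrightarrow> 0 / \<sigma> ^ (CARD('n) + 1)"
    using \<sigma>_pos by (intro tendsto_divide B0 tendsto_const) simp
  then have v0: "(\<lambda>k. B k / \<sigma> ^ (CARD('n) + 1)) \<longlonglongrightarrow> 0" by simp
  have "(\<lambda>k. L * prod_norm \<omega> R (p k - ?l) + B k / \<sigma> ^ (CARD('n) + 1)) \<longlonglongrightarrow> 0 + 0"
    by (intro tendsto_add L0 v0)
  moreover have "norm (g y) \<le> L * prod_norm \<omega> R (p k - ?l) + B k / \<sigma> ^ (CARD('n) + 1)" for k
    using residual[of k] val[of k] norm_triangle_ineq2[of "g y" "fst (p k) (snd (p k))"] norm_minus_commute[of "g y" "fst (p k) (snd (p k))"] by linarith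
  ultimately have "norm (g y) \<le> 0 + 0" by (intro LIMSEQ_le_const) auto
  then have gy: "g y = 0" by simp
  have BL: "B k \<le> L * prod_norm \<omega> R (p k - ?l)" for k
  proof -
    have A01: "0 \<le> A (snd (p k))" "A (snd (p k)) \<le> 1" using A_bounds[OF p_snd[of k]] amin_pos by auto
    have "B k \<le> 1 * norm (fst (p k) (snd (p k)))"
      unfolding B_def using A01 by (intro mult_right_mono power_le_one) auto
    then show ?thesis using residual[of k] gy by simp
  qed
  have "prod_norm \<omega> R (p (Suc k) - ?l) \<le> (2 * \<Lambda> * L\<^sup>2) * (prod_norm \<omega> R (p k - ?l))\<^sup>2" for k
  proof -
    have "prod_norm \<omega> R (p (Suc k) - ?l) \<le> 2 * (\<Lambda> * (B k)\<^sup>2)" using tail[of "Suc k"] B_Suc[of k] by simp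
    also have "\<dots> \<le> 2 * (\<Lambda> * (L * prod_norm \<omega> R (p k - ?l))\<^sup>2)"
      using \<Lambda>_nonneg B_nonneg[of k] by (intro mult_left_mono power_mono BL) auto
    finally show ?thesis by (simp add: power_mult_distrib mult_ac)
  qed
  then have "converges_quadratically (prod_norm \<omega> R) p ?l"
    unfolding converges_quadratically_def using lim by blast
  with g gy final D_ball[OF y] show ?thesis using that by blast
qed

end

theorem mainTheorem3:
  fixes \<omega> x :: "complex ^ 'n"
    and R \<nu> :: real
    and f :: "complex ^ 'n \<Rightarrow> complex ^ 's"
  assumes "CARD('n) \<ge> 2"
    and "R > 0"
    and "f \<in> A2s \<omega> R"
    and "x \<in> ball \<omega> R"
    and "\<nu> = norm (x - \<omega>) / R"
    and "c0 * (1 - \<nu>\<^sup>2) powr ((real CARD('n) + 1) / 2) * (norm (f x) / R) + \<nu> < 1"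
    and "(real CARD('n) + 1) * (real CARD('n) + 2) / 2
           * (1 - \<nu>\<^sup>2) powr ((real CARD('n) - 1) / 2)
           * (A2s_norm \<omega> R f / R * (1 / (1 - \<nu>\<^sup>2)) + 1)
           * (norm (f x) / R) \<le> alpha0"
  shows "(\<forall>k. newton_seq \<omega> R (f, x) k \<in> A2s \<omega> R \<times> ball \<omega> R) \<and>
         (\<exists>g y. g \<in> A2s \<omega> R \<and> y \<in> ball \<omega> R \<and>
            converges_quadratically (prod_norm \<omega> R) (newton_seq \<omega> R (f, x)) (g, y) \<and>
            g y = 0 \<and>
            sqrt ((A2s_norm \<omega> R (f - g))\<^sup>2 + (norm (x - y))\<^sup>2)
              \<le> c0 * (1 - \<nu>\<^sup>2) powr ((real CARD('n) + 1) / 2) * norm (f x))"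
proof -
  let ?n = "CARD('n)"
  define a where "a = 1 - \<nu>\<^sup>2"
  define \<beta> where "\<beta> = sqrt a ^ (?n + 1) * norm (f x)"
  define N where "N = (real ?n + 1) * (real ?n + 2) / 2"
  define \<Phi> where "\<Phi> = A2s_norm \<omega> R f / (R * a)"
  interpret bergman_ball \<omega> R by standard (rule assms(2))
  have "0 \<le> \<nu>" "\<nu> < 1" using assms(2,4,5) ball_ratio by auto
  then have a: "a > 0" unfolding a_def by (simp add: power_less_one_iff abs_square_less_1)
  \<comment> \<open>\<open>CARD('n) + 1\<close> may be odd, so natural powers of
    \<open>sqrt a\<close> replace the real exponent.\<close>
  have pw: "a powr ((real ?n + 1) / 2) = sqrt a ^ (?n + 1)"
  proof -
    have "sqrt a ^ (?n + 1) = (a powr (1 / 2)) powr (real (?n + 1))"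
      using a powr_realpow[of "sqrt a" "?n + 1"] by (simp only: powr_half_sqrt real_sqrt_gt_0_iff)
    then show ?thesis by (simp add: powr_powr add.commute)
  qed
  \<comment> \<open>The two exponents differ by exactly 1, so the second hypothesis can be written
    with \<open>\<beta> / a\<close>.\<close>
  have pw': "a powr ((real ?n - 1) / 2) = sqrt a ^ (?n + 1) / a"
  proof -
    have "(t + 1) / 2 = (t - 1) / 2 + 1" for t :: real by (simp add: field_simps)
    from this[of "real ?n"]
    have "sqrt a ^ (?n + 1) = a powr ((real ?n - 1) / 2) * a"
      unfolding pw[symmetric] using a by (simp only: powr_add powr_one)
    then show ?thesis using a by simp
  qed
  have "N * (\<Phi> + 1) * (\<beta> / (R * a)) \<le> alpha0"
    using assms(7) unfolding a_def[symmetric] pw' by (simp add: N_def \<Phi>_def \<beta>_def mult_ac)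
  then have small: "N * (\<Phi> + 1) * (\<beta> / (R * a)) \<le> 132 / 1000" using alpha0_le by linarith
  interpret newton_setup \<omega> R f x a \<beta> N \<Phi>
    by standard (use assms small in \<open>auto simp: a_def \<beta>_def N_def \<Phi>_def\<close>)
  have p_eq: "newton_seq \<omega> R (f, x) = p" by (simp add: fun_eq_iff p_def)
  obtain g y where gy: "g \<in> A2s \<omega> R" "y \<in> ball \<omega> R" "converges_quadratically (prod_norm \<omega> R) p (g, y)" "g y = 0"
    "prod_norm \<omega> R (p 0 - (g, y)) \<le> c0 * \<beta>" using newton_converges by blast
  have "prod_norm \<omega> R (p 0 - (g, y)) = sqrt ((A2s_norm \<omega> R (f - g))\<^sup>2 + (norm (x - y))\<^sup>2)"
    using prod_inner_self(2)[of "p 0 - (g, y)"] A2s_minus[OF assms(3) gy(1)] by (simp add: p0 norm_Pair)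
  then have "sqrt ((A2s_norm \<omega> R (f - g))\<^sup>2 + (norm (x - y))\<^sup>2) \<le> c0 * (1 - \<nu>\<^sup>2) powr ((real ?n + 1) / 2) * norm (f x)"
    using gy(5) unfolding a_def[symmetric] pw by (simp add: \<beta>_def mult.assoc)
  moreover have "\<forall>k. p k \<in> A2s \<omega> R \<times> ball \<omega> R"
    using p_fst D_ball[OF p_snd] by (simp add: mem_Times_iff)
  ultimately show ?thesis unfolding p_eq using gy by blast
qed

end
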